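(* Let $z\sim N(0,I_n)$ and let $f=(f_1,\dots,f_n):\mathbb R^n\to\mathbb R^n$ be such that each coordinate $f_i$ is weakly differentiable with $\mathbb E[f_i(z)^2]+\mathbb E[\|\nabla f_i(z)\|^2]<+\infty$, and suppose $\mathbb E[f(z)]\neq 0$. Let $\xi=z^\top f(z)-\operatorname{div} f(z)$, let $Z=z^\top\mathbb E[f(z)]/\|\mathbb E[f(z)]\|$ (so $Z\sim N(0,1)$), and set $$\epsilon_1^2=1-\frac{\|\mathbb E[f(z)]\|^2}{\operatorname{Var}[\xi]},\qquad \bar\epsilon_1^2=\frac{2\,\mathbb E[\|\{\nabla f(z)\}^s\|_F^2]}{\|\mathbb E[f(z)]\|^2+2\,\mathbb E[\|\{\nabla f(z)\}^s\|_F^2]}.$$ Then there is a deterministic real $c_1\in[1/4,1]$ such that $$\mathbb E\Big[\Big(\frac{\xi}{\operatorname{Var}[\xi]^{1/2}}-Z\Big)^2\Big]=\epsilon_1^2+\big(1-(1-\epsilon_1^2)^{1/2}\big)^2=\epsilon_1^2+c_1\epsilon_1^4,$$ and $$\epsilon_1^2\le\bar\epsilon_1^2\le\frac{2\,\mathbb E[\|\nabla f(z)\|_F^2]}{\mathbb E[\|f(z)\|^2]+\mathbb E[\|\nabla f(z)\|_F^2]}.$$ Consequently, with $C=1+(2\pi)^{-1/2}$, $$\sup_{t\in\mathbb R}\Big|\mathbb P\big(\xi/\operatorname{Var}[\xi]^{1/2}\le t\big)-\mathbb P(Z\le t)\Big|\le C\,(\epsilon_1^2+c_1\epsilon_1^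4)^{1/3}.$$
   Context: $\|\cdot\|$ is the Euclidean norm, $\|\cdot\|_F$ the Frobenius norm. For $f:\mathbb R^n\to\mathbb R^n$, $\nabla f(x)\in\mathbb R^{n\times n}$ is the matrix whose columns are the weak gradients $\nabla f_1(x),\dots,\nabla f_n(x)$ (the transpose of the Jacobian), and $\operatorname{div} f(x)=\operatorname{trace}[\nabla f(x)]$. For a square matrix $M$, $M^s=(M+M^\top)/2$. *)

theory Defs
  imports "HOL-Analysis.Analysis" "HOL-Probability.Probability"
begin

definition std_gaussian_vector :: "'a measure \<Rightarrow> ('a \<Rightarrow> real ^ 'n) \<Rightarrow> bool" where
  "std_gaussian_vector M z \<longleftrightarrow>
     distributed M lborel z (\<lambda>x. ennreal (\<Prod>i\<in>UNIV. std_normal_density (x $ i)))"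

text \<open>Square integrability, that is, measurability together with a finite second moment;
  \<open>integrable\<close> applied to the squared norm alone would say nothing about the
  measurability of \<open>X\<close> itself.\<close>

definition square_integrable ::
    "'a measure \<Rightarrow> ('a \<Rightarrow> 'b::{second_countable_topology, real_normed_vector}) \<Rightarrow> bool" where
  "square_integrable M X \<longleftrightarrow>
     X \<in> borel_measurable M \<and> integrable M (\<lambda>\<omega>. (norm (X \<omega>))\<^sup>2)"

definition partial_deriv :: "'n \<Rightarrow> (real ^ 'n \<Rightarrow> real) \<Rightarrow> real ^ 'n \<Rightarrow> real" where
  "partial_deriv j \<phi> x = frechet_derivative \<phi> (at x) (axis j 1)"

primrec Ck :: "nat \<Rightarrow> (real ^ 'n \<Rightarrow> real) \<Rightarrow> bool" where
  "Ck 0 \<phi> \<longleftrightarrow> continuous_on UNIV \<phi>"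
| "Ck (Suc k) \<phi> \<longleftrightarrow> (\<forall>x. \<phi> differentiable (at x)) \<and> (\<forall>j. Ck k (partial_deriv j \<phi>))"

definition test_function :: "(real ^ 'n \<Rightarrow> real) \<Rightarrow> bool" where
  "test_function \<phi> \<longleftrightarrow> (\<forall>k. Ck k \<phi>) \<and> compact (closure {x. \<phi> x \<noteq> 0})"

definition locally_integrable :: "(real ^ 'n \<Rightarrow> 'b::euclidean_space) \<Rightarrow> bool" where
  "locally_integrable u \<longleftrightarrow> (\<forall>K. compact K \<longrightarrow> u absolutely_integrable_on K)"

text \<open>Weak gradients are determined only up to Lebesgue-null sets, so they are given by
  a relation: \<open>u\<close> is weakly differentiable iff it has some weak gradient \<open>g\<close>.\<close>

definition weak_gradient :: "(real ^ 'n \<Rightarrow> real) \<Rightarrow> (real ^ 'n \<Rightarrow> real ^ 'n) \<Rightarrow> bool" where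
  "weak_gradient u g \<longleftrightarrow>
     locally_integrable u \<and> locally_integrable g \<and>
     (\<forall>\<phi> j. test_function \<phi> \<longrightarrow>
        (\<integral>x. u x * partial_deriv j \<phi> x \<partial>lebesgue) = - (\<integral>x. g x $ j * \<phi> x \<partial>lebesgue))"

text \<open>The columns of \<open>G x\<close> are the gradients of the coordinates of \<open>f\<close>, so \<open>G x\<close> is the
  transpose of the Jacobian matrix.\<close>

definition weak_gradient_matrix ::
    "(real ^ 'n \<Rightarrow> real ^ 'n) \<Rightarrow> (real ^ 'n \<Rightarrow> real ^ 'n ^ 'n) \<Rightarrow> bool" where
  "weak_gradient_matrix f G \<longleftrightarrow>
     (\<forall>i. weak_gradient (\<lambda>x. f x $ i) (\<lambda>x. column i (G x)))"

definition sym_part :: "real ^ 'n ^ 'n \<Rightarrow> real ^ 'n ^ 'n" where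
  "sym_part A = (1 / 2) *\<^sub>R (A + transpose A)"

text \<open>The library norm on matrices, seen as vectors of vectors, is the Frobenius norm.\<close>

lemma norm_matrix_frobenius:
  fixes A :: "real ^ 'n ^ 'm"
  shows "norm A = sqrt (\<Sum>i\<in>UNIV. \<Sum>j\<in>UNIV. (A $ i $ j)\<^sup>2)"
  by (simp add: norm_vec_def L2_set_def sum_nonneg)

end

theory Submission
  imports Defs "HOL-Real_Asymp.Real_Asymp"
begin

text \<open>
  Everything rests on two facts about \<open>\<xi> = z \<bullet> f(z) - div f(z)\<close>: the Gaussian integration by
  parts \<open>E[\<xi> h(z)] = E[f(z) \<bullet> \<nabla>h(z)]\<close>, which for \<open>h\<close> constant or linear gives \<open>E \<xi> = 0\<close> and
  \<open>E[\<xi> Z] = \<parallel>E f(z)\<parallel>\<close>, and the second-order Stein inequality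
  \<open>Var \<xi> \<le> E \<parallel>f(z)\<parallel>\<^sup>2 + E trace ((\<nabla>f(z))\<^sup>2)\<close>.  Combined with the Gaussian Poincare inequality
  for each coordinate of \<open>f\<close>, the latter yields \<open>Var \<xi> \<le> \<parallel>E f(z)\<parallel>\<^sup>2 + 2 E \<parallel>sym \<nabla>f(z)\<parallel>\<^sup>2\<close>, hence the
  bounds on \<open>\<epsilon>\<^sub>1\<close>; the \<open>L\<^sup>2\<close> distance between \<open>\<xi> / sqrt (Var \<xi>)\<close> and \<open>Z\<close> is then elementary, and
  Chebyshev's inequality with a shift of size \<open>\<delta>\<close>, optimised in \<open>\<delta>\<close>, controls the Kolmogorov
  distance.

  For compactly supported \<open>C\<^sup>2\<close> functions the second-order identity follows by integrating by parts
  twice, and the Poincare inequality by tensorising the one-dimensional case.  Cutting off and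
  mollifying a weakly differentiable function approximates it, together with its weak gradient, in
  \<open>L\<^sup>2\<close> of the Gaussian measure, so that the inequalities survive in the limit (by Fatou for \<open>\<xi>\<close>).
\<close>

section \<open>Smooth bump functions and test functions\<close>

text \<open>For weakly differentiable \<open>f\<close> the second-order identity survives only as an
  inequality: the approximants and their gradients converge in Gaussian L2, but \<open>x $ i\<close>
  is unbounded, so the products \<open>x $ i * w x\<close> are controlled only in L1. Fatou then
  yields an upper bound for Var \<xi>, which is all that is asked of it. The opposite bound, Var
  \<xi> at least the squared norm of m = E f(z), is Cauchy-Schwarz applied to E[\<xi> Z] = norm m.

  The link to the symmetric part is the identity 2 |sym A|^2 = |A|^2 + trace (A^2) for Frobenius
  norms. Poincare replaces E |f(z)|^2 by |m|^2 + E |grad f(z)|^2, and this supplies precisely the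
  missing |A|^2; a constant larger than 1 would spoil the match.

  Weak gradients may be tested only against infinitely differentiable functions of compact support.
  This forces cutoffs and kernels that are smooth of every order, although the identities themselves
  use just two derivatives.\<close>

text \<open>The factors \<open>x ^ k\<close> make the family closed (up to linear combinations) under
  differentiation, see \<open>DERIV_bexp\<close>.\<close>

definition bexp :: "nat \<Rightarrow> real \<Rightarrow> real" where
  "bexp k x = (if 0 < x then exp (- 1 / x) / x ^ k else 0)"

lemma bexp_nonneg: "0 \<le> bexp k x"
  by (simp add: bexp_def)

lemma bexp_nonpos [simp]: "x \<le> 0 \<Longrightarrow> bexp k x = 0"
  by (simp add: bexp_def)

text \<open>With y = 1/x this is y^2 exp (-y) \<le> 2, from the quadratic Taylor bound. As
  \<open>bexp 2\<close> is the derivative of \<open>bexp 0\<close>, it keeps the gradients of the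
  cutoffs bounded uniformly in the radius.\<close>

lemma bexp_2_le_2: "bexp 2 x \<le> 2"
proof (cases "0 < x")
  case True
  have "(1 / x)\<^sup>2 / 2 \<le> exp (1 / x)"
    using exp_lower_Taylor_quadratic[of "1 / x"] True by (smt (verit) divide_pos_pos)
  then have "(1 / x)\<^sup>2 * exp (- 1 / x) \<le> (2 * exp (1 / x)) * exp (- 1 / x)"
    by (intro mult_right_mono) auto
  also have "\<dots> = 2"
    by (simp add: exp_minus)
  finally have "(1 / x)\<^sup>2 * exp (- 1 / x) \<le> 2" .
  then show ?thesis
    using True by (simp add: bexp_def power_divide)
qed simp

lemma bexp_tendsto_0: "(bexp k \<longlongrightarrow> 0) (at_right 0)"
proof -
  have "((\<lambda>y::real. y ^ k / exp y) \<longlongrightarrow> 0) at_top"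
    by (rule tendsto_power_div_exp_0)
  then have "((\<lambda>x::real. inverse x ^ k / exp (inverse x)) \<longlongrightarrow> 0) (at_right 0)"
    by (rule filterlim_compose) (rule filterlim_inverse_at_top_right)
  then show ?thesis
    by (rule Lim_transform_eventually)
       (auto simp: eventually_at_filter bexp_def exp_minus field_simps)
qed

text \<open>For x > 0, put y = 1/x and differentiate exp (-y) y^k using dy/dx = -y^2. The branches
  are glued at 0, where every \<open>bexp j\<close> tends to 0.\<close>

lemma DERIV_bexp:
  "(bexp k has_real_derivative (bexp (k + 2) x - of_nat k * bexp (k + 1) x)) (at x)"
proof -
  consider "x > 0" | "x = 0" | "x < 0" by linarith
  then show ?thesis
  proof cases
    case 1
    define y where "y = inverse x"
    have y: "bexp j x = exp (- y) * y ^ j" for j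
      using 1 by (simp add: bexp_def y_def divide_inverse power_inverse)
    \<comment> \<open>For k = 0 the exponent k - 1 is truncated to 0, but the factor
      \<open>of_nat k\<close> vanishes.\<close>
    have p: "of_nat k * y ^ (k - 1) * y\<^sup>2 = of_nat k * y ^ (k + 1)"
      unfolding power2_eq_square by (cases k) simp_all
    have "((\<lambda>x. exp (- inverse x) * inverse x ^ k) has_real_derivative
        exp (- y) * y\<^sup>2 * y ^ k - exp (- y) * (of_nat k * y ^ (k - 1) * y\<^sup>2)) (at x)"
      using 1 by (auto intro!: derivative_eq_intros simp: y_def power2_eq_square algebra_simps)
    also have "exp (- y) * y\<^sup>2 * y ^ k - exp (- y) * (of_nat k * y ^ (k - 1) * y\<^sup>2) =
        bexp (k + 2) x - of_nat k * bexp (k + 1) x"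
      unfolding p y by (simp add: power_add power2_eq_square algebra_simps)
    also have "(\<lambda>x::real. exp (- inverse x) * inverse x ^ k) = (\<lambda>x. exp (- 1 / x) / x ^ k)"
      by (simp add: divide_inverse power_inverse)
    finally have "((\<lambda>x. exp (- 1 / x) / x ^ k) has_real_derivative
        (bexp (k + 2) x - of_nat k * bexp (k + 1) x)) (at x)" .
    then show ?thesis
      using has_field_derivative_transform_within_open[of _ _ x "{0<..}" "bexp k"] 1
      by (auto simp: bexp_def)
  next
    case 2
    have "(bexp (Suc k) \<longlongrightarrow> 0) (at 0)"
      unfolding filterlim_at_split
    proof
      show "(bexp (Suc k) \<longlongrightarrow> 0) (at_left 0)"
        by (rule Lim_transform_eventually[where f="\<lambda>_. 0"])
           (auto simp: eventually_at_filter)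
    qed (rule bexp_tendsto_0)
    \<comment> \<open>The difference quotient at 0 is \<open>bexp (Suc k) h\<close> itself: dividing
      by h raises the index by one, and for h < 0 both sides are 0.\<close>
    then have "((\<lambda>h. (bexp k (0 + h) - bexp k 0) / h) \<longlongrightarrow> 0) (at 0)"
      by (rule Lim_transform_eventually)
         (auto simp: eventually_at_filter bexp_def divide_simps)
    then show ?thesis
      using 2 by (simp add: DERIV_def)
  next
    case 3
    have "((\<lambda>x. 0) has_real_derivative 0) (at x)"
      by simp
    then show ?thesis
      using has_field_derivative_transform_within_open[of "\<lambda>_. 0" 0 x "{..<0}" "bexp k"] 3
      by auto
  qed
qed

lemma isCont_bexp: "isCont (bexp k) x"
  by (rule DERIV_isCont[OF DERIV_bexp])

text \<open>\<open>Ck k\<close> for all \<open>k\<close> is most easily obtained for a class of functions closed under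
  partial derivatives; this one contains the cutoffs and mollifiers needed below.\<close>

inductive smooth_fn :: "(real ^ 'n \<Rightarrow> real) \<Rightarrow> bool" where
  smooth_const: "smooth_fn (\<lambda>x. c)"
| smooth_coord: "smooth_fn (\<lambda>x. x $ i)"
| smooth_bexp: "smooth_fn q \<Longrightarrow> smooth_fn (\<lambda>x. bexp k (q x))"
| smooth_add: "smooth_fn p \<Longrightarrow> smooth_fn q \<Longrightarrow> smooth_fn (\<lambda>x. p x + q x)"
| smooth_mult: "smooth_fn p \<Longrightarrow> smooth_fn q \<Longrightarrow> smooth_fn (\<lambda>x. p x * q x)"

lemma smooth_diff:
  assumes "smooth_fn p" "smooth_fn q"
  shows "smooth_fn (\<lambda>x. p x - q x)"
  using smooth_add[OF assms(1) smooth_mult[OF smooth_const[of "-1"] assms(2)]] by simp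

lemma smooth_sum:
  assumes "finite I" "\<And>i. i \<in> I \<Longrightarrow> smooth_fn (p i)"
  shows "smooth_fn (\<lambda>x. \<Sum>i\<in>I. p i x)"
  using assms by (induction I rule: finite_induct) (auto intro: smooth_fn.intros)

lemma partial_derivI:
  assumes "(\<phi> has_derivative D) (at x)"
  shows "partial_deriv j \<phi> x = D (axis j 1)"
  unfolding partial_deriv_def using frechet_derivative_at[OF assms] by simp

text \<open>Differentiability and closure go through one induction, because each partial derivative
  is identified from the Frechet derivatives of the components.\<close>

lemma smooth_fn_partial_deriv:
  fixes \<phi> :: "real ^ 'n \<Rightarrow> real"
  assumes "smooth_fn \<phi>"
  shows "(\<forall>x. \<phi> differentiable (at x)) \<and> (\<forall>j. smooth_fn (partial_deriv j \<phi>))"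
  using assms
proof induction
  case (smooth_const c)
  have "partial_deriv j (\<lambda>x. c) = (\<lambda>x. 0)" for j :: 'n
    by (rule ext, rule partial_derivI) simp
  then show ?case by (auto intro: smooth_fn.intros)
next
  case (smooth_coord i)
  have d: "((\<lambda>x::real^'n. x $ i) has_derivative (\<lambda>x. x $ i)) (at x)" for x
    by (rule bounded_linear_imp_has_derivative) (rule bounded_linear_vec_nth)
  have "partial_deriv j (\<lambda>x. x $ i) = (\<lambda>x. axis j 1 $ i)" for j :: 'n
    by (rule ext, rule partial_derivI) (rule d)
  then show ?case using d by (auto intro: smooth_fn.intros simp: differentiable_def)
next
  case (smooth_bexp q k)
  define b where "b = (\<lambda>x. bexp (k + 2) x - of_nat k * bexp (k + 1) x)"
  have q: "(q has_derivative frechet_derivative q (at x)) (at x)" for x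
    using smooth_bexp.IH frechet_derivative_works by blast
  have d: "((\<lambda>x. bexp k (q x)) has_derivative (\<lambda>h. b (q x) * frechet_derivative q (at x) h)) (at x)" for x
    using has_derivative_compose[OF q DERIV_bexp[of k "q x", unfolded has_field_derivative_def]]
    by (simp add: b_def)
  have "partial_deriv j (\<lambda>x. bexp k (q x)) = (\<lambda>x. b (q x) * partial_deriv j q x)" for j :: 'n
    by (rule ext, subst partial_derivI[OF d]) (simp add: partial_deriv_def)
  moreover have "smooth_fn (\<lambda>x. b (q x))"
    unfolding b_def by (intro smooth_diff smooth_fn.intros smooth_bexp.hyps)
  ultimately show ?case using d smooth_bexp.IH
    by (auto simp: differentiable_def intro!: smooth_fn.intros)
next
  case (smooth_add p q)
  have p: "(p has_derivative frechet_derivative p (at x)) (at x)"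
   and q: "(q has_derivative frechet_derivative q (at x)) (at x)" for x
    using smooth_add.IH frechet_derivative_works by blast+
  note d = has_derivative_add[OF p q]
  have "partial_deriv j (\<lambda>x. p x + q x) = (\<lambda>x. partial_deriv j p x + partial_deriv j q x)" for j :: 'n
    by (rule ext, subst partial_derivI[OF d]) (simp add: partial_deriv_def)
  then show ?case using d smooth_add.IH
    by (auto simp: differentiable_def intro!: smooth_fn.intros)
next
  case (smooth_mult p q)
  have p: "(p has_derivative frechet_derivative p (at x)) (at x)"
   and q: "(q has_derivative frechet_derivative q (at x)) (at x)" for x
    using smooth_mult.IH frechet_derivative_works by blast+
  note d = has_derivative_mult[OF p q]
  have "partial_deriv j (\<lambda>x. p x * q x) = (\<lambda>x. p x * partial_deriv j q x + partial_deriv j p x * q x)" for j :: 'n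
    by (rule ext, subst partial_derivI[OF d]) (simp add: partial_deriv_def)
  then show ?case using d smooth_mult.IH smooth_mult.hyps
    by (auto simp: differentiable_def intro!: smooth_fn.intros)
qed

lemma smooth_fn_Ck: "smooth_fn \<phi> \<Longrightarrow> Ck k \<phi>"
proof (induction k arbitrary: \<phi>)
  case 0
  then show ?case
    using smooth_fn_partial_deriv[of \<phi>]
    by (auto intro!: continuous_at_imp_continuous_on differentiable_imp_continuous_within)
next
  case (Suc k)
  then show ?case using smooth_fn_partial_deriv[of \<phi>] by auto
qed

lemma smooth_fn_continuous: "smooth_fn \<phi> \<Longrightarrow> continuous_on UNIV \<phi>"
  using smooth_fn_Ck[of \<phi> 0] by simp

lemma smooth_test_function:
  assumes "smooth_fn \<phi>" "\<And>x. norm x > R \<Longrightarrow> \<phi> x = 0"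
  shows "test_function \<phi>"
proof -
  have "{x. \<phi> x \<noteq> 0} \<subseteq> cball 0 R"
    using assms(2) by (force simp: dist_norm)
  then have "compact (closure {x. \<phi> x \<noteq> 0})"
    using bounded_subset[OF bounded_cball] compact_closure by blast
  then show ?thesis
    using smooth_fn_Ck[OF assms(1)] by (simp add: test_function_def)
qed

section \<open>Partial derivatives along coordinate lines\<close>

text \<open>Asking only for a derivative along the line, not for Frechet differentiability as in
  \<open>partial_deriv\<close>, reduces products, reflections and convolutions to one-variable
  calculus. On \<open>smooth_fn\<close> both notions agree
  (\<open>has_partial_partial_deriv\<close>).\<close>

definition has_partial :: "'n \<Rightarrow> (real ^ 'n \<Rightarrow> real) \<Rightarrow> (real ^ 'n \<Rightarrow> real) \<Rightarrow> bool" where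
  "has_partial j \<phi> \<phi>' \<longleftrightarrow>
     (\<forall>x. ((\<lambda>t. \<phi> (x + t *\<^sub>R axis j 1)) has_real_derivative \<phi>' x) (at 0))"

text \<open>The base point in \<open>has_partial\<close> is arbitrary, so a derivative at parameter
  0 gives one at every parameter t.\<close>

lemma has_partial_line:
  assumes "has_partial j \<phi> \<phi>'"
  shows "((\<lambda>t. \<phi> (x + t *\<^sub>R axis j 1)) has_real_derivative \<phi>' (x + t *\<^sub>R axis j 1)) (at t)"
proof -
  have "((\<lambda>s. \<phi> ((x + t *\<^sub>R axis j 1) + s *\<^sub>R axis j 1)) has_real_derivative \<phi>' (x + t *\<^sub>R axis j 1)) (at 0)"
    using assms by (simp add: has_partial_def)
  moreover have "(\<lambda>s. \<phi> ((x + t *\<^sub>R axis j 1) + s *\<^sub>R axis j 1)) = (\<lambda>s. \<phi> (x + (s + t) *\<^sub>R axis j 1))"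
    by (simp add: algebra_simps)
  ultimately show ?thesis
    using DERIV_shift[of "\<lambda>t. \<phi> (x + t *\<^sub>R axis j 1)" _ 0 t] by simp
qed

lemma has_partial_derivative:
  assumes "\<And>x. (\<phi> has_derivative D x) (at x)"
  shows "has_partial j \<phi> (\<lambda>x. D x (axis j 1))"
  unfolding has_partial_def
proof
  fix x
  have "((\<lambda>t. x + t *\<^sub>R axis j 1) has_derivative (\<lambda>t. t *\<^sub>R axis j (1::real))) (at 0)"
    by (auto intro!: derivative_eq_intros)
  from has_derivative_compose[OF this, of \<phi> "D x"] assms[of x]
  have "((\<lambda>t. \<phi> (x + t *\<^sub>R axis j 1)) has_derivative (\<lambda>t. D x (t *\<^sub>R axis j 1))) (at 0)"
    by simp
  moreover have "D x (t *\<^sub>R axis j 1) = D x (axis j 1) * t" for t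
    using linear_scale[OF has_derivative_linear[OF assms[of x]]] by simp
  ultimately show "((\<lambda>t. \<phi> (x + t *\<^sub>R axis j 1)) has_real_derivative D x (axis j 1)) (at 0)"
    by (simp add: has_field_derivative_def)
qed

lemma smooth_fn_has_partial:
  assumes "smooth_fn \<phi>"
  shows "has_partial j \<phi> (partial_deriv j \<phi>)"
  using has_partial_derivative[of \<phi> "\<lambda>x. frechet_derivative \<phi> (at x)" j] smooth_fn_partial_deriv[OF assms]
  by (simp add: partial_deriv_def[abs_def] frechet_derivative_works[symmetric])

lemma has_partial_unique: "has_partial j \<phi> a \<Longrightarrow> has_partial j \<phi> b \<Longrightarrow> a = b"
  by (rule ext) (auto simp: has_partial_def intro: DERIV_unique)

section \<open>Convolution and mollification\<close>

text \<open>Dominated convergence along sequences: by the mean value bound, \<open>g\<close>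
  dominates the difference quotients as soon as it dominates the derivative for every
  parameter.\<close>

lemma DERIV_integral:
  fixes f f' :: "real \<Rightarrow> 'b \<Rightarrow> real"
  assumes int: "\<And>t. integrable M (f t)"
    and deriv: "\<And>t y. y \<in> space M \<Longrightarrow> ((\<lambda>t. f t y) has_real_derivative f' t y) (at t)"
    and bound: "\<And>t y. y \<in> space M \<Longrightarrow> \<bar>f' t y\<bar> \<le> g y"
    and g: "integrable M g"
    and meas: "f' t \<in> borel_measurable M"
  shows "((\<lambda>t. \<integral>y. f t y \<partial>M) has_real_derivative (\<integral>y. f' t y \<partial>M)) (at t)"
proof -
  have "(\<lambda>i. ((\<integral>y. f (t + X i) y \<partial>M) - (\<integral>y. f t y \<partial>M)) / X i) \<longlonglongrightarrow> (\<integral>y. f' t y \<partial>M)"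
    if X: "\<And>i. X i \<noteq> 0" "X \<longlonglongrightarrow> 0" for X :: "nat \<Rightarrow> real"
  proof -
    have [measurable]: "f s \<in> borel_measurable M" for s
      using int[of s] by simp
    have "(\<lambda>i. \<integral>y. (f (t + X i) y - f t y) / X i \<partial>M) \<longlonglongrightarrow> (\<integral>y. f' t y \<partial>M)"
    proof (rule integral_dominated_convergence[where w=g])
      show "AE y in M. (\<lambda>i. (f (t + X i) y - f t y) / X i) \<longlonglongrightarrow> f' t y"
      proof (rule AE_I2)
        fix y assume "y \<in> space M"
        then have "((\<lambda>h. (f (t + h) y - f t y) / h) \<longlongrightarrow> f' t y) (at 0)"
          using deriv by (simp add: DERIV_def)
        then show "(\<lambda>i. (f (t + X i) y - f t y) / X i) \<longlonglongrightarrow> f' t y"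
          using X by (auto simp: tendsto_at_iff_sequentially o_def)
      qed
      show "AE y in M. norm ((f (t + X i) y - f t y) / X i) \<le> g y" for i
      proof (rule AE_I2)
        fix y assume y: "y \<in> space M"
        have "norm (f (t + X i) y - f t y) \<le> g y * norm ((t + X i) - t)"
          by (rule field_differentiable_bound[where S=UNIV and f="\<lambda>t. f t y" and f'="\<lambda>t. f' t y"])
             (auto simp: deriv bound y)
        then show "norm ((f (t + X i) y - f t y) / X i) \<le> g y"
          using X(1)[of i] by (simp add: field_simps)
      qed
    qed (use g meas in auto)
    then show ?thesis
      using int by simp
  qed
  then show ?thesis
    by (auto simp: DERIV_def tendsto_at_iff_sequentially o_def)
qed

lemma continuous_on_integral:
  fixes f :: "'a::metric_space \<Rightarrow> 'b \<Rightarrow> real"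
  assumes cont: "\<And>y. y \<in> space M \<Longrightarrow> continuous_on UNIV (\<lambda>x. f x y)"
    and bound: "\<And>x y. y \<in> space M \<Longrightarrow> \<bar>f x y\<bar> \<le> g y"
    and g: "integrable M g"
    and meas: "\<And>x. f x \<in> borel_measurable M"
  shows "continuous_on UNIV (\<lambda>x. \<integral>y. f x y \<partial>M)"
  unfolding continuous_on_sequentially
proof (intro ballI allI impI)
  fix X a assume X: "(\<forall>n. X n \<in> UNIV) \<and> X \<longlonglongrightarrow> (a::'a)"
  have "(\<lambda>i. f (X i) y) \<longlonglongrightarrow> f a y" if "y \<in> space M" for y
    using cont[OF that] X by (auto simp: continuous_on_sequentially o_def)
  then show "((\<lambda>x. \<integral>y. f x y \<partial>M) \<circ> X) \<longlonglongrightarrow> (\<integral>y. f a y \<partial>M)"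
    unfolding o_def
    by (intro integral_dominated_convergence[where w=g]) (use g meas bound in \<open>auto intro!: AE_I2\<close>)
qed

text \<open>The difference sits in the kernel, so all regularity comes from \<open>K\<close> and
  \<open>v\<close> is asked only to be integrable.\<close>

definition conv :: "(real ^ 'n \<Rightarrow> real) \<Rightarrow> (real ^ 'n \<Rightarrow> real) \<Rightarrow> real ^ 'n \<Rightarrow> real" where
  "conv K v x = (\<integral>y. K (x - y) * v y \<partial>lborel)"

lemma bounded_vanishing:
  fixes K :: "real ^ 'n \<Rightarrow> real"
  assumes "continuous_on UNIV K" "\<And>x. norm x > r \<Longrightarrow> K x = 0"
  obtains B where "B \<ge> 0" "\<And>x. \<bar>K x\<bar> \<le> B"
proof -
  have "compact (K ` cball 0 r)"
    by (intro compact_continuous_image continuous_on_subset[OF assms(1)]) auto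
  then obtain B where B: "\<And>y. y \<in> K ` cball 0 r \<Longrightarrow> norm y \<le> B"
    using compact_imp_bounded bounded_iff by metis
  have "\<bar>K x\<bar> \<le> max B 0" for x
    using B[of "K x"] assms(2)[of x] by (cases "norm x > r") (auto simp: dist_norm)
  then show thesis by (intro that[of "max B 0"]) auto
qed

lemma conv_integrand_integrable:
  fixes K v :: "real ^ 'n \<Rightarrow> real"
  assumes "continuous_on UNIV K" "\<And>x. \<bar>K x\<bar> \<le> B" "integrable lborel v"
  shows "integrable lborel (\<lambda>y. K (x - y) * v y)"
proof (rule Bochner_Integration.integrable_bound[where f="\<lambda>y. B * \<bar>v y\<bar>"])
  have [measurable]: "K \<in> borel_measurable borel"
    by (rule borel_measurable_continuous_onI) (rule assms)
  show "(\<lambda>y. K (x - y) * v y) \<in> borel_measurable lborel"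
    using assms(3) by measurable
  show "AE y in lborel. norm (K (x - y) * v y) \<le> norm (B * \<bar>v y\<bar>)"
    using assms(2) abs_ge_zero[of B] by (auto intro!: AE_I2 mult_right_mono simp: abs_mult intro: order_trans[OF _ abs_ge_self])
qed (use assms in auto)

lemma conv_continuous:
  assumes K: "continuous_on UNIV K" "\<And>x. \<bar>K x\<bar> \<le> B" and v: "integrable lborel v"
  shows "continuous_on UNIV (conv K v)"
  unfolding conv_def[abs_def]
proof (rule continuous_on_integral[where g="\<lambda>y. B * \<bar>v y\<bar>"])
  show "continuous_on UNIV (\<lambda>x. K (x - y) * v y)" for y
    by (intro continuous_intros continuous_on_compose2[OF K(1)]) auto
  show "(\<lambda>y. K (x - y) * v y) \<in> borel_measurable lborel" for x
    using conv_integrand_integrable[OF K v] by auto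
qed (use v K in \<open>auto simp: abs_mult mult_right_mono\<close>)

lemma conv_has_partial:
  assumes K: "continuous_on UNIV K" "\<And>x. \<bar>K x\<bar> \<le> B"
    and K': "continuous_on UNIV K'" "\<And>x. \<bar>K' x\<bar> \<le> B'" and pd: "has_partial j K K'"
    and v: "integrable lborel v"
  shows "has_partial j (conv K v) (conv K' v)"
  unfolding has_partial_def
proof
  fix x
  let ?f = "\<lambda>t y. K (x + t *\<^sub>R axis j 1 - y) * v y"
  let ?f' = "\<lambda>t y. K' (x + t *\<^sub>R axis j 1 - y) * v y"
  have d: "((\<lambda>t. K (x + t *\<^sub>R axis j 1 - y) * v y) has_real_derivative ?f' t y) (at t)" for t y
    using DERIV_cmult_right[OF has_partial_line[OF pd, of "x - y" t], of "v y"] by (simp add: algebra_simps)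
  have "((\<lambda>t. \<integral>y. ?f t y \<partial>lborel) has_real_derivative (\<integral>y. ?f' 0 y \<partial>lborel)) (at 0)"
  proof (rule DERIV_integral[where g="\<lambda>y. B' * \<bar>v y\<bar>"])
    show "?f' 0 \<in> borel_measurable lborel"
      using conv_integrand_integrable[OF K' v] by (metis borel_measurable_integrable)
  qed (use conv_integrand_integrable[OF K v] d K' v in \<open>auto simp: abs_mult mult_right_mono\<close>)
  then show "((\<lambda>t. conv K v (x + t *\<^sub>R axis j 1)) has_real_derivative conv K' v x) (at 0)"
    by (simp add: conv_def)
qed

lemma conv_vanishing:
  assumes "\<And>x. norm x > r \<Longrightarrow> K x = 0" "\<And>x. norm x > R \<Longrightarrow> v x = 0" "norm x > r + R"
  shows "conv K v x = 0"
proof -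
  have "K (x - y) * v y = 0" for y
  proof (cases "norm y > R")
    case False
    then have "norm (x - y) > r"
      using assms(3) norm_triangle_ineq2[of x y] by linarith
    then show ?thesis using assms(1) by simp
  qed (simp add: assms)
  then show ?thesis unfolding conv_def by (metis (no_types, lifting) integral_zero Bochner_Integration.integral_cong)
qed

lemma lborel_integral_shift:
  fixes f :: "'a::euclidean_space \<Rightarrow> real"
  assumes [measurable]: "f \<in> borel_measurable borel"
  shows "(\<integral>x. f (c + x) \<partial>lborel) = (\<integral>x. f x \<partial>lborel)"
  by (subst (2) lborel_distr_plus[symmetric, of c], subst integral_distr) auto

lemma lborel_nn_integral_shift:
  fixes f :: "'a::euclidean_space \<Rightarrow> ennreal"
  assumes [measurable]: "f \<in> borel_measurable borel"
  shows "(\<integral>\<^sup>+x. f (c + x) \<partial>lborel) = (\<integral>\<^sup>+x. f x \<partial>lborel)"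
  by (subst (2) lborel_distr_plus[symmetric, of c], subst nn_integral_distr) auto

lemma lborel_integrable_shift:
  fixes f :: "'a::euclidean_space \<Rightarrow> real"
  assumes "integrable lborel f"
  shows "integrable lborel (\<lambda>x. f (c + x))"
proof -
  have "integrable (distr lborel borel ((+) c)) f"
    using assms by (simp add: lborel_distr_plus)
  then show ?thesis by (subst (asm) integrable_distr_eq) (use assms in auto)
qed

section \<open>Mollifiers acting on L2\<close>

text \<open>Continuity is enough for the L2 estimates; derivatives of the kernel enter separately
  through \<open>C2c\<close>. Symmetry makes \<open>K (x - y)\<close>, as a function of
  \<open>y\<close>, a translate of \<open>K\<close>, so that translation invariance gives its
  integral.\<close>

definition mollifier :: "real \<Rightarrow> (real ^ 'n \<Rightarrow> real) \<Rightarrow> bool" where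
  "mollifier \<delta> K \<longleftrightarrow> continuous_on UNIV K \<and> (\<forall>x. 0 \<le> K x) \<and> (\<forall>x. K (- x) = K x) \<and>
     integrable lborel K \<and> (\<integral>x. K x \<partial>lborel) = 1 \<and> (\<forall>x. norm x > \<delta> \<longrightarrow> K x = 0)"

lemma mollifier_mono: "mollifier \<delta> K \<Longrightarrow> \<delta> \<le> \<delta>' \<Longrightarrow> mollifier \<delta>' K"
  by (auto simp: mollifier_def)

lemma mollifier_shift:
  assumes "mollifier \<delta> K"
  shows "integrable lborel (\<lambda>y. K (x - y))" "(\<integral>y. K (x - y) \<partial>lborel) = 1"
    "(\<integral>\<^sup>+y. K (y - x) \<partial>lborel) = 1"
proof -
  have K: "integrable lborel K" "(\<integral>x. K x \<partial>lborel) = 1" and even: "\<And>x. K (- x) = K x"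
    and nn: "\<And>x. 0 \<le> K x"
    using assms by (auto simp: mollifier_def)
  then have [measurable]: "K \<in> borel_measurable borel" by auto
  have e: "K (x - y) = K (- x + y)" for y
    using even[of "x - y"] by simp
  show "integrable lborel (\<lambda>y. K (x - y))"
    unfolding e by (rule lborel_integrable_shift) (rule K)
  show "(\<integral>y. K (x - y) \<partial>lborel) = 1"
    unfolding e by (subst lborel_integral_shift) (auto simp: K)
  have "(\<integral>\<^sup>+y. K (- x + y) \<partial>lborel) = (\<integral>\<^sup>+y. K y \<partial>lborel)"
    by (rule lborel_nn_integral_shift[of "\<lambda>x. ennreal (K x)" "- x"]) auto
  also have "\<dots> = 1"
    using nn_integral_eq_integral[OF K(1)] nn K(2) by simp
  finally show "(\<integral>\<^sup>+y. K (y - x) \<partial>lborel) = 1" by simp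
qed

lemma integrable_indicator_cball:
  "integrable lborel (indicator (cball (a::'a::euclidean_space) R) :: 'a \<Rightarrow> real)"
  using emeasure_bounded_finite[of "cball a R"] by (intro integrable_real_indicator) auto

lemma square_integrable_vanishing_imp_integrable:
  fixes v :: "real ^ 'n \<Rightarrow> real"
  assumes [measurable]: "v \<in> borel_measurable borel" and "integrable lborel (\<lambda>x. (v x)\<^sup>2)"
    and "\<And>x. norm x > R \<Longrightarrow> v x = 0"
  shows "integrable lborel v"
proof (rule Bochner_Integration.integrable_bound[where f="\<lambda>x. (v x)\<^sup>2 + indicator (cball 0 R) x"])
  show "integrable lborel (\<lambda>x. (v x)\<^sup>2 + indicat_real (cball 0 R) x)"
    using assms(2) by (intro Bochner_Integration.integrable_add integrable_indicator_cball)
  have "\<bar>v x\<bar> \<le> (v x)\<^sup>2 + 1" for x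
    using zero_le_power2[of "\<bar>v x\<bar> - 1"] by (simp add: power2_diff)
  then show "AE x in lborel. norm (v x) \<le> norm ((v x)\<^sup>2 + indicat_real (cball 0 R) x)"
    using assms(3) by (auto intro!: AE_I2 simp: indicator_def dist_norm)
qed auto

text \<open>Jensen's inequality for the probability density \<open>K (x - y)\<close> in
  \<open>y\<close>, obtained by expanding the nonnegative variance of \<open>v\<close> about its
  mean \<open>conv K v x\<close>.\<close>

lemma conv_square_le:
  assumes K: "mollifier \<delta> K" and v: "integrable lborel v" "integrable lborel (\<lambda>x. (v x)\<^sup>2)"
  shows "(conv K v x)\<^sup>2 \<le> conv K (\<lambda>y. (v y)\<^sup>2) x"
proof -
  have cK: "continuous_on UNIV K" and "\<And>x. norm x > \<delta> \<Longrightarrow> K x = 0" and nn: "\<And>x. 0 \<le> K x"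
    using K by (auto simp: mollifier_def)
  then obtain B where B: "\<And>x. \<bar>K x\<bar> \<le> B"
    using bounded_vanishing by metis
  define c where "c = conv K v x"
  note i = conv_integrand_integrable[OF cK B v(1), of x] conv_integrand_integrable[OF cK B v(2), of x]
    mollifier_shift(1)[OF K, of x]
  have "0 \<le> (\<integral>y. K (x - y) * (v y - c)\<^sup>2 \<partial>lborel)"
    using nn by (intro integral_nonneg_AE) auto
  also have "(\<lambda>y. K (x - y) * (v y - c)\<^sup>2) =
      (\<lambda>y. K (x - y) * (v y)\<^sup>2 - (2 * c) * (K (x - y) * v y) + c\<^sup>2 * K (x - y))"
    by (auto simp: power2_diff algebra_simps)
  also have "(\<integral>y. K (x - y) * (v y)\<^sup>2 - (2 * c) * (K (x - y) * v y) + c\<^sup>2 * K (x - y) \<partial>lborel) =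
      conv K (\<lambda>y. (v y)\<^sup>2) x - (2 * c) * c + c\<^sup>2 * 1"
    using i mollifier_shift(2)[OF K] by (simp add: conv_def c_def)
  finally show ?thesis by (simp add: c_def power2_eq_square)
qed

text \<open>Jensen pointwise, then Tonelli and total mass 1 of \<open>K\<close> in the variable x.
  Working with the nonnegative integral gives integrability and the bound together.\<close>

lemma conv_L2_contraction:
  fixes v :: "real ^ 'n \<Rightarrow> real"
  assumes K: "mollifier \<delta> K" and v: "integrable lborel v" "integrable lborel (\<lambda>x. (v x)\<^sup>2)"
  shows "integrable lborel (\<lambda>x. (conv K v x)\<^sup>2)"
    and "(\<integral>x. (conv K v x)\<^sup>2 \<partial>lborel) \<le> (\<integral>x. (v x)\<^sup>2 \<partial>lborel)"
proof -
  have cK: "continuous_on UNIV K" and "\<And>x. norm x > \<delta> \<Longrightarrow> K x = 0" and nn: "\<And>x. 0 \<le> K x"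
    using K by (auto simp: mollifier_def)
  then obtain B where B: "\<And>x. \<bar>K x\<bar> \<le> B"
    using bounded_vanishing by metis
  have [measurable]: "K \<in> borel_measurable borel" "v \<in> borel_measurable borel"
    using v cK by (auto intro: borel_measurable_continuous_onI)
  have [measurable]: "conv K v \<in> borel_measurable borel"
    by (rule borel_measurable_continuous_onI) (rule conv_continuous[OF cK B v(1)])
  have le: "(\<integral>\<^sup>+x. ennreal ((conv K v x)\<^sup>2) \<partial>lborel) \<le> (\<integral>\<^sup>+x. ennreal ((v x)\<^sup>2) \<partial>lborel)"
  proof -
    have "(\<integral>\<^sup>+x. ennreal ((conv K v x)\<^sup>2) \<partial>lborel)
        \<le> (\<integral>\<^sup>+x. \<integral>\<^sup>+y. ennreal (K (x - y) * (v y)\<^sup>2) \<partial>lborel \<partial>lborel)"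
    proof (rule nn_integral_mono)
      fix x
      have "(\<integral>\<^sup>+y. ennreal (K (x - y) * (v y)\<^sup>2) \<partial>lborel) = ennreal (conv K (\<lambda>y. (v y)\<^sup>2) x)"
        unfolding conv_def using conv_integrand_integrable[OF cK B v(2)] nn
        by (intro nn_integral_eq_integral) auto
      then show "ennreal ((conv K v x)\<^sup>2) \<le> (\<integral>\<^sup>+y. ennreal (K (x - y) * (v y)\<^sup>2) \<partial>lborel)"
        using conv_square_le[OF K v] by (simp add: ennreal_leI)
    qed
    also have "\<dots> = (\<integral>\<^sup>+y. \<integral>\<^sup>+x. ennreal (K (x - y) * (v y)\<^sup>2) \<partial>lborel \<partial>lborel)"
      by (rule lborel_pair.Fubini'[symmetric]) measurable
    also have "\<dots> = (\<integral>\<^sup>+y. (\<integral>\<^sup>+x. ennreal (K (x - y)) \<partial>lborel) * ennreal ((v y)\<^sup>2) \<partial>lborel)"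
      using nn by (subst nn_integral_multc[symmetric]) (auto simp: ennreal_mult)
    also have "\<dots> = (\<integral>\<^sup>+x. ennreal ((v x)\<^sup>2) \<partial>lborel)"
      by (simp add: mollifier_shift(3)[OF K])
    finally show ?thesis .
  qed
  have fin: "(\<integral>\<^sup>+x. ennreal ((v x)\<^sup>2) \<partial>lborel) = ennreal (\<integral>x. (v x)\<^sup>2 \<partial>lborel)"
    by (intro nn_integral_eq_integral) (use v in auto)
  show i: "integrable lborel (\<lambda>x. (conv K v x)\<^sup>2)"
    by (intro integrableI_nonneg) (use le fin in \<open>auto simp: le_less_trans\<close>)
  have "ennreal (\<integral>x. (conv K v x)\<^sup>2 \<partial>lborel) \<le> ennreal (\<integral>x. (v x)\<^sup>2 \<partial>lborel)"
    using le fin nn_integral_eq_integral[OF i] by simp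
  then show "(\<integral>x. (conv K v x)\<^sup>2 \<partial>lborel) \<le> (\<integral>x. (v x)\<^sup>2 \<partial>lborel)"
    by (simp add: integral_nonneg_AE)
qed

text \<open>\<open>conv K w x - w x\<close> is the average of \<open>w y - w x\<close> against
  \<open>K (x - y)\<close>, and only \<open>y\<close> within distance \<delta> of \<open>x\<close>
  has weight.\<close>

lemma conv_uniform:
  fixes w :: "real ^ 'n \<Rightarrow> real"
  assumes K: "mollifier \<delta> K" and w: "continuous_on UNIV w" "integrable lborel w"
    and close: "\<And>x y. norm (x - y) \<le> \<delta> \<Longrightarrow> \<bar>w y - w x\<bar> \<le> \<eta>"
  shows "\<bar>conv K w x - w x\<bar> \<le> \<eta>"
proof -
  have cK: "continuous_on UNIV K" and K0: "\<And>x. norm x > \<delta> \<Longrightarrow> K x = 0" and nn: "\<And>x. 0 \<le> K x"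
    using K by (auto simp: mollifier_def)
  then obtain B where B: "\<And>x. \<bar>K x\<bar> \<le> B"
    using bounded_vanishing by metis
  note i = conv_integrand_integrable[OF cK B w(2), of x] mollifier_shift(1)[OF K, of x]
  have "conv K w x - w x = (\<integral>y. K (x - y) * w y - w x * K (x - y) \<partial>lborel)"
    using i mollifier_shift(2)[OF K] by (simp add: conv_def)
  also have "\<bar>\<dots>\<bar> \<le> (\<integral>y. \<eta> * K (x - y) \<partial>lborel)"
  proof (rule integral_abs_bound[THEN order_trans], rule integral_mono)
    fix y
    show "\<bar>K (x - y) * w y - w x * K (x - y)\<bar> \<le> \<eta> * K (x - y)"
    proof (cases "norm (x - y) \<le> \<delta>")
      case True
      have "\<bar>K (x - y) * w y - w x * K (x - y)\<bar> = \<bar>w y - w x\<bar> * K (x - y)"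
        using nn[of "x - y"] by (metis (no_types, opaque_lifting) abs_mult abs_of_nonneg left_diff_distrib mult.commute)
      then show ?thesis
        using close[OF True] nn[of "x - y"] by (simp add: mult_right_mono)
    qed (use K0 in auto)
  qed (use i in auto)
  also have "\<dots> = \<eta>"
    using i mollifier_shift(2)[OF K] by simp
  finally show ?thesis .
qed

section \<open>Density of continuous functions and convergence of mollification in L2\<close>

definition clip :: "real \<Rightarrow> real \<Rightarrow> real" where
  "clip a x = max (- a) (min a x)"

lemma clip_bound: "0 \<le> a \<Longrightarrow> \<bar>clip a x\<bar> \<le> a"
  by (auto simp: clip_def)

lemma clip_abs_le: "0 \<le> a \<Longrightarrow> \<bar>clip a x\<bar> \<le> \<bar>x\<bar>"
  by (auto simp: clip_def)

lemma clip_id: "\<bar>x\<bar> \<le> a \<Longrightarrow> clip a x = x"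
  by (auto simp: clip_def)

lemma clip_continuous: "continuous_on UNIV (clip a)"
  unfolding clip_def[abs_def] by (intro continuous_intros)

lemma square_add3_le: "(a + b + c)\<^sup>2 \<le> 3 * (a\<^sup>2 + b\<^sup>2 + (c::real)\<^sup>2)"
  using zero_le_power2[of "a - b"] zero_le_power2[of "b - c"] zero_le_power2[of "a - c"]
  by (simp add: power2_eq_square algebra_simps)

lemma square_add_le: "(a + b)\<^sup>2 \<le> 2 * (a\<^sup>2 + (b::real)\<^sup>2)"
  using zero_le_power2[of "a - b"] by (simp add: power2_eq_square algebra_simps)

definition tent :: "real \<Rightarrow> real ^ 'n \<Rightarrow> real" where
  "tent R x = max 0 (min 1 (R + 1 - norm x))"

lemma tent: "continuous_on UNIV (tent R)" "0 \<le> tent R x" "tent R x \<le> 1"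
    "norm x \<le> R \<Longrightarrow> tent R x = 1" "norm x > R + 1 \<Longrightarrow> tent R x = 0"
  unfolding tent_def[abs_def] by (auto intro!: continuous_intros)

lemma integrable_bounded_vanishing:
  fixes f :: "real ^ 'n \<Rightarrow> real"
  assumes "f \<in> borel_measurable borel" "\<And>x. \<bar>f x\<bar> \<le> B" "\<And>x. norm x > R \<Longrightarrow> f x = 0"
  shows "integrable lborel f"
proof (rule Bochner_Integration.integrable_bound[where f="\<lambda>x. B * indicator (cball 0 R) x"])
  show "integrable lborel (\<lambda>x. B * indicat_real (cball (0::real^'n) R) x)"
    by (intro integrable_mult_right integrable_indicator_cball)
  show "AE x in lborel. norm (f x) \<le> norm (B * indicat_real (cball 0 R) x)"
    using assms(2,3) abs_ge_self[of B] by (auto intro!: AE_I2 simp: indicator_def dist_norm intro: order_trans)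
qed (use assms in auto)

lemma dominated_L2:
  fixes a :: "nat \<Rightarrow> 'a \<Rightarrow> real" and h :: "'a \<Rightarrow> real"
  assumes "\<And>k. a k \<in> borel_measurable M" "AE x in M. (\<lambda>k. a k x) \<longlonglongrightarrow> 0"
    "\<And>k. AE x in M. (a k x)\<^sup>2 \<le> h x" "integrable M h"
  shows "(\<lambda>k. \<integral>x. (a k x)\<^sup>2 \<partial>M) \<longlonglongrightarrow> 0"
proof -
  have "(\<lambda>k. \<integral>x. (a k x)\<^sup>2 \<partial>M) \<longlonglongrightarrow> (\<integral>x. 0 \<partial>M)"
  proof (rule integral_dominated_convergence[where w=h])
    show "AE x in M. (\<lambda>k. (a k x)\<^sup>2) \<longlonglongrightarrow> 0"
      using assms(2) by eventually_elim (auto intro: tendsto_eq_intros)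
  qed (use assms in auto)
  then show ?thesis by simp
qed

text \<open>First truncate \<open>v\<close> in height, then approximate the bounded function almost
  everywhere by continuous ones. Each error is below e/4, and (a + b)^2 \<le> 2 (a^2 + b^2) adds
  them up to less than e.\<close>

lemma continuous_L2_dense:
  fixes v :: "real ^ 'n \<Rightarrow> real"
  assumes [measurable]: "v \<in> borel_measurable borel" and v2: "integrable lborel (\<lambda>x. (v x)\<^sup>2)"
    and v0: "\<And>x. norm x > R \<Longrightarrow> v x = 0" and e: "e > 0"
  obtains w where "continuous_on UNIV w" "\<And>x. norm x > R + 1 \<Longrightarrow> w x = 0"
    "(\<integral>x. (v x - w x)\<^sup>2 \<partial>lborel) < e"
proof -
  have "(\<lambda>k. \<integral>x. (v x - clip (real k) (v x))\<^sup>2 \<partial>lborel) \<longlonglongrightarrow> 0"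
  proof (rule dominated_L2[where h="\<lambda>x. 4 * (v x)\<^sup>2"])
    have [measurable]: "clip a \<in> borel_measurable borel" for a
      by (rule borel_measurable_continuous_onI[OF clip_continuous])
    show "(\<lambda>x. v x - clip (real k) (v x)) \<in> borel_measurable lborel" for k
      by measurable
    show "AE x in lborel. (\<lambda>k. v x - clip (real k) (v x)) \<longlonglongrightarrow> 0"
    proof (rule AE_I2, rule tendsto_eventually)
      fix x
      have "\<forall>\<^sub>F k in sequentially. \<bar>v x\<bar> \<le> real k"
        using filterlim_real_sequentially by (auto simp: filterlim_at_top)
      then show "\<forall>\<^sub>F k in sequentially. v x - clip (real k) (v x) = 0"
        by eventually_elim (simp add: clip_id)
    qed
    show "AE x in lborel. (v x - clip (real k) (v x))\<^sup>2 \<le> 4 * (v x)\<^sup>2" for k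
    proof (rule AE_I2)
      fix x
      have "\<bar>v x - clip (real k) (v x)\<bar> \<le> \<bar>2 * v x\<bar>"
        using clip_abs_le[of "real k" "v x"] by linarith
      then show "(v x - clip (real k) (v x))\<^sup>2 \<le> 4 * (v x)\<^sup>2"
        using abs_le_square_iff[of "v x - clip (real k) (v x)" "2 * v x"] by (simp add: power_mult_distrib)
    qed
  qed (use v2 in auto)
  then have "\<forall>\<^sub>F k in sequentially. (\<integral>x. (v x - clip (real k) (v x))\<^sup>2 \<partial>lborel) < e / 4"
    using e by (intro order_tendstoD(2)) auto
  then obtain k where k: "(\<integral>x. (v x - clip (real k) (v x))\<^sup>2 \<partial>lborel) < e / 4"
    by (meson eventually_happens sequentially_bot)
  define a where "a = real k"
  define vk where "vk = (\<lambda>x. clip a (v x))"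
  have a: "0 \<le> a" by (simp add: a_def)
  have [measurable]: "clip a \<in> borel_measurable borel"
    by (rule borel_measurable_continuous_onI[OF clip_continuous])
  have [measurable]: "vk \<in> borel_measurable borel" by (simp add: vk_def)
  have "vk \<in> borel_measurable lebesgue"
    by (rule measurable_completion) simp
  then have "vk measurable_on UNIV"
    by (rule lebesgue_measurable_imp_measurable_on) simp
  then obtain N g where N: "negligible N" and g: "\<And>n. continuous_on UNIV (g n)"
    and lim: "\<And>x. x \<notin> N \<Longrightarrow> (\<lambda>n. g n x) \<longlonglongrightarrow> vk x"
    unfolding measurable_on_def by (auto)
  \<comment> \<open>The continuous \<open>g n\<close> converge almost everywhere with no control on
    size or support. Clipping and the tent supply the dominating function without changing the
    limit, as \<open>vk\<close> is bounded by a and vanishes beyond R.\<close>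
  define w where "w = (\<lambda>n x. tent R x * clip a (g n x))"
  have cw: "continuous_on UNIV (w n)" for n
    unfolding w_def by (intro continuous_intros tent continuous_on_compose2[OF clip_continuous g]) auto
  then have [measurable]: "w n \<in> borel_measurable borel" for n
    by (rule borel_measurable_continuous_onI)
  have w0: "norm x > R + 1 \<Longrightarrow> w n x = 0" for n x
    by (simp add: w_def tent)
  have vk0: "norm x > R \<Longrightarrow> vk x = 0" for x
    using v0[of x] a by (simp add: vk_def clip_def)
  have wb: "\<bar>w n x\<bar> \<le> a" for n x
    using mult_mono[OF _ clip_bound[OF a, of "g n x"], of "\<bar>tent R x\<bar>" 1] tent(2,3)[of R x]
    by (simp add: w_def abs_mult)
  have vb: "\<bar>vk x\<bar> \<le> a" for x
    using clip_bound[OF a] by (simp add: vk_def)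
  have "(\<lambda>n. \<integral>x. (vk x - w n x)\<^sup>2 \<partial>lborel) \<longlonglongrightarrow> 0"
  proof (rule dominated_L2[where h="\<lambda>x. (2 * a)\<^sup>2 * indicator (cball 0 (R + 1)) x"])
    have "N \<in> null_sets lebesgue"
      using N by (simp add: negligible_iff_null_sets)
    then have "AE x in lebesgue. x \<notin> N"
      by (rule AE_not_in)
    then have N: "AE x in lborel. x \<notin> N"
      by (simp add: AE_completion_iff)
    show "AE x in lborel. (\<lambda>n. vk x - w n x) \<longlonglongrightarrow> 0"
      using N
    proof eventually_elim
      case (elim x)
      have "(\<lambda>n. clip a (g n x)) \<longlonglongrightarrow> clip a (vk x)"
        unfolding clip_def by (intro tendsto_intros lim elim)
      then have "(\<lambda>n. w n x) \<longlonglongrightarrow> tent R x * clip a (vk x)"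
        unfolding w_def by (intro tendsto_intros)
      also have "tent R x * clip a (vk x) = vk x"
        using vk0[of x] tent(4)[of x R] clip_id[OF vb, of x] by (cases "norm x \<le> R") auto
      finally show ?case
        by (auto intro: tendsto_eq_intros)
    qed
    show "AE x in lborel. (vk x - w n x)\<^sup>2 \<le> (2 * a)\<^sup>2 * indicator (cball 0 (R + 1)) x" for n
    proof (rule AE_I2)
      fix x
      have "\<bar>vk x - w n x\<bar> \<le> \<bar>2 * a\<bar>"
        using vb[of x] wb[of n x] a by linarith
      then have "(vk x - w n x)\<^sup>2 \<le> (2 * a)\<^sup>2"
        by (simp only: abs_le_square_iff)
      then show "(vk x - w n x)\<^sup>2 \<le> (2 * a)\<^sup>2 * indicator (cball 0 (R + 1)) x"
        using vk0[of x] w0[of x n] by (auto simp: indicator_def dist_norm)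
    qed
    show "integrable lborel (\<lambda>x. (2 * a)\<^sup>2 * indicator (cball (0::real^'n) (R + 1)) x)"
      by (intro integrable_mult_right integrable_indicator_cball)
  qed measurable
  then have "\<forall>\<^sub>F n in sequentially. (\<integral>x. (vk x - w n x)\<^sup>2 \<partial>lborel) < e / 4"
    using e by (intro order_tendstoD(2)) auto
  then obtain n where n: "(\<integral>x. (vk x - w n x)\<^sup>2 \<partial>lborel) < e / 4"
    by (meson eventually_happens sequentially_bot)
  have i: "integrable lborel (\<lambda>x. (v x - vk x)\<^sup>2)" "integrable lborel (\<lambda>x. (vk x - w n x)\<^sup>2)"
  proof -
    show "integrable lborel (\<lambda>x. (v x - vk x)\<^sup>2)"
    proof (rule Bochner_Integration.integrable_bound[where f="\<lambda>x. 4 * (v x)\<^sup>2"])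
      show "AE x in lborel. norm ((v x - vk x)\<^sup>2) \<le> norm (4 * (v x)\<^sup>2)"
      proof (rule AE_I2)
        fix x
        have "\<bar>v x - vk x\<bar> \<le> \<bar>2 * v x\<bar>"
          using clip_abs_le[OF a, of "v x"] unfolding vk_def by linarith
        then show "norm ((v x - vk x)\<^sup>2) \<le> norm (4 * (v x)\<^sup>2)"
          using abs_le_square_iff[of "v x - vk x" "2 * v x"] by (simp add: power_mult_distrib)
      qed
    qed (use v2 in auto)
    show "integrable lborel (\<lambda>x. (vk x - w n x)\<^sup>2)"
    proof (rule integrable_bounded_vanishing[where B="(2 * a)\<^sup>2" and R="R + 1"])
      fix x
      have "\<bar>vk x - w n x\<bar> \<le> \<bar>2 * a\<bar>"
        using vb[of x] wb[of n x] a by linarith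
      then show "\<bar>(vk x - w n x)\<^sup>2\<bar> \<le> (2 * a)\<^sup>2"
        by (simp add: abs_le_square_iff)
    qed (use vk0 w0 in auto)
  qed
  have "(\<integral>x. (v x - w n x)\<^sup>2 \<partial>lborel) \<le> (\<integral>x. 2 * ((v x - vk x)\<^sup>2 + (vk x - w n x)\<^sup>2) \<partial>lborel)"
  proof (rule integral_mono')
    fix x show "(v x - w n x)\<^sup>2 \<le> 2 * ((v x - vk x)\<^sup>2 + (vk x - w n x)\<^sup>2)"
      using square_add_le[of "v x - vk x" "vk x - w n x"] by simp
  qed (use i in auto)
  also have "\<dots> < e"
    using i k n by (simp add: a_def vk_def)
  finally show thesis
    using that[of "w n"] cw w0 by blast
qed

text \<open>Split \<open>conv K v - v\<close> through a continuous \<open>w\<close>: the contraction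
  handles \<open>conv K (v - w)\<close>, uniform continuity handles \<open>conv K w - w\<close>. The
  errors e/12, e/6, e/12 add up to e after the factor 3 of \<open>square_add3_le\<close>. The radius
  \<delta> works for every kernel, so that one kernel can later serve a function and all its weak
  derivatives.\<close>

lemma mollifier_L2:
  fixes v :: "real ^ 'n \<Rightarrow> real"
  assumes v [measurable]: "v \<in> borel_measurable borel" and v2: "integrable lborel (\<lambda>x. (v x)\<^sup>2)"
    and v0: "\<And>x. norm x > R \<Longrightarrow> v x = 0" and e: "e > 0"
  obtains \<delta> where "\<delta> > 0"
    "\<And>K. mollifier \<delta> K \<Longrightarrow> integrable lborel (\<lambda>x. (conv K v x - v x)\<^sup>2) \<and>
       (\<integral>x. (conv K v x - v x)\<^sup>2 \<partial>lborel) < e"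
proof -
  have e12: "e / 12 > 0" using e by simp
  obtain w where cw: "continuous_on UNIV w" and w0: "\<And>x. norm x > R + 1 \<Longrightarrow> w x = 0"
    and vw: "(\<integral>x. (v x - w x)\<^sup>2 \<partial>lborel) < e / 12"
    using continuous_L2_dense[OF v v2 v0 e12] by metis
  have [measurable]: "w \<in> borel_measurable borel"
    by (rule borel_measurable_continuous_onI[OF cw])
  obtain B where B: "\<And>x. \<bar>w x\<bar> \<le> B" "B \<ge> 0"
    using bounded_vanishing[OF cw w0] by metis
  have wi: "integrable lborel w"
    by (rule integrable_bounded_vanishing[OF _ B(1) w0]) simp_all
  have w2: "integrable lborel (\<lambda>x. (w x)\<^sup>2)"
    by (rule integrable_bounded_vanishing[where B="B\<^sup>2" and R="R + 1"])
       (use w0 B in \<open>auto simp: abs_le_square_iff[symmetric]\<close>)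
  have vi: "integrable lborel v"
    by (rule square_integrable_vanishing_imp_integrable[OF v v2 v0])
  have d2: "integrable lborel (\<lambda>x. (v x - w x)\<^sup>2)"
  proof (rule Bochner_Integration.integrable_bound[where f="\<lambda>x. 2 * ((v x)\<^sup>2 + (w x)\<^sup>2)"])
    show "AE x in lborel. norm ((v x - w x)\<^sup>2) \<le> norm (2 * ((v x)\<^sup>2 + (w x)\<^sup>2))"
      using square_add_le[of "v _" "- w _"] by (auto intro!: AE_I2)
  qed (use v2 w2 in auto)
  define vol where "vol = measure lborel (cball (0::real^'n) (R + 2))"
  have "vol \<ge> 0" by (simp add: vol_def)
  \<comment> \<open>The uniform error \<eta> is paid on the ball of radius R + 2, so its square is
    scaled by the volume; the + 1 keeps the denominator positive.\<close>
  define \<eta> where "\<eta> = sqrt (e / (12 * (vol + 1)))"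
  have \<eta>: "\<eta> > 0" "\<eta>\<^sup>2 * vol < e / 6"
  proof -
    show "\<eta> > 0" using e \<open>vol \<ge> 0\<close> by (simp add: \<eta>_def)
    have "\<eta>\<^sup>2 * (vol + 1) = e / 12"
      using e \<open>vol \<ge> 0\<close> by (simp add: \<eta>_def field_simps)
    moreover have "\<eta>\<^sup>2 * vol \<le> \<eta>\<^sup>2 * (vol + 1)"
      by (intro mult_left_mono) auto
    ultimately show "\<eta>\<^sup>2 * vol < e / 6" using e by simp
  qed
  \<comment> \<open>\<open>w\<close> lives in radius R + 1, \<open>conv K w\<close> in radius R + 2
    since \<delta> \<le> 1, and points compared with those lie in radius R + 3.\<close>
  have "uniformly_continuous_on (cball 0 (R + 3)) w"
    by (rule compact_uniformly_continuous[OF continuous_on_subset[OF cw]]) auto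
  then obtain d where d: "d > 0"
    "\<And>x y. x \<in> cball 0 (R + 3) \<Longrightarrow> y \<in> cball 0 (R + 3) \<Longrightarrow> dist y x < d \<Longrightarrow> dist (w y) (w x) < \<eta>"
    unfolding uniformly_continuous_on_def using \<eta>(1) by meson
  define \<delta> where "\<delta> = min 1 (d / 2)"
  have \<delta>: "\<delta> > 0" "\<delta> \<le> 1" "\<delta> < d" using d(1) by (auto simp: \<delta>_def)
  have close: "\<bar>w y - w x\<bar> \<le> \<eta>" if "norm (x - y) \<le> \<delta>" for x y
  proof (cases "norm x \<le> R + 2")
    case True
    then have "norm y \<le> R + 3"
      using that \<delta>(2) norm_triangle_sub[of y x] by (simp add: norm_minus_commute)
    then show ?thesis
      using d(2)[of x y] True that \<delta>(3) by (simp add: dist_norm norm_minus_commute dist_real_def)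
  next
    case False
    then have "norm y > R + 1"
      using that \<delta>(2) norm_triangle_sub[of x y] by simp
    then show ?thesis
      using False w0[of x] w0[of y] \<eta>(1) by simp
  qed
  show thesis
  proof (rule that[OF \<delta>(1)])
    fix K :: "real ^ 'n \<Rightarrow> real" assume K: "mollifier \<delta> K"
    have cK: "continuous_on UNIV K" and K0: "\<And>x. norm x > \<delta> \<Longrightarrow> K x = 0" and nn: "\<And>x. 0 \<le> K x"
      using K by (auto simp: mollifier_def)
    then obtain A where A: "\<And>x. \<bar>K x\<bar> \<le> A"
      using bounded_vanishing by metis
    have [measurable]: "conv K u \<in> borel_measurable borel" if "integrable lborel u" for u
      by (rule borel_measurable_continuous_onI) (rule conv_continuous[OF cK A that])
    have [measurable]: "conv K v \<in> borel_measurable borel" "conv K w \<in> borel_measurable borel"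
      using vi wi by auto
    have lin: "conv K (\<lambda>x. v x - w x) x = conv K v x - conv K w x" for x
      using conv_integrand_integrable[OF cK A vi, of x] conv_integrand_integrable[OF cK A wi, of x]
      by (simp add: conv_def algebra_simps)
    have c1: "integrable lborel (\<lambda>x. (conv K v x - conv K w x)\<^sup>2)"
      "(\<integral>x. (conv K v x - conv K w x)\<^sup>2 \<partial>lborel) < e / 12"
      using conv_L2_contraction[OF K _ d2] vi wi vw by (auto simp: lin)
    have u: "(conv K w x - w x)\<^sup>2 \<le> \<eta>\<^sup>2 * indicator (cball 0 (R + 2)) x" for x
    proof (cases "norm x \<le> R + 2")
      case True
      have "\<bar>conv K w x - w x\<bar> \<le> \<eta>"
        by (rule conv_uniform[OF K cw wi close])
      then show ?thesis
        using True \<eta>(1) by (simp add: dist_norm abs_le_square_iff[symmetric])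
    next
      case False
      then have "conv K w x = 0"
        using conv_vanishing[of \<delta> K "R + 1" w x] K0 w0 \<delta>(2) by simp
      then show ?thesis using False w0[of x] by simp
    qed
    have ii: "integrable lborel (\<lambda>x. \<eta>\<^sup>2 * indicator (cball (0::real^'n) (R + 2)) x)"
      by (intro integrable_mult_right integrable_indicator_cball)
    have c2: "integrable lborel (\<lambda>x. (conv K w x - w x)\<^sup>2)"
      by (rule Bochner_Integration.integrable_bound[OF ii]) (use u in \<open>auto intro!: AE_I2\<close>)
    have "(\<integral>x. (conv K w x - w x)\<^sup>2 \<partial>lborel) \<le> (\<integral>x. \<eta>\<^sup>2 * indicator (cball (0::real^'n) (R + 2)) x \<partial>lborel)"
      by (rule integral_mono[OF c2 ii u])
    also have "\<dots> = \<eta>\<^sup>2 * vol"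
      by (simp add: vol_def)
    finally have c2': "(\<integral>x. (conv K w x - w x)\<^sup>2 \<partial>lborel) < e / 6"
      using \<eta> by simp
    have le: "(conv K v x - v x)\<^sup>2 \<le> 3 * ((conv K v x - conv K w x)\<^sup>2 + (conv K w x - w x)\<^sup>2 + (v x - w x)\<^sup>2)" for x
      using square_add3_le[of "conv K v x - conv K w x" "conv K w x - w x" "w x - v x"]
      by (simp add: power2_commute[of "v x" "w x"])
    have i3: "integrable lborel (\<lambda>x. 3 * ((conv K v x - conv K w x)\<^sup>2 + (conv K w x - w x)\<^sup>2 + (v x - w x)\<^sup>2))"
      using c1 c2 d2 by auto
    have i: "integrable lborel (\<lambda>x. (conv K v x - v x)\<^sup>2)"
      by (rule Bochner_Integration.integrable_bound[OF i3]) (use le in \<open>auto intro!: AE_I2\<close>)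
    have "(\<integral>x. (conv K v x - v x)\<^sup>2 \<partial>lborel) \<le>
        (\<integral>x. 3 * ((conv K v x - conv K w x)\<^sup>2 + (conv K w x - w x)\<^sup>2 + (v x - w x)\<^sup>2) \<partial>lborel)"
      by (rule integral_mono[OF i i3 le])
    also have "\<dots> < e"
      using c1 c2 c2' d2 vw by simp
    finally show "integrable lborel (\<lambda>x. (conv K v x - v x)\<^sup>2) \<and>
       (\<integral>x. (conv K v x - v x)\<^sup>2 \<partial>lborel) < e"
      using i by simp
  qed
qed

section \<open>Gaussian integration by parts\<close>

definition gauss :: "real ^ 'n \<Rightarrow> real" where
  "gauss x = (\<Prod>i\<in>UNIV. std_normal_density (x $ i))"

definition gauss_measure :: "(real ^ 'n) measure" where
  "gauss_measure = density lborel (\<lambda>x. ennreal (gauss x))"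

lemma gauss_pos: "0 < gauss x"
  unfolding gauss_def by (intro prod_pos) (simp add: normal_density_pos)

lemma gauss_nonneg [simp]: "0 \<le> gauss x"
  using gauss_pos[of x] by simp

lemma std_normal_density_le_1: "std_normal_density x \<le> 1"
proof -
  have "1 \<le> sqrt (2 * pi)" using pi_ge_two by (simp add: real_le_rsqrt)
  then have "1 / sqrt (2 * pi) \<le> 1" by simp
  moreover have "exp (- x\<^sup>2 / 2) \<le> 1" by simp
  ultimately show ?thesis
    unfolding std_normal_density_def by (intro mult_le_one) auto
qed

lemma gauss_le_1: "gauss x \<le> 1"
  unfolding gauss_def by (intro prod_le_1) (auto simp: std_normal_density_le_1)

lemma gauss_continuous: "continuous_on UNIV gauss"
  unfolding gauss_def[abs_def] std_normal_density_def by (intro continuous_intros) auto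

lemma gauss_measurable [measurable]: "gauss \<in> borel_measurable borel"
  by (rule borel_measurable_continuous_onI[OF gauss_continuous])

lemma sets_gauss_measure [simp, measurable_cong]: "sets gauss_measure = sets borel"
  by (simp add: gauss_measure_def)

lemma space_gauss_measure [simp]: "space gauss_measure = UNIV"
  by (simp add: gauss_measure_def)

lemma integral_gauss_measure:
  assumes [measurable]: "f \<in> borel_measurable borel"
  shows "(\<integral>x. f x \<partial>gauss_measure) = (\<integral>x. gauss x * f x \<partial>lborel)"
  unfolding gauss_measure_def by (subst integral_density) auto

lemma integrable_gauss_measure:
  fixes f :: "real ^ 'n \<Rightarrow> real"
  assumes [measurable]: "f \<in> borel_measurable borel"
  shows "integrable gauss_measure f \<longleftrightarrow> integrable lborel (\<lambda>x. gauss x * f x)"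
  unfolding gauss_measure_def by (subst integrable_density) auto

lemma AE_gauss_measure:
  "(AE x in gauss_measure. P x) \<longleftrightarrow> (AE x in lborel. P (x :: real ^ 'n))"
  unfolding gauss_measure_def by (subst AE_density) (auto simp: gauss_pos)

lemma std_normal_density_deriv:
  "(std_normal_density has_real_derivative - x * std_normal_density x) (at x)"
proof -
  have "((\<lambda>x. c * exp (- x\<^sup>2 / 2)) has_real_derivative - x * (c * exp (- x\<^sup>2 / 2))) (at x)" for c :: real
    by (auto intro!: derivative_eq_intros)
  then show ?thesis
    unfolding std_normal_density_def[abs_def] .
qed

lemma gauss_has_partial:
  fixes j :: "'n::finite"
  shows "has_partial j gauss (\<lambda>x. - x $ j * gauss x)"
  unfolding has_partial_def
proof
  fix x :: "real ^ 'n"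
  let ?c = "\<Prod>i\<in>UNIV - {j}. std_normal_density (x $ i)"
  have split: "gauss y = std_normal_density (y $ j) * (\<Prod>i\<in>UNIV - {j}. std_normal_density (y $ i))"
    for y :: "real ^ 'n"
    unfolding gauss_def by (rule prod.remove) auto
  have e: "gauss (x + t *\<^sub>R axis j 1) = std_normal_density (x $ j + t) * ?c" for t
    unfolding split by (auto simp: axis_def intro!: prod.cong)
  have "((\<lambda>t. std_normal_density (x $ j + t)) has_real_derivative
      - (x $ j) * std_normal_density (x $ j)) (at 0)"
    using DERIV_shift[of std_normal_density "- (x $ j) * std_normal_density (x $ j)" 0 "x $ j"]
      std_normal_density_deriv[of "x $ j"] by (simp add: add.commute)
  from DERIV_cmult_right[OF this, of ?c]
  show "((\<lambda>t. gauss (x + t *\<^sub>R axis j 1)) has_real_derivative - x $ j * gauss x) (at 0)"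
    unfolding e by (simp add: split[of x] mult.assoc)
qed

lemma has_partial_mult:
  assumes "has_partial j p p'" "has_partial j q q'"
  shows "has_partial j (\<lambda>x. p x * q x) (\<lambda>x. p x * q' x + p' x * q x)"
  using assms DERIV_mult unfolding has_partial_def
  by (fastforce intro!: derivative_eq_intros)

lemma has_partial_diff:
  assumes "has_partial j p p'" "has_partial j q q'"
  shows "has_partial j (\<lambda>x. p x - q x) (\<lambda>x. p' x - q' x)"
  using assms unfolding has_partial_def by (auto intro!: derivative_eq_intros)

lemma has_partial_coord: "has_partial j (\<lambda>x. x $ i) (\<lambda>x. if i = j then 1 else 0)"
  unfolding has_partial_def by (auto intro!: derivative_eq_intros simp: axis_def)

section \<open>Integration by parts for compactly supported functions\<close>

definition C0c :: "(real ^ 'n \<Rightarrow> real) \<Rightarrow> bool" where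
  "C0c f \<longleftrightarrow> continuous_on UNIV f \<and> (\<exists>R. \<forall>x. norm x > R \<longrightarrow> f x = 0)"

lemma C0c_continuous: "C0c f \<Longrightarrow> continuous_on UNIV f"
  by (simp add: C0c_def)

lemma C0c_measurable: "C0c f \<Longrightarrow> f \<in> borel_measurable borel"
  by (intro borel_measurable_continuous_onI C0c_continuous)

lemma C0c_bounded: "C0c f \<Longrightarrow> \<exists>B\<ge>0. \<forall>x. \<bar>f x\<bar> \<le> B"
  unfolding C0c_def using bounded_vanishing by metis

lemma C0c_mult: "continuous_on UNIV g \<Longrightarrow> C0c f \<Longrightarrow> C0c (\<lambda>x. g x * f x)"
  by (auto simp: C0c_def intro!: continuous_intros)

lemma C0c_mult': "continuous_on UNIV g \<Longrightarrow> C0c f \<Longrightarrow> C0c (\<lambda>x. f x * g x)"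
  using C0c_mult[of g f] by (simp add: mult.commute)

lemma C0c_add: "C0c f \<Longrightarrow> C0c g \<Longrightarrow> C0c (\<lambda>x. f x + g x)"
proof -
  assume "C0c f" "C0c g"
  then obtain R1 R2 where "\<forall>x. norm x > R1 \<longrightarrow> f x = 0" "\<forall>x. norm x > R2 \<longrightarrow> g x = 0"
    by (auto simp: C0c_def)
  then have "\<forall>x. norm x > max R1 R2 \<longrightarrow> f x + g x = 0" by auto
  then show ?thesis
    using \<open>C0c f\<close> \<open>C0c g\<close> unfolding C0c_def by (blast intro: continuous_on_add)
qed

lemma C0c_diff: "C0c f \<Longrightarrow> C0c g \<Longrightarrow> C0c (\<lambda>x. f x - g x)"
  using C0c_add[of f "\<lambda>x. -1 * g x"] C0c_mult[of "\<lambda>x. -1" g] by simp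

lemma C0c_if: "(P \<Longrightarrow> C0c f) \<Longrightarrow> C0c (\<lambda>x. if P then f x else 0)"
  by (cases P) (auto simp: C0c_def)

lemma C0c_integrable_lborel: "C0c f \<Longrightarrow> integrable lborel f"
  using C0c_bounded[of f] C0c_measurable[of f]
  by (auto simp: C0c_def intro: integrable_bounded_vanishing)

lemma C0c_integrable_gauss: "C0c f \<Longrightarrow> integrable gauss_measure f"
  by (subst integrable_gauss_measure)
     (auto intro: C0c_measurable C0c_integrable_lborel C0c_mult gauss_continuous)

text \<open>By translation invariance every difference quotient of \<open>f\<close> in direction
  \<open>j\<close> has integral 0, and dominated convergence passes this to the derivative. No
  iterated integrals are involved.\<close>

lemma integral_partial_zero:
  assumes f: "C0c f" and f': "C0c f'" and pd: "has_partial j f f'"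
  shows "(\<integral>x. f' x \<partial>lborel) = 0"
proof -
  obtain R where R: "\<And>x. norm x > R \<Longrightarrow> f x = 0" "\<And>x. norm x > R \<Longrightarrow> f' x = 0"
  proof -
    obtain R1 R2 where "\<forall>x. norm x > R1 \<longrightarrow> f x = 0" "\<forall>x. norm x > R2 \<longrightarrow> f' x = 0"
      using f f' by (auto simp: C0c_def)
    then show thesis by (intro that[of "max R1 R2"]) auto
  qed
  obtain B where B: "\<And>x. \<bar>f' x\<bar> \<le> B"
    using C0c_bounded[OF f'] by auto
  \<comment> \<open>The steps \<open>?X k\<close> are at most 1, so all quotients vanish outside
    radius R + 1.\<close>
  let ?g = "\<lambda>x. B * indicator (cball 0 (R + 1)) x :: real"
  let ?X = "\<lambda>k. 1 / real (Suc k)"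
  let ?s = "\<lambda>k x. (f (x + ?X k *\<^sub>R axis j 1) - f x) / ?X k"
  have X0: "?X \<longlonglongrightarrow> 0" by (rule LIMSEQ_Suc[OF lim_1_over_n])
  note [measurable] = C0c_measurable[OF f] C0c_measurable[OF f']
  have "(\<lambda>k. \<integral>x. ?s k x \<partial>lborel) \<longlonglongrightarrow> (\<integral>x. f' x \<partial>lborel)"
  proof (rule integral_dominated_convergence[where w="?g"])
    show "integrable lborel ?g"
      by (intro integrable_mult_right integrable_indicator_cball)
    show "AE x in lborel. (\<lambda>k. ?s k x) \<longlonglongrightarrow> f' x"
    proof (rule AE_I2)
      fix x
      have "((\<lambda>h. (f (x + h *\<^sub>R axis j 1) - f x) / h) \<longlongrightarrow> f' x) (at 0)"
        using pd by (simp add: has_partial_def DERIV_def)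
      then show "(\<lambda>k. ?s k x) \<longlonglongrightarrow> f' x"
        unfolding tendsto_at_iff_sequentially
        by (elim allE[of _ ?X]) (use X0 in \<open>auto simp: o_def\<close>)
    qed
    show "AE x in lborel. norm (?s k x) \<le> ?g x" for k
    proof (rule AE_I2)
      fix x
      have n: "norm (?X k *\<^sub>R axis j (1::real)) \<le> 1"
        by simp
      show "norm (?s k x) \<le> ?g x"
      proof (cases "norm x \<le> R + 1")
        case True
        have "norm (f (x + ?X k *\<^sub>R axis j 1) - f (x + 0 *\<^sub>R axis j 1)) \<le> B * norm (?X k - 0)"
          by (rule field_differentiable_bound[where S=UNIV and f="\<lambda>t. f (x + t *\<^sub>R axis j 1)"
                and f'="\<lambda>t. f' (x + t *\<^sub>R axis j 1)"])
             (use has_partial_line[OF pd] B in auto)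
        then have "norm (?s k x) \<le> B"
          unfolding norm_divide by (subst pos_divide_le_eq) (simp_all del: of_nat_Suc)
        then show ?thesis using True by (simp add: dist_norm)
      next
        case False
        have "norm (x + ?X k *\<^sub>R axis j 1) > R"
          using n norm_triangle_ineq4[of "x + ?X k *\<^sub>R axis j 1" "?X k *\<^sub>R axis j 1"] False
          unfolding add_diff_cancel_right' by linarith
        then show ?thesis using False R(1)[of x] R(1)[of "x + ?X k *\<^sub>R axis j 1"]
          by simp
      qed
    qed
  qed measurable
  moreover have "(\<integral>x. ?s k x \<partial>lborel) = 0" for k
  proof -
    have "(\<integral>x. f (?X k *\<^sub>R axis j 1 + x) \<partial>lborel) = (\<integral>x. f x \<partial>lborel)"
      by (rule lborel_integral_shift) measurable
    moreover have "integrable lborel (\<lambda>x. f (?X k *\<^sub>R axis j 1 + x))"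
      by (intro lborel_integrable_shift C0c_integrable_lborel f)
    ultimately show ?thesis
      using C0c_integrable_lborel[OF f] by (simp add: add.commute)
  qed
  ultimately have "(\<lambda>k::nat. 0) \<longlonglongrightarrow> (\<integral>x. f' x \<partial>lborel)"
    by (simp only:)
  then show ?thesis
    by (simp add: LIMSEQ_const_iff)
qed

lemma coord_continuous: "continuous_on UNIV (\<lambda>x::real^'n. x $ j)"
  by (intro continuous_intros)

text \<open>The derivative of \<open>w * v * gauss\<close> integrates to 0, and differentiating
  \<open>gauss\<close> produces the factor \<open>- x $ j\<close>. Compact support is asked of
  \<open>w\<close> alone, so \<open>v\<close> may be a constant or a coordinate.\<close>

lemma gaussian_by_parts:
  assumes w: "C0c w" "C0c w'" "has_partial j w w'"
    and v: "continuous_on UNIV v" "continuous_on UNIV v'" "has_partial j v v'"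
  shows "(\<integral>x. (x $ j * w x - w' x) * v x \<partial>gauss_measure) = (\<integral>x. w x * v' x \<partial>gauss_measure)"
proof -
  let ?p = "\<lambda>x. w x * v x" and ?p' = "\<lambda>x. w x * v' x + w' x * v x"
  have p: "C0c ?p" "C0c ?p'" "has_partial j ?p ?p'"
    by (intro C0c_add C0c_mult' w v has_partial_mult)+
  have "C0c (\<lambda>x. ?p x * gauss x)" "C0c (\<lambda>x. ?p x * (- x $ j * gauss x) + ?p' x * gauss x)"
    by (intro C0c_add C0c_mult' p continuous_intros gauss_continuous coord_continuous)+
  from integral_partial_zero[OF this has_partial_mult[OF p(3) gauss_has_partial]]
  have z: "(\<integral>x. ?p x * (- x $ j * gauss x) + ?p' x * gauss x \<partial>lborel) = 0" .
  have cxw: "C0c (\<lambda>x. x $ j * w x)"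
    by (intro C0c_mult w coord_continuous)
  have c1: "C0c (\<lambda>x. (x $ j * w x - w' x) * v x)" and c2: "C0c (\<lambda>x. w x * v' x)"
    by (intro C0c_mult' C0c_diff cxw w v)+
  have "(\<integral>x. w x * v' x \<partial>gauss_measure) - (\<integral>x. (x $ j * w x - w' x) * v x \<partial>gauss_measure)
      = (\<integral>x. w x * v' x - (x $ j * w x - w' x) * v x \<partial>gauss_measure)"
    by (intro Bochner_Integration.integral_diff[symmetric] C0c_integrable_gauss c1 c2)
  also have "\<dots> = (\<integral>x. gauss x * (w x * v' x - (x $ j * w x - w' x) * v x) \<partial>lborel)"
    by (intro integral_gauss_measure C0c_measurable C0c_diff c1 c2)
  also have "(\<lambda>x. gauss x * (w x * v' x - (x $ j * w x - w' x) * v x)) =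
      (\<lambda>x. ?p x * (- x $ j * gauss x) + ?p' x * gauss x)"
    by (auto simp: algebra_simps)
  finally show ?thesis using z by simp
qed

text \<open>The derivatives are explicit arguments, with \<open>w2 i j\<close> the derivative of
  \<open>w1 i\<close> in direction \<open>j\<close>. Symmetry of second derivatives is built in;
  mollified functions inherit it from the kernel.\<close>

definition C2c :: "(real ^ 'n \<Rightarrow> real) \<Rightarrow> ('n \<Rightarrow> real ^ 'n \<Rightarrow> real) \<Rightarrow> ('n \<Rightarrow> 'n \<Rightarrow> real ^ 'n \<Rightarrow> real) \<Rightarrow> bool" where
  "C2c w w1 w2 \<longleftrightarrow> C0c w \<and> (\<forall>j. C0c (w1 j) \<and> has_partial j w (w1 j)) \<and>
     (\<forall>i j. C0c (w2 i j) \<and> has_partial j (w1 i) (w2 i j) \<and> w2 i j = w2 j i)"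

lemma C2cD:
  assumes "C2c w w1 w2"
  shows "C0c w" "C0c (w1 j)" "has_partial j w (w1 j)" "C0c (w2 i j)" "has_partial j (w1 i) (w2 i j)" "w2 i j = w2 j i"
  using assms by (auto simp: C2c_def)

lemma C0c_sum: "(\<And>i. i \<in> I \<Longrightarrow> C0c (f i)) \<Longrightarrow> C0c (\<lambda>x. \<Sum>i\<in>I. f i x)"
proof (induction I rule: infinite_finite_induct)
  case (insert i I)
  then show ?case by (simp add: C0c_add)
qed (auto simp: C0c_def)

text \<open>Expand the square and treat the product of the terms \<open>i\<close> and
  \<open>j\<close>. Integrating by parts in direction \<open>i\<close> moves the derivative onto the
  term \<open>j\<close>, giving \<open>w i * w j\<close> when \<open>j = i\<close> plus a term that
  is again of divergence form, now in direction \<open>j\<close>. A second integration by parts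
  turns it into \<open>w1 i j * w1 j i\<close>.\<close>

lemma second_order_stein:
  fixes w :: "'n \<Rightarrow> real ^ 'n \<Rightarrow> real"
  assumes w: "\<And>i. C2c (w i) (w1 i) (w2 i)"
  shows "(\<integral>x. (\<Sum>i\<in>UNIV. x $ i * w i x - w1 i i x)\<^sup>2 \<partial>gauss_measure) =
    (\<integral>x. (\<Sum>i\<in>UNIV. (w i x)\<^sup>2) + (\<Sum>i\<in>UNIV. \<Sum>j\<in>UNIV. w1 i j x * w1 j i x) \<partial>gauss_measure)"
proof -
  note D = C2cD[OF w]
  let ?d = "\<lambda>i x. x $ i * w i x - w1 i i x"
  let ?d' = "\<lambda>i j x. x $ j * w1 j i x + (if j = i then 1 else 0) * w j x - w2 j j i x"
  have cd: "C0c (?d i)" for i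
    by (intro C0c_diff C0c_mult coord_continuous D)
  have cd': "C0c (?d' i j)" for i j
    by (intro C0c_diff C0c_add C0c_mult coord_continuous D continuous_intros)
  have pd: "has_partial i (?d j) (?d' i j)" for i j
    by (intro has_partial_diff has_partial_mult has_partial_coord D)
  have ce: "C0c (\<lambda>x. x $ j * w1 j i x - w2 j i j x)" for i j
    by (intro C0c_diff C0c_mult coord_continuous D)
  have cross: "(\<integral>x. ?d i x * ?d j x \<partial>gauss_measure) =
      (\<integral>x. (if j = i then w i x * w j x else 0) + w1 i j x * w1 j i x \<partial>gauss_measure)" for i j
  proof -
    have "(\<integral>x. ?d i x * ?d j x \<partial>gauss_measure) = (\<integral>x. w i x * ?d' i j x \<partial>gauss_measure)"
      by (rule gaussian_by_parts) (intro D C0c_continuous cd cd' pd)+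
    \<comment> \<open>Here symmetry rewrites \<open>w2 j j i\<close> as \<open>w2 j i j\<close>, the
      derivative of \<open>w1 j i\<close> in direction \<open>j\<close>, which is the shape needed
      for the second integration by parts.\<close>
    also have "(\<lambda>x. w i x * ?d' i j x) =
        (\<lambda>x. (if j = i then w i x * w j x else 0) + (x $ j * w1 j i x - w2 j i j x) * w i x)"
      using D(6)[of j j i] by (auto simp: algebra_simps)
    also have "(\<integral>x. (if j = i then w i x * w j x else 0) + (x $ j * w1 j i x - w2 j i j x) * w i x \<partial>gauss_measure) =
        (\<integral>x. (if j = i then w i x * w j x else 0) \<partial>gauss_measure) +
        (\<integral>x. (x $ j * w1 j i x - w2 j i j x) * w i x \<partial>gauss_measure)"
      by (intro Bochner_Integration.integral_add C0c_integrable_gauss C0c_mult' C0c_continuous ce D)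
         (auto intro!: C0c_integrable_gauss C0c_if C0c_mult' C0c_continuous D)
    also have "(\<integral>x. (x $ j * w1 j i x - w2 j i j x) * w i x \<partial>gauss_measure) =
        (\<integral>x. w1 j i x * w1 i j x \<partial>gauss_measure)"
      by (rule gaussian_by_parts) (intro D C0c_continuous)+
    also have "(\<integral>x. (if j = i then w i x * w j x else 0) \<partial>gauss_measure) + (\<integral>x. w1 j i x * w1 i j x \<partial>gauss_measure) =
        (\<integral>x. (if j = i then w i x * w j x else 0) + w1 j i x * w1 i j x \<partial>gauss_measure)"
      by (intro Bochner_Integration.integral_add[symmetric])
         (auto intro!: C0c_integrable_gauss C0c_if C0c_mult' C0c_continuous D)
    finally show ?thesis by (simp add: mult.commute)
  qed
  have i1: "integrable gauss_measure (\<lambda>x. ?d i x * ?d j x)" for i j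
    by (intro C0c_integrable_gauss C0c_mult' cd C0c_continuous)
  have i2: "integrable gauss_measure (\<lambda>x. (if j = i then w i x * w j x else 0) + w1 i j x * w1 j i x)" for i j
    by (auto intro!: C0c_integrable_gauss C0c_add C0c_if C0c_mult' C0c_continuous D)
  have "(\<integral>x. (\<Sum>i\<in>UNIV. ?d i x)\<^sup>2 \<partial>gauss_measure) =
      (\<integral>x. (\<Sum>i\<in>UNIV. \<Sum>j\<in>UNIV. ?d i x * ?d j x) \<partial>gauss_measure)"
    by (simp add: power2_eq_square sum_product)
  also have "\<dots> = (\<Sum>i\<in>UNIV. \<Sum>j\<in>UNIV. \<integral>x. ?d i x * ?d j x \<partial>gauss_measure)"
    using i1 by (simp add: Bochner_Integration.integral_sum Bochner_Integration.integrable_sum)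
  also have "\<dots> = (\<integral>x. (\<Sum>i\<in>UNIV. \<Sum>j\<in>UNIV. (if j = i then w i x * w j x else 0) + w1 i j x * w1 j i x) \<partial>gauss_measure)"
    unfolding cross using i2 by (simp add: Bochner_Integration.integral_sum Bochner_Integration.integrable_sum del: integral_add integrable_add)
  also have "\<dots> = (\<integral>x. (\<Sum>i\<in>UNIV. (w i x)\<^sup>2) + (\<Sum>i\<in>UNIV. \<Sum>j\<in>UNIV. w1 i j x * w1 j i x) \<partial>gauss_measure)"
    by (simp add: sum.distrib power2_eq_square)
  finally show ?thesis .
qed

section \<open>The Gaussian Poincare inequality\<close>

definition gauss1 :: "real measure" where
  "gauss1 = density lborel (\<lambda>x. ennreal (std_normal_density x))"

lemma prob_space_gauss1: "prob_space gauss1"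
  unfolding gauss1_def by (rule prob_space_normal_density) simp

lemma sets_gauss1 [simp, measurable_cong]: "sets gauss1 = sets borel"
  by (simp add: gauss1_def)

lemma space_gauss1 [simp]: "space gauss1 = UNIV"
  by (simp add: gauss1_def)

lemma (in prob_space) integrable_bounded:
  fixes f :: "'a \<Rightarrow> real"
  assumes "f \<in> borel_measurable M" "\<And>x. x \<in> space M \<Longrightarrow> \<bar>f x\<bar> \<le> B"
  shows "integrable M f"
  by (rule integrable_const_bound[where B=B]) (use assms in auto)

lemma (in prob_space) expectation_square_le:
  fixes f :: "'a \<Rightarrow> real"
  assumes "integrable M f" "integrable M (\<lambda>x. (f x)\<^sup>2)"
  shows "(expectation f)\<^sup>2 \<le> expectation (\<lambda>x. (f x)\<^sup>2)"
  using variance_eq[OF assms] variance_positive[of f] by simp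

interpretation gauss1: prob_space gauss1
  by (rule prob_space_gauss1)

lemma gauss1_moments:
  "integrable gauss1 (\<lambda>x. x)" "(\<integral>x. x \<partial>gauss1) = 0"
proof -
  show "integrable gauss1 (\<lambda>x. x)"
    unfolding gauss1_def
    using integrable_std_normal_moment[of 1] by (subst integrable_density) auto
  show "(\<integral>x. x \<partial>gauss1) = 0"
    unfolding gauss1_def
    using integral_std_normal_moment_odd[of 0] by (subst integral_density) auto
qed

lemma std_normal_density_tendsto_0: "(std_normal_density \<longlongrightarrow> 0) at_top"
proof -
  have "((\<lambda>x::real. (1 / sqrt (2 * pi)) * exp (- x\<^sup>2 / 2)) \<longlongrightarrow> 0) at_top"
    by real_asymp
  then show ?thesis
    by (simp add: std_normal_density_def[abs_def])
qed

lemma std_normal_density_continuous: "isCont std_normal_density x"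
  by (rule DERIV_isCont[OF std_normal_density_deriv])

text \<open>The function \<open>x * std_normal_density x\<close> has antiderivative
  \<open>- std_normal_density x\<close>, which vanishes at infinity.\<close>

lemma gauss1_tail_mean:
  "(\<integral>y. y * indicator {t<..} y \<partial>gauss1) = std_normal_density t"
proof -
  have "(LBINT x=ereal t..\<infinity>. x * std_normal_density x) = 0 - (- std_normal_density t)"
  proof (rule interval_integral_FTC_integrable[where F="\<lambda>x. - std_normal_density x"])
    show "((\<lambda>x. - std_normal_density x) has_vector_derivative x * std_normal_density x) (at x)" for x
      using DERIV_minus[OF std_normal_density_deriv[of x]]
      by (simp add: has_real_derivative_iff_has_vector_derivative)
    show "isCont (\<lambda>x. x * std_normal_density x) x" for x
      by (intro continuous_intros std_normal_density_continuous)
    show "set_integrable lborel (einterval (ereal t) \<infinity>) (\<lambda>x. x * std_normal_density x)"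
      unfolding set_integrable_def
      by (intro integrable_mult_indicator)
         (use integrable_std_normal_moment[of 1] in \<open>auto simp: mult.commute\<close>)
    have "((\<lambda>x. - std_normal_density x) \<longlongrightarrow> - std_normal_density t) (at_right t)"
      using std_normal_density_continuous[of t]
      by (intro tendsto_minus) (auto simp: continuous_at intro: tendsto_within_subset)
    then show "(((\<lambda>x. - std_normal_density x) \<circ> real_of_ereal) \<longlongrightarrow> - std_normal_density t) (at_right (ereal t))"
      by (simp only: ereal_tendsto_simps1)
    show "(((\<lambda>x. - std_normal_density x) \<circ> real_of_ereal) \<longlongrightarrow> 0) (at_left \<infinity>)"
      using tendsto_minus[OF std_normal_density_tendsto_0] by (simp only: ereal_tendsto_simps1 minus_zero)
  qed simp
  moreover have "(LBINT x=ereal t..\<infinity>. x * std_normal_density x) =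
      (\<integral>x. std_normal_density x * (x * indicator {t<..} x) \<partial>lborel)"
    by (auto simp: interval_lebesgue_integral_def set_lebesgue_integral_def einterval_def
        indicator_def intro!: Bochner_Integration.integral_cong)
  moreover have "(\<integral>y. y * indicator {t<..} y \<partial>gauss1) =
      (\<integral>x. std_normal_density x * (x * indicator {t<..} x) \<partial>lborel)"
    unfolding gauss1_def by (subst integral_density) auto
  ultimately show ?thesis by simp
qed

text \<open>Cauchy-Schwarz for \<open>u y - u x\<close> as the integral of \<open>u'\<close>,
  derived from the nonnegative integral of the squared deviation of \<open>u'\<close> from the mean
  slope \<open>d\<close>.\<close>

lemma square_increment_le:
  fixes u u' :: "real \<Rightarrow> real"
  assumes u: "\<And>t. (u has_real_derivative u' t) (at t)" and c: "continuous_on UNIV u'" and "x < y"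
  shows "ennreal ((u y - u x)\<^sup>2) \<le>
    (\<integral>\<^sup>+t. ennreal (u' t ^ 2 * ((y - x) * indicator {x<..<y} t)) \<partial>lborel)"
proof -
  define d where "d = (u y - u x) / (y - x)"
  have cont: "isCont g t" if "continuous_on UNIV g" for g :: "real \<Rightarrow> real" and t
    using that by (simp add: continuous_on_eq_continuous_at)
  have i: "integrable lborel (\<lambda>t. g t * indicator {x..y} t)" if "continuous_on UNIV g" for g :: "real \<Rightarrow> real"
    using borel_integrable_atLeastAtMost[of x y g] cont[OF that] by auto
  have f: "(\<integral>t. u' t * indicator {x..y} t \<partial>lborel) = u y - u x"
    by (rule integral_FTC_Icc_real) (use u c cont \<open>x < y\<close> in auto)
  have "0 \<le> (\<integral>t. (u' t - d)\<^sup>2 * indicator {x..y} t \<partial>lborel)"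
    by (intro integral_nonneg_AE) auto
  also have "(\<lambda>t. (u' t - d)\<^sup>2 * indicator {x..y} t) =
      (\<lambda>t. (u' t)\<^sup>2 * indicator {x..y} t - 2 * d * (u' t * indicator {x..y} t) + d\<^sup>2 * indicator {x..y} t)"
    by (auto simp: indicator_def power2_diff)
  also have "(\<integral>t. (u' t)\<^sup>2 * indicator {x..y} t - 2 * d * (u' t * indicator {x..y} t) + d\<^sup>2 * indicator {x..y} t \<partial>lborel)
      = (\<integral>t. (u' t)\<^sup>2 * indicator {x..y} t \<partial>lborel) - 2 * d * (u y - u x) + d\<^sup>2 * (y - x)"
    using i[of u'] i[of "\<lambda>t. (u' t)\<^sup>2"] i[of "\<lambda>_. 1"] c \<open>x < y\<close>
    by (simp add: f continuous_on_power)
  finally have "(y - x) * (2 * d * (u y - u x) - d\<^sup>2 * (y - x)) \<le> (y - x) * (\<integral>t. (u' t)\<^sup>2 * indicator {x..y} t \<partial>lborel)"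
    using \<open>x < y\<close> by (intro mult_left_mono) auto
  also have "(y - x) * (2 * d * (u y - u x) - d\<^sup>2 * (y - x)) = (u y - u x)\<^sup>2"
  proof -
    have "d * (y - x) = u y - u x"
      using \<open>x < y\<close> by (simp add: d_def)
    moreover have "(y - x) * (2 * d * (u y - u x) - d\<^sup>2 * (y - x)) =
        2 * (d * (y - x)) * (u y - u x) - (d * (y - x))\<^sup>2"
      by (simp add: power2_eq_square algebra_simps)
    ultimately show ?thesis
      by (simp add: power2_eq_square)
  qed
  also have "(y - x) * (\<integral>t. (u' t)\<^sup>2 * indicator {x..y} t \<partial>lborel) =
      (\<integral>t. (u' t)\<^sup>2 * ((y - x) * indicator {x..y} t) \<partial>lborel)"
    by (subst integral_mult_right_zero[symmetric]) (simp add: mult_ac)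
  finally have "ennreal ((u y - u x)\<^sup>2) \<le> ennreal (\<integral>t. (u' t)\<^sup>2 * ((y - x) * indicator {x..y} t) \<partial>lborel)"
    by (rule ennreal_leI)
  also have "\<dots> = (\<integral>\<^sup>+t. ennreal ((u' t)\<^sup>2 * ((y - x) * indicator {x..y} t)) \<partial>lborel)"
  proof (rule nn_integral_eq_integral[symmetric])
    show "integrable lborel (\<lambda>t. (u' t)\<^sup>2 * ((y - x) * indicator {x..y} t))"
      using i[of "\<lambda>t. (u' t)\<^sup>2 * (y - x)"] c by (simp add: continuous_intros mult.assoc)
  qed (use \<open>x < y\<close> in auto)
  \<comment> \<open>Dropping the endpoints, a null set, matches the open intervals of the kernel in
    \<open>gauss1_kernel\<close>.\<close>
  also have "\<dots> = (\<integral>\<^sup>+t. ennreal ((u' t)\<^sup>2 * ((y - x) * indicator {x<..<y} t)) \<partial>lborel)"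
  proof (rule nn_integral_cong_AE)
    have "AE t in lborel. t \<noteq> x" "AE t in lborel. t \<noteq> y"
      by (rule AE_lborel_singleton)+
    then show "AE t in lborel. ennreal ((u' t)\<^sup>2 * ((y - x) * indicator {x..y} t)) =
        ennreal ((u' t)\<^sup>2 * ((y - x) * indicator {x<..<y} t))"
      by eventually_elim (auto simp: indicator_def)
  qed
  finally show ?thesis .
qed

text \<open>The factor 2, compensated by \<open>E (u(X) - u(Y))\<^sup>2 = 2 Var u(X)\<close>, is what makes the Poincare
  constant exactly 1.\<close>

lemma gauss1_kernel:
  "(\<integral>\<^sup>+x. \<integral>\<^sup>+y. ennreal ((y - x) * indicator {x<..<y} t + (x - y) * indicator {y<..<x} t) \<partial>gauss1 \<partial>gauss1)
     = ennreal (2 * std_normal_density t)"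
proof -
  define p where "p = (\<lambda>y. (y - t) * indicator {t<..} y)"
  define q where "q = (\<lambda>y. (t - y) * indicator {..<t} y)"
  define a where "a = (indicator {..<t} :: real \<Rightarrow> real)"
  define b where "b = (indicator {t<..} :: real \<Rightarrow> real)"
  have [measurable]: "p \<in> borel_measurable borel" "q \<in> borel_measurable borel"
      "a \<in> borel_measurable borel" "b \<in> borel_measurable borel"
    by (auto simp: p_def q_def a_def b_def)
  have nn: "0 \<le> p x" "0 \<le> q x" "0 \<le> a x" "0 \<le> b x" for x
    by (auto simp: p_def q_def a_def b_def indicator_def)
  \<comment> \<open>If t lies between x and y, the distance splits at t, e.g. y - x = (y - t) + (t -
    x). So the kernel is a sum of products of functions of one variable each, and the double
    integral factorises.\<close>
  have k: "(y - x) * indicator {x<..<y} t + (x - y) * indicator {y<..<x} t =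
      p y * a x + q x * b y + (p x * a y + q y * b x)" for x y
    by (auto simp: p_def q_def a_def b_def indicator_def)
  have ix: "integrable gauss1 (\<lambda>x. x - t)" "integrable gauss1 (\<lambda>x. t - x)"
    using gauss1_moments by auto
  have i: "integrable gauss1 p" "integrable gauss1 q" "integrable gauss1 a" "integrable gauss1 b"
  proof -
    show "integrable gauss1 p" unfolding p_def by (rule integrable_real_mult_indicator) (use ix in auto)
    show "integrable gauss1 q" unfolding q_def by (rule integrable_real_mult_indicator) (use ix in auto)
    show "integrable gauss1 a" "integrable gauss1 b"
      by (intro gauss1.integrable_bounded[where B=1]; simp add: a_def b_def indicator_def)+
  qed
  define P Q A B where "P = (\<integral>x. p x \<partial>gauss1)" "Q = (\<integral>x. q x \<partial>gauss1)"
    "A = (\<integral>x. a x \<partial>gauss1)" "B = (\<integral>x. b x \<partial>gauss1)"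
  note defs = P_Q_A_B_def
  have AE1: "AE x in gauss1. a x + b x = 1"
  proof -
    have "AE x in lborel. x \<noteq> t" by (rule AE_lborel_singleton)
    then have "AE x in lborel. a x + b x = 1"
      by eventually_elim (auto simp: a_def b_def indicator_def)
    then show ?thesis unfolding gauss1_def by (subst AE_density) auto
  qed
  have AB: "A + B = 1"
  proof -
    have "A + B = (\<integral>x. a x + b x \<partial>gauss1)" using i by (simp add: defs)
    also have "\<dots> = (\<integral>x. 1 \<partial>gauss1)" by (rule integral_cong_AE) (use AE1 in auto)
    also have "\<dots> = 1" using gauss1.prob_space by simp
    finally show ?thesis .
  qed
  have "P - Q = (\<integral>x. p x - q x \<partial>gauss1)"
    unfolding defs using i by simp
  also have "\<dots> = (\<integral>x. x - t \<partial>gauss1)"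
    by (intro Bochner_Integration.integral_cong) (auto simp: p_def q_def indicator_def)
  also have "\<dots> = - t"
    using gauss1_moments gauss1.prob_space by simp
  finally have PQ: "P - Q = - t" .
  have "P = (\<integral>y. y * indicator {t<..} y - t * b y \<partial>gauss1)"
    unfolding defs by (intro Bochner_Integration.integral_cong) (auto simp: p_def b_def indicator_def)
  also have "\<dots> = std_normal_density t - t * B"
    using i gauss1_moments
    by (subst Bochner_Integration.integral_diff)
       (auto simp: gauss1_tail_mean defs intro!: integrable_real_mult_indicator)
  finally have P: "P = std_normal_density t - t * B" .
  have Q: "Q = std_normal_density t + t * A"
  proof -
    have A: "A = 1 - B" using AB by simp
    have "t * A = t - t * B" unfolding A by (simp add: right_diff_distrib)
    then show ?thesis using PQ P by linarith
  qed
  \<comment> \<open>The terms with t cancel between P A = (density - t B) A and Q B = (density + t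
    A) B. The two orderings of x and y contribute this value once each.\<close>
  have PAQB: "P * A + Q * B = std_normal_density t"
  proof -
    have "P * A + Q * B = std_normal_density t * (A + B)"
      unfolding P Q by (simp add: algebra_simps)
    then show ?thesis by (simp add: AB)
  qed
  have e: "(\<integral>\<^sup>+y. ennreal (f y) \<partial>gauss1) = ennreal (\<integral>y. f y \<partial>gauss1)"
    if "integrable gauss1 f" "\<And>y. 0 \<le> f y" for f
    using that by (intro nn_integral_eq_integral) auto
  have "(\<integral>\<^sup>+x. \<integral>\<^sup>+y. ennreal (p y * a x + q x * b y + (p x * a y + q y * b x)) \<partial>gauss1 \<partial>gauss1)
      = (\<integral>\<^sup>+x. ennreal (P * a x + q x * B + (p x * A + Q * b x)) \<partial>gauss1)"
    by (rule nn_integral_cong, subst e) (use i nn in \<open>auto simp: defs\<close>)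
  also have "\<dots> = ennreal (P * A + Q * B + (P * A + Q * B))"
  proof (subst e)
    show "integrable gauss1 (\<lambda>x. P * a x + q x * B + (p x * A + Q * b x))"
      using i by auto
    have "0 \<le> P" "0 \<le> Q" "0 \<le> A" "0 \<le> B"
      unfolding defs using nn by (auto intro!: integral_nonneg_AE)
    then show "0 \<le> P * a y + q y * B + (p y * A + Q * b y)" for y
      using nn by auto
    show "ennreal (\<integral>x. P * a x + q x * B + (p x * A + Q * b x) \<partial>gauss1) =
        ennreal (P * A + Q * B + (P * A + Q * B))"
      using i by (simp add: defs)
  qed
  finally show ?thesis
    unfolding k by (simp add: PAQB)
qed

text \<open>Twice the variance is the mean square of \<open>u y - u x\<close> for independent x and
  y. Bounding it by \<open>square_increment_le\<close> and integrating over x and y first, by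
  Tonelli, leaves the square of \<open>u' t\<close> with the weight computed in
  \<open>gauss1_kernel\<close>.\<close>

lemma poincare_1d:
  fixes u u' :: "real \<Rightarrow> real"
  assumes u: "\<And>t. (u has_real_derivative u' t) (at t)" and c: "continuous_on UNIV u'"
    and B: "\<And>t. \<bar>u t\<bar> \<le> B" "\<And>t. \<bar>u' t\<bar> \<le> B"
  shows "(\<integral>x. (u x)\<^sup>2 \<partial>gauss1) - (\<integral>x. u x \<partial>gauss1)\<^sup>2 \<le> (\<integral>x. (u' x)\<^sup>2 \<partial>gauss1)"
proof -
  have cu: "continuous_on UNIV u"
    using u by (auto intro!: continuous_at_imp_continuous_on DERIV_isCont)
  note [measurable] = borel_measurable_continuous_onI[OF cu] borel_measurable_continuous_onI[OF c]
  have B0: "B \<ge> 0" using B(1)[of 0] by linarith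
  have sq: "\<bar>(u t)\<^sup>2\<bar> \<le> B\<^sup>2" "\<bar>(u' t)\<^sup>2\<bar> \<le> B\<^sup>2" for t
    using B[of t] B0 by (auto simp: abs_le_square_iff[symmetric])
  have i: "integrable gauss1 u" "integrable gauss1 (\<lambda>x. (u x)\<^sup>2)" "integrable gauss1 (\<lambda>x. (u' x)\<^sup>2)"
    using B sq by (auto intro!: gauss1.integrable_bounded)
  define m where "m = (\<integral>x. u x \<partial>gauss1)"
  define s where "s = (\<integral>x. (u x)\<^sup>2 \<partial>gauss1)"
  define k :: "real \<Rightarrow> real \<Rightarrow> real \<Rightarrow> real" where
    "k = (\<lambda>x y t. (y - x) * indicator {x<..<y} t + (x - y) * indicator {y<..<x} t)"
  have k_if: "k x y t = (if x < t \<and> t < y then y - x else 0) + (if y < t \<and> t < x then x - y else 0)" for x y t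
    by (auto simp: k_def indicator_def)
  \<comment> \<open>Stated for composed arguments, so that the joint measurability demanded by both
    uses of Tonelli is automatic.\<close>
  have [measurable (raw)]: "(\<lambda>z. k (a z) (b z) (c z)) \<in> borel_measurable N"
    if [measurable]: "a \<in> borel_measurable N" "b \<in> borel_measurable N" "c \<in> borel_measurable N"
    for a b c and N :: "'z measure"
    unfolding k_if by measurable
  have knn: "0 \<le> k x y t" for x y t by (auto simp: k_if)
  have inner: "(\<integral>\<^sup>+y. ennreal ((u y - u x)\<^sup>2) \<partial>gauss1) = ennreal (s - 2 * u x * m + (u x)\<^sup>2)" for x
  proof -
    have "(\<integral>\<^sup>+y. ennreal ((u y - u x)\<^sup>2) \<partial>gauss1) = ennreal (\<integral>y. (u y - u x)\<^sup>2 \<partial>gauss1)"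
    proof (rule nn_integral_eq_integral)
      show "integrable gauss1 (\<lambda>y. (u y - u x)\<^sup>2)"
        using i by (simp add: power2_diff)
    qed simp
    also have "(\<integral>y. (u y - u x)\<^sup>2 \<partial>gauss1) = s - 2 * u x * m + (u x)\<^sup>2"
      using i gauss1.prob_space by (simp add: power2_diff m_def s_def mult_ac)
    finally show ?thesis .
  qed
  have "(\<integral>\<^sup>+x. ennreal (s - 2 * u x * m + (u x)\<^sup>2) \<partial>gauss1) = ennreal (\<integral>x. s - 2 * u x * m + (u x)\<^sup>2 \<partial>gauss1)"
  proof (rule nn_integral_eq_integral)
    have "0 \<le> s - 2 * u x * m + (u x)\<^sup>2" for x
    proof -
      have "m\<^sup>2 \<le> s"
        unfolding m_def s_def by (rule gauss1.expectation_square_le[OF i(1,2)])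
      moreover have "0 \<le> (u x - m)\<^sup>2" by simp
      ultimately show ?thesis by (simp add: power2_diff)
    qed
    then show "AE x in gauss1. 0 \<le> s - 2 * u x * m + (u x)\<^sup>2" by simp
  qed (use i in auto)
  also have "(\<integral>x. s - 2 * u x * m + (u x)\<^sup>2 \<partial>gauss1) = 2 * (s - m\<^sup>2)"
    using i gauss1.prob_space by (simp add: m_def[symmetric] s_def[symmetric]) (simp add: power2_eq_square)
  finally have "ennreal (2 * (s - m\<^sup>2)) = (\<integral>\<^sup>+x. \<integral>\<^sup>+y. ennreal ((u y - u x)\<^sup>2) \<partial>gauss1 \<partial>gauss1)"
    by (simp add: inner)
  also have "\<dots> \<le> (\<integral>\<^sup>+x. \<integral>\<^sup>+y. \<integral>\<^sup>+t. ennreal ((u' t)\<^sup>2 * k x y t) \<partial>lborel \<partial>gauss1 \<partial>gauss1)"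
  proof (intro nn_integral_mono)
    fix x y :: real
    consider "x < y" | "y < x" | "x = y" by linarith
    then show "ennreal ((u y - u x)\<^sup>2) \<le> (\<integral>\<^sup>+t. ennreal ((u' t)\<^sup>2 * k x y t) \<partial>lborel)"
    proof cases
      case 1
      then show ?thesis using square_increment_le[OF u c 1] by (simp add: k_def)
    next
      case 2
      then show ?thesis using square_increment_le[OF u c 2] by (simp add: k_def power2_commute[of "u y"])
    qed simp
  qed
  also have "\<dots> = (\<integral>\<^sup>+x. \<integral>\<^sup>+t. \<integral>\<^sup>+y. ennreal ((u' t)\<^sup>2 * k x y t) \<partial>gauss1 \<partial>lborel \<partial>gauss1)"
  proof (rule nn_integral_cong)
    fix x :: real
    interpret pair_sigma_finite gauss1 lborel ..
    show "(\<integral>\<^sup>+y. \<integral>\<^sup>+t. ennreal ((u' t)\<^sup>2 * k x y t) \<partial>lborel \<partial>gauss1) =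
        (\<integral>\<^sup>+t. \<integral>\<^sup>+y. ennreal ((u' t)\<^sup>2 * k x y t) \<partial>gauss1 \<partial>lborel)"
      by (rule Fubini'[symmetric]) measurable
  qed
  also have "\<dots> = (\<integral>\<^sup>+t. \<integral>\<^sup>+x. \<integral>\<^sup>+y. ennreal ((u' t)\<^sup>2 * k x y t) \<partial>gauss1 \<partial>gauss1 \<partial>lborel)"
  proof -
    interpret pair_sigma_finite gauss1 lborel ..
    show ?thesis
      by (rule Fubini'[symmetric]) measurable
  qed
  also have "\<dots> = (\<integral>\<^sup>+t. ennreal ((u' t)\<^sup>2) * (\<integral>\<^sup>+x. \<integral>\<^sup>+y. ennreal (k x y t) \<partial>gauss1 \<partial>gauss1) \<partial>lborel)"
  proof (rule nn_integral_cong)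
    fix t :: real
    have "(\<integral>\<^sup>+x. \<integral>\<^sup>+y. ennreal ((u' t)\<^sup>2 * k x y t) \<partial>gauss1 \<partial>gauss1) =
        (\<integral>\<^sup>+x. ennreal ((u' t)\<^sup>2) * (\<integral>\<^sup>+y. ennreal (k x y t) \<partial>gauss1) \<partial>gauss1)"
      by (simp add: ennreal_mult' nn_integral_cmult)
    also have "\<dots> = ennreal ((u' t)\<^sup>2) * (\<integral>\<^sup>+x. \<integral>\<^sup>+y. ennreal (k x y t) \<partial>gauss1 \<partial>gauss1)"
      by (simp add: nn_integral_cmult)
    finally show "(\<integral>\<^sup>+x. \<integral>\<^sup>+y. ennreal ((u' t)\<^sup>2 * k x y t) \<partial>gauss1 \<partial>gauss1) = \<dots>" .
  qed
  also have "\<dots> = (\<integral>\<^sup>+t. ennreal (std_normal_density t) * ennreal (2 * (u' t)\<^sup>2) \<partial>lborel)"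
    unfolding k_def gauss1_kernel by (simp add: ennreal_mult'[symmetric] mult_ac)
  also have "\<dots> = (\<integral>\<^sup>+t. ennreal (2 * (u' t)\<^sup>2) \<partial>gauss1)"
    unfolding gauss1_def by (subst nn_integral_density) auto
  also have "\<dots> = ennreal (\<integral>t. 2 * (u' t)\<^sup>2 \<partial>gauss1)"
    by (rule nn_integral_eq_integral) (use i in auto)
  finally have "2 * (s - m\<^sup>2) \<le> (\<integral>t. 2 * (u' t)\<^sup>2 \<partial>gauss1)"
    by (subst (asm) ennreal_le_iff) (auto intro!: integral_nonneg_AE)
  then show ?thesis by (simp add: s_def m_def)
qed

section \<open>Tensorisation of the Poincare inequality\<close>

abbreviation gauss_prod :: "'i set \<Rightarrow> ('i \<Rightarrow> real) measure" where
  "gauss_prod I \<equiv> Pi\<^sub>M I (\<lambda>_. gauss1)"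

interpretation gaussPi: product_prob_space "\<lambda>_. gauss1" I for I
  by unfold_locales

lemma prob_space_gauss_prod: "prob_space (gauss_prod I)"
  by (rule prob_space_PiM) (rule prob_space_gauss1)

lemma (in prob_space) abs_expectation_le:
  fixes f :: "'a \<Rightarrow> real"
  assumes "\<And>x. x \<in> space M \<Longrightarrow> \<bar>f x\<bar> \<le> B"
  shows "\<bar>expectation f\<bar> \<le> B"
proof (cases "integrable M f")
  case True
  have "\<bar>expectation f\<bar> \<le> expectation (\<lambda>x. \<bar>f x\<bar>)"
    by (rule integral_abs_bound)
  also have "\<dots> \<le> expectation (\<lambda>x. B)"
    using True assms by (intro integral_mono) auto
  finally show ?thesis by (simp add: prob_space)
next
  case False
  \<comment> \<open>A non-integrable function has integral 0 by default, and B is nonnegative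
    because the space has a point.\<close>
  obtain x where "x \<in> space M" using not_empty by auto
  then have "0 \<le> B" using assms[of x] by linarith
  then show ?thesis using False by (simp add: not_integrable_integral_eq)
qed

text \<open>Induction on the index set, which is why the variables are functions on \<open>I\<close>
  rather than vectors. The one-dimensional inequality in the new coordinate \<open>i\<close>
  compares \<open>F\<close> with its average \<open>A\<close> over that coordinate. The induction
  hypothesis applies to \<open>A\<close>, whose derivatives \<open>A'\<close> are averages of the
  \<open>F'\<close>, and Jensen bounds their squares. The common bound B provides integrability and
  domination throughout.\<close>

lemma poincare_product:
  fixes F :: "('i \<Rightarrow> real) \<Rightarrow> real" and F' :: "'i \<Rightarrow> ('i \<Rightarrow> real) \<Rightarrow> real"
  assumes "finite I"
    and "F \<in> borel_measurable (gauss_prod I)" "\<And>i. i \<in> I \<Longrightarrow> F' i \<in> borel_measurable (gauss_prod I)"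
    and "\<And>x. x \<in> space (gauss_prod I) \<Longrightarrow> \<bar>F x\<bar> \<le> B"
    and "\<And>i x. i \<in> I \<Longrightarrow> x \<in> space (gauss_prod I) \<Longrightarrow> \<bar>F' i x\<bar> \<le> B"
    and "\<And>i x t. i \<in> I \<Longrightarrow> x \<in> space (gauss_prod I) \<Longrightarrow>
      ((\<lambda>t. F (x(i := t))) has_real_derivative F' i (x(i := t))) (at t)"
    and "\<And>i x. i \<in> I \<Longrightarrow> x \<in> space (gauss_prod I) \<Longrightarrow> continuous_on UNIV (\<lambda>t. F' i (x(i := t)))"
  shows "(\<integral>x. (F x)\<^sup>2 \<partial>gauss_prod I) - (\<integral>x. F x \<partial>gauss_prod I)\<^sup>2 \<le> (\<Sum>i\<in>I. \<integral>x. (F' i x)\<^sup>2 \<partial>gauss_prod I)"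
  using assms
proof (induction I arbitrary: F F' rule: finite_induct)
  \<comment> \<open>The product over no coordinates is a point mass, so the variance is 0.\<close>
  case empty
  then show ?case by (simp add: PiM_empty lebesgue_integral_count_space_finite)
next
  case (insert i I)
  note F = insert.prems(1) and F' = insert.prems(2)
  note BF = insert.prems(3) and BF' = insert.prems(4)
  note dF = insert.prems(5) and cF' = insert.prems(6)
  have upd: "x(i := y) \<in> space (gauss_prod (insert i I))" if "x \<in> space (gauss_prod I)" for x y
    using that by (auto simp: space_PiM PiE_def extensional_def)
  have upd': "x(j := y) \<in> space (gauss_prod I)" if "x \<in> space (gauss_prod I)" "j \<in> I" for x y j
    using that by (auto simp: space_PiM PiE_def extensional_def)
  have ext: "(\<lambda>(x, y). H (x(i := y))) \<in> borel_measurable (gauss_prod I \<Otimes>\<^sub>M gauss1)"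
    if "H \<in> borel_measurable (gauss_prod (insert i I))" for H :: "('i \<Rightarrow> real) \<Rightarrow> real"
    using measurable_compose[OF measurable_add_dim that] by (simp add: case_prod_beta')
  have ext1: "(\<lambda>y. H (x(i := y))) \<in> borel_measurable gauss1"
    if "H \<in> borel_measurable (gauss_prod (insert i I))" "x \<in> space (gauss_prod I)" for H :: "('i \<Rightarrow> real) \<Rightarrow> real" and x
    using measurable_Pair2[OF ext[OF that(1)] that(2)] by simp
  have ext2: "(\<lambda>x. \<integral>y. H (x(i := y)) \<partial>gauss1) \<in> borel_measurable (gauss_prod I)"
    if "H \<in> borel_measurable (gauss_prod (insert i I))" for H :: "('i \<Rightarrow> real) \<Rightarrow> real"
    using gauss1.borel_measurable_lebesgue_integral[OF ext[OF that]] .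
  have sq: "\<bar>a\<^sup>2\<bar> \<le> B\<^sup>2" if "\<bar>a\<bar> \<le> B" for a
    using that by (simp add: abs_le_square_iff[symmetric])
  have fubini: "(\<integral>x. H x \<partial>gauss_prod (insert i I)) = (\<integral>x. \<integral>y. H (x(i := y)) \<partial>gauss1 \<partial>gauss_prod I)"
    and int2: "integrable (gauss_prod I) (\<lambda>x. \<integral>y. H (x(i := y)) \<partial>gauss1)"
    if H: "H \<in> borel_measurable (gauss_prod (insert i I))"
      and BH: "\<And>x. x \<in> space (gauss_prod (insert i I)) \<Longrightarrow> \<bar>H x\<bar> \<le> C" for H :: "('i \<Rightarrow> real) \<Rightarrow> real" and C
  proof -
    show "(\<integral>x. H x \<partial>gauss_prod (insert i I)) = (\<integral>x. \<integral>y. H (x(i := y)) \<partial>gauss1 \<partial>gauss_prod I)"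
      by (rule gaussPi.product_integral_insert[OF insert.hyps(1,2)])
         (rule prob_space.integrable_bounded[OF prob_space_gauss_prod H BH])
    show "integrable (gauss_prod I) (\<lambda>x. \<integral>y. H (x(i := y)) \<partial>gauss1)"
      by (rule prob_space.integrable_bounded[OF prob_space_gauss_prod ext2[OF H], where B=C])
         (intro gauss1.abs_expectation_le BH upd)
  qed
  define A where "A = (\<lambda>x. \<integral>y. F (x(i := y)) \<partial>gauss1)"
  define A' where "A' = (\<lambda>j x. \<integral>y. F' j (x(i := y)) \<partial>gauss1)"
  have A2: "integrable (gauss_prod I) (\<lambda>x. (A x)\<^sup>2)"
    unfolding A_def
    by (rule prob_space.integrable_bounded[OF prob_space_gauss_prod borel_measurable_power[OF ext2[OF F]], where B="B\<^sup>2"])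
       (intro sq gauss1.abs_expectation_le BF upd)
  have IH: "(\<integral>x. (A x)\<^sup>2 \<partial>gauss_prod I) - (\<integral>x. A x \<partial>gauss_prod I)\<^sup>2 \<le> (\<Sum>j\<in>I. \<integral>x. (A' j x)\<^sup>2 \<partial>gauss_prod I)"
  proof (rule insert.IH)
    show "A \<in> borel_measurable (gauss_prod I)"
      unfolding A_def by (rule ext2[OF F])
    show "A' j \<in> borel_measurable (gauss_prod I)" if "j \<in> I" for j
      unfolding A'_def by (rule ext2[OF F']) (use that in simp)
    show "\<bar>A x\<bar> \<le> B" if "x \<in> space (gauss_prod I)" for x
      unfolding A_def by (intro gauss1.abs_expectation_le BF upd that)
    show "\<bar>A' j x\<bar> \<le> B" if "j \<in> I" "x \<in> space (gauss_prod I)" for j x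
      unfolding A'_def using that by (intro gauss1.abs_expectation_le BF' upd) auto
    fix j x assume j: "j \<in> I" and x: "x \<in> space (gauss_prod I)"
    then have ij: "j \<noteq> i" and j': "j \<in> insert i I" using insert.hyps by auto
    have tw: "x(j := t, i := y) = x(i := y, j := t)" for t y
      using ij by (rule fun_upd_twist)
    show "((\<lambda>t. A (x(j := t))) has_real_derivative A' j (x(j := t))) (at t)" for t
      unfolding A_def A'_def
    proof (rule DERIV_integral[where g="\<lambda>_. B"])
      show "integrable gauss1 (\<lambda>y. F (x(j := t, i := y)))" for t
        by (rule gauss1.integrable_bounded[OF ext1[OF F], where B=B]) (intro upd' x j BF upd)+
      show "((\<lambda>t. F (x(j := t, i := y))) has_real_derivative F' j (x(j := t, i := y))) (at t)" for t y
        unfolding tw by (rule dF[OF j' upd[OF x]])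
      show "\<bar>F' j (x(j := t, i := y))\<bar> \<le> B" for t y
        by (intro BF' j' upd upd' x j)
      show "(\<lambda>y. F' j (x(j := t, i := y))) \<in> borel_measurable gauss1"
        by (intro ext1 F' j' upd' x j)
    qed simp
    show "continuous_on UNIV (\<lambda>t. A' j (x(j := t)))"
      unfolding A'_def
    proof (rule continuous_on_integral[where g="\<lambda>_. B"])
      show "continuous_on UNIV (\<lambda>t. F' j (x(j := t, i := y)))" for y
        unfolding tw by (rule cF'[OF j' upd[OF x]])
      show "\<bar>F' j (x(j := t, i := y))\<bar> \<le> B" for t y
        by (intro BF' j' upd upd' x j)
      show "(\<lambda>y. F' j (x(j := t, i := y))) \<in> borel_measurable gauss1" for t
        by (intro ext1 F' j' upd' x j)
    qed simp
  qed
  have F2: "(\<lambda>x. (F x)\<^sup>2) \<in> borel_measurable (gauss_prod (insert i I))"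
    using F by simp
  have F'2: "(\<lambda>x. (F' j x)\<^sup>2) \<in> borel_measurable (gauss_prod (insert i I))" if "j \<in> insert i I" for j
    using F'[OF that] by simp
  have bF2: "\<bar>(F x)\<^sup>2\<bar> \<le> B\<^sup>2" if "x \<in> space (gauss_prod (insert i I))" for x
    by (intro sq BF that)
  have bF'2: "\<bar>(F' j x)\<^sup>2\<bar> \<le> B\<^sup>2" if "j \<in> insert i I" "x \<in> space (gauss_prod (insert i I))" for j x
    by (intro sq BF' that)
  have "(\<integral>x. (F x)\<^sup>2 \<partial>gauss_prod (insert i I)) = (\<integral>x. \<integral>y. (F (x(i := y)))\<^sup>2 \<partial>gauss1 \<partial>gauss_prod I)"
    by (rule fubini[OF F2 bF2])
  also have "\<dots> \<le> (\<integral>x. (A x)\<^sup>2 + (\<integral>y. (F' i (x(i := y)))\<^sup>2 \<partial>gauss1) \<partial>gauss_prod I)"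
  proof (rule integral_mono)
    show "integrable (gauss_prod I) (\<lambda>x. \<integral>y. (F (x(i := y)))\<^sup>2 \<partial>gauss1)"
      by (rule int2[OF F2 bF2])
    show "integrable (gauss_prod I) (\<lambda>x. (A x)\<^sup>2 + (\<integral>y. (F' i (x(i := y)))\<^sup>2 \<partial>gauss1))"
      by (intro Bochner_Integration.integrable_add A2 int2[OF F'2 bF'2]) auto
    fix x assume x: "x \<in> space (gauss_prod I)"
    have i: "i \<in> insert i I" by simp
    have "(\<integral>y. (F (x(i := y)))\<^sup>2 \<partial>gauss1) - (A x)\<^sup>2 \<le> (\<integral>y. (F' i (x(i := y)))\<^sup>2 \<partial>gauss1)"
      unfolding A_def
    proof (rule poincare_1d[where B=B])
      show "((\<lambda>y. F (x(i := y))) has_real_derivative F' i (x(i := t))) (at t)" for t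
        \<comment> \<open>The hypothesis wants a base point with all coordinates; the value 0 placed
          at \<open>i\<close> is overwritten at once.\<close>
        using dF[OF i upd[OF x, of 0], of t] by (simp only: fun_upd_upd)
      show "continuous_on UNIV (\<lambda>y. F' i (x(i := y)))"
        using cF'[OF i upd[OF x, of 0]] by (simp only: fun_upd_upd)
    qed (intro BF BF' i upd x)+
    then show "(\<integral>y. (F (x(i := y)))\<^sup>2 \<partial>gauss1) \<le> (A x)\<^sup>2 + (\<integral>y. (F' i (x(i := y)))\<^sup>2 \<partial>gauss1)"
      by simp
  qed
  also have "\<dots> = (\<integral>x. (A x)\<^sup>2 \<partial>gauss_prod I) + (\<integral>x. \<integral>y. (F' i (x(i := y)))\<^sup>2 \<partial>gauss1 \<partial>gauss_prod I)"
    by (rule Bochner_Integration.integral_add[OF A2 int2[OF F'2 bF'2]]) auto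
  also have "(\<integral>x. \<integral>y. (F' i (x(i := y)))\<^sup>2 \<partial>gauss1 \<partial>gauss_prod I) = (\<integral>x. (F' i x)\<^sup>2 \<partial>gauss_prod (insert i I))"
    by (rule fubini[OF F'2 bF'2, symmetric]) auto
  finally have 1: "(\<integral>x. (F x)\<^sup>2 \<partial>gauss_prod (insert i I)) \<le>
      (\<integral>x. (A x)\<^sup>2 \<partial>gauss_prod I) + (\<integral>x. (F' i x)\<^sup>2 \<partial>gauss_prod (insert i I))" .
  have 2: "(\<integral>x. F x \<partial>gauss_prod (insert i I)) = (\<integral>x. A x \<partial>gauss_prod I)"
    unfolding A_def by (rule fubini[OF F BF])
  have 3: "(\<integral>x. (A' j x)\<^sup>2 \<partial>gauss_prod I) \<le> (\<integral>x. (F' j x)\<^sup>2 \<partial>gauss_prod (insert i I))" if "j \<in> I" for j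
  proof -
    have j: "j \<in> insert i I" using that by simp
    have "(\<integral>x. (A' j x)\<^sup>2 \<partial>gauss_prod I) \<le> (\<integral>x. \<integral>y. (F' j (x(i := y)))\<^sup>2 \<partial>gauss1 \<partial>gauss_prod I)"
    proof (rule integral_mono)
      show "integrable (gauss_prod I) (\<lambda>x. (A' j x)\<^sup>2)"
        unfolding A'_def
        by (rule prob_space.integrable_bounded[OF prob_space_gauss_prod borel_measurable_power[OF ext2[OF F'[OF j]]], where B="B\<^sup>2"])
           (intro sq gauss1.abs_expectation_le BF' j upd)
      show "integrable (gauss_prod I) (\<lambda>x. \<integral>y. (F' j (x(i := y)))\<^sup>2 \<partial>gauss1)"
        by (rule int2[OF F'2[OF j] bF'2[OF j]])
      fix x assume x: "x \<in> space (gauss_prod I)"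
      show "(A' j x)\<^sup>2 \<le> (\<integral>y. (F' j (x(i := y)))\<^sup>2 \<partial>gauss1)"
        unfolding A'_def
      proof (rule gauss1.expectation_square_le)
        show "integrable gauss1 (\<lambda>y. F' j (x(i := y)))"
          by (rule gauss1.integrable_bounded[OF ext1[OF F'[OF j] x], where B=B]) (intro BF' j upd x)
        show "integrable gauss1 (\<lambda>y. (F' j (x(i := y)))\<^sup>2)"
          by (rule gauss1.integrable_bounded[OF ext1[OF F'2[OF j] x], where B="B\<^sup>2"]) (intro bF'2 j upd x)
      qed
    qed
    also have "\<dots> = (\<integral>x. (F' j x)\<^sup>2 \<partial>gauss_prod (insert i I))"
      by (rule fubini[OF F'2[OF j] bF'2[OF j], symmetric])
    finally show ?thesis .
  qed
  have "(\<Sum>j\<in>I. \<integral>x. (A' j x)\<^sup>2 \<partial>gauss_prod I) \<le> (\<Sum>j\<in>I. \<integral>x. (F' j x)\<^sup>2 \<partial>gauss_prod (insert i I))"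
    by (rule sum_mono) (rule 3)
  then show ?case
    using 1 IH insert.hyps unfolding 2 by simp
qed

section \<open>The Gaussian measure on vectors as a product measure\<close>

lemma vec_lambda_measurable [measurable]:
  "vec_lambda \<in> (\<Pi>\<^sub>M i\<in>(UNIV::'n::finite set). (borel :: real measure)) \<rightarrow>\<^sub>M (borel :: (real ^ 'n) measure)"
proof -
  have "vec_lambda f = (\<Sum>i\<in>UNIV. f i *\<^sub>R axis i 1)" for f :: "'n \<Rightarrow> real"
    using basis_expansion[of "vec_lambda f"] by (simp add: scalar_mult_eq_scaleR)
  then have "vec_lambda = (\<lambda>f :: 'n \<Rightarrow> real. \<Sum>i\<in>UNIV. f i *\<^sub>R (axis i 1 :: real ^ 'n))"
    by auto
  also have "\<dots> \<in> (\<Pi>\<^sub>M i\<in>(UNIV::'n set). (borel :: real measure)) \<rightarrow>\<^sub>M (borel :: (real ^ 'n) measure)"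
    by measurable
  finally show ?thesis .
qed

text \<open>Both measures give a box the product of its side lengths, which determines Lebesgue
  measure. This is the bridge from vectors to the function space where product measures
  live.\<close>

lemma lborel_vec:
  "(lborel :: (real ^ 'n) measure) = distr (\<Pi>\<^sub>M i\<in>UNIV. lborel) borel vec_lambda"
proof (rule lborel_eqI)
  interpret product_sigma_finite "\<lambda>_::'n. lborel :: real measure" ..
  fix l u :: "real ^ 'n" assume le: "\<And>b. b \<in> Basis \<Longrightarrow> l \<bullet> b \<le> u \<bullet> b"
  have le': "l $ i \<le> u $ i" for i
    using le[of "axis i 1"] by (simp add: axis_in_Basis_iff inner_axis)
  have [measurable]: "vec_lambda \<in> (\<Pi>\<^sub>M i\<in>(UNIV::'n set). (lborel :: real measure)) \<rightarrow>\<^sub>M (borel :: (real ^ 'n) measure)"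
    using vec_lambda_measurable by (simp cong: measurable_cong_sets sets_PiM_cong)
  have vim: "vec_lambda -` box l u \<inter> space (\<Pi>\<^sub>M i\<in>UNIV. lborel) = (\<Pi>\<^sub>E i\<in>UNIV. {l $ i<..<u $ i})"
    by (auto simp: mem_box_cart space_PiM PiE_def Pi_def)
  have "emeasure (distr (\<Pi>\<^sub>M i\<in>UNIV. lborel) borel vec_lambda) (box l u) =
      (\<Prod>i\<in>UNIV. emeasure lborel {l $ i<..<u $ i})"
    by (subst emeasure_distr) (auto simp: vim intro!: emeasure_PiM)
  also have "\<dots> = ennreal (\<Prod>i\<in>UNIV. u $ i - l $ i)"
    using le' by (simp add: prod_ennreal)
  also have "(\<Prod>i\<in>UNIV. u $ i - l $ i) = (\<Prod>b\<in>Basis. (u - l) \<bullet> b)"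
  proof -
    have B: "(Basis :: (real ^ 'n) set) = (\<lambda>i. axis i 1) ` UNIV"
      by (auto simp: Basis_vec_def)
    have inj: "inj (\<lambda>i. axis i (1::real) :: real ^ 'n)"
      by (auto simp: inj_on_def axis_eq_axis)
    show ?thesis
      unfolding B by (subst prod.reindex[OF inj]) (simp add: inner_axis)
  qed
  finally show "emeasure (distr (\<Pi>\<^sub>M i\<in>UNIV. lborel) borel vec_lambda) (box l u) = ennreal (\<Prod>b\<in>Basis. (u - l) \<bullet> b)" .
qed simp

text \<open>The density is a product, so the measures agree on rectangles before being pushed
  forward by \<open>vec_lambda\<close>. Total mass 1, the marginals and independence of the
  coordinates all come from here.\<close>

lemma gauss_measure_product:
  "(gauss_measure :: (real ^ 'n) measure) = distr (gauss_prod UNIV) borel vec_lambda"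
proof -
  interpret L: product_sigma_finite "\<lambda>_::'n. lborel :: real measure" ..
  let ?h = "\<lambda>f :: 'n \<Rightarrow> real. ennreal (\<Prod>i\<in>UNIV. std_normal_density (f i))"
  let ?L = "\<Pi>\<^sub>M i\<in>(UNIV :: 'n set). (lborel :: real measure)"
  have [measurable]: "vec_lambda \<in> ?L \<rightarrow>\<^sub>M (borel :: (real ^ 'n) measure)"
    using vec_lambda_measurable by (simp cong: measurable_cong_sets sets_PiM_cong)
  have "density ?L ?h = gauss_prod UNIV"
  proof (rule gaussPi.PiM_eqI)
    show "sets (density ?L ?h) = sets (gauss_prod UNIV)"
      by (simp cong: sets_PiM_cong)
    fix A :: "'n \<Rightarrow> real set" assume A: "\<And>i. i \<in> UNIV \<Longrightarrow> A i \<in> sets gauss1"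
    then have [measurable]: "A i \<in> sets borel" for i by simp
    have "emeasure (density ?L ?h) (Pi\<^sub>E UNIV A) = (\<integral>\<^sup>+f. ?h f * indicator (Pi\<^sub>E UNIV A) f \<partial>?L)"
      by (rule emeasure_density) (auto intro!: sets_PiM_I_finite)
    also have "\<dots> = (\<integral>\<^sup>+f. (\<Prod>i\<in>UNIV. ennreal (std_normal_density (f i)) * indicator (A i) (f i)) \<partial>?L)"
    proof (rule nn_integral_cong)
      fix f :: "'n \<Rightarrow> real"
      have "indicator (Pi\<^sub>E UNIV A) f = (\<Prod>i\<in>UNIV. indicator (A i) (f i) :: ennreal)"
        by (auto simp: indicator_def PiE_def Pi_def)
      then show "?h f * indicator (Pi\<^sub>E UNIV A) f = (\<Prod>i\<in>UNIV. ennreal (std_normal_density (f i)) * indicator (A i) (f i))"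
        by (simp add: prod.distrib prod_ennreal)
    qed
    also have "\<dots> = (\<Prod>i\<in>UNIV. \<integral>\<^sup>+x. ennreal (std_normal_density x) * indicator (A i) x \<partial>lborel)"
      by (rule L.product_nn_integral_prod) auto
    also have "\<dots> = (\<Prod>i\<in>UNIV. emeasure gauss1 (A i))"
      unfolding gauss1_def by (intro prod.cong refl, subst emeasure_density) auto
    finally show "emeasure (density ?L ?h) (Pi\<^sub>E UNIV A) = (\<Prod>i\<in>UNIV. emeasure gauss1 (A i))" .
  qed simp
  then have "distr (gauss_prod UNIV) borel vec_lambda = distr (density ?L (\<lambda>f. ennreal (gauss (vec_lambda f)))) borel vec_lambda"
    by (simp add: gauss_def)
  also have "\<dots> = density (distr ?L borel vec_lambda) (\<lambda>x. ennreal (gauss x))"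
    by (rule density_distr[symmetric]) measurable
  also have "\<dots> = gauss_measure"
    by (simp add: gauss_measure_def lborel_vec[symmetric])
  finally show ?thesis ..
qed

lemma prob_space_gauss_measure: "prob_space (gauss_measure :: (real ^ 'n) measure)"
  unfolding gauss_measure_product
  by (intro prob_space.prob_space_distr prob_space_gauss_prod)
     (simp cong: measurable_cong_sets sets_PiM_cong)

lemma poincare_C1c:
  fixes w :: "real ^ 'n \<Rightarrow> real"
  assumes w: "C0c w" and w1: "\<And>j. C0c (w1 j)" and pd: "\<And>j. has_partial j w (w1 j)"
  shows "(\<integral>x. (w x)\<^sup>2 \<partial>gauss_measure) - (\<integral>x. w x \<partial>gauss_measure)\<^sup>2 \<le>
    (\<Sum>j\<in>UNIV. \<integral>x. (w1 j x)\<^sup>2 \<partial>gauss_measure)"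
proof -
  have [measurable]: "vec_lambda \<in> gauss_prod UNIV \<rightarrow>\<^sub>M (borel :: (real ^ 'n) measure)"
    using vec_lambda_measurable by (simp cong: measurable_cong_sets sets_PiM_cong)
  note [measurable] = C0c_measurable[OF w] C0c_measurable[OF w1]
  have tr: "(\<integral>x. h x \<partial>gauss_measure) = (\<integral>f. h (vec_lambda f) \<partial>gauss_prod UNIV)"
    if "h \<in> borel_measurable borel" for h :: "real ^ 'n \<Rightarrow> real"
    unfolding gauss_measure_product by (rule integral_distr) (use that in auto)
  obtain B0 where B0: "\<And>x. \<bar>w x\<bar> \<le> B0" using C0c_bounded[OF w] by auto
  have "\<exists>B. \<forall>x. \<bar>w1 j x\<bar> \<le> B" for j using C0c_bounded[OF w1[of j]] by auto
  then obtain B1 where B1: "\<And>j x. \<bar>w1 j x\<bar> \<le> B1 j" by metis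
  \<comment> \<open>\<open>poincare_product\<close> takes one bound for the function and all its
    partial derivatives.\<close>
  define B where "B = Max (insert B0 (range B1))"
  have "B0 \<le> B" "B1 j \<le> B" for j unfolding B_def by (rule Max_ge, simp, simp)+
  then have B: "\<bar>w x\<bar> \<le> B" "\<bar>w1 j x\<bar> \<le> B" for x j
    using B0 B1 order_trans by metis+
  have "(\<integral>f. (w (vec_lambda f))\<^sup>2 \<partial>gauss_prod UNIV) - (\<integral>f. w (vec_lambda f) \<partial>gauss_prod UNIV)\<^sup>2 \<le>
      (\<Sum>j\<in>UNIV. \<integral>f. (w1 j (vec_lambda f))\<^sup>2 \<partial>gauss_prod UNIV)"
  proof (rule poincare_product)
    fix j and f :: "'n \<Rightarrow> real" and t
    \<comment> \<open>Clearing coordinate \<open>j\<close> makes the updated point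
      \<open>c + t *\<^sub>R axis j 1\<close>, so coordinate updates become the lines of
      \<open>has_partial\<close>.\<close>
    define c :: "real ^ 'n" where "c = vec_lambda (f(j := 0))"
    have line: "vec_lambda (f(j := t)) = c + t *\<^sub>R axis j 1" for t
      by (auto simp: c_def vec_eq_iff axis_def)
    show "((\<lambda>t. w (vec_lambda (f(j := t)))) has_real_derivative w1 j (vec_lambda (f(j := t)))) (at t)"
      unfolding line by (rule has_partial_line[OF pd])
    show "continuous_on UNIV (\<lambda>t. w1 j (vec_lambda (f(j := t))))"
      unfolding line
      by (rule continuous_on_compose2[OF C0c_continuous[OF w1]]) (auto intro!: continuous_intros)
  qed (use B in auto)
  then show ?thesis by (simp add: tr)
qed

section \<open>Approximation of weakly differentiable functions\<close>

text \<open>For positive \<open>a\<close> and \<open>c\<close> this is positive exactly inside a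
  ball, so composing it with \<open>bexp\<close> gives a smooth bump supported there. Cutoffs use a
  = 1 with small c, kernels use c = 1 with small a.\<close>

definition paraboloid :: "real \<Rightarrow> real \<Rightarrow> real ^ 'n \<Rightarrow> real" where
  "paraboloid a c x = a - c * (x \<bullet> x)"

lemma smooth_fn_paraboloid_shift: "smooth_fn (\<lambda>y :: real ^ 'n. paraboloid a c (x - y))"
proof -
  have "(\<lambda>y. paraboloid a c (x - y)) = (\<lambda>y. a + (- c) * (\<Sum>i\<in>UNIV. (x $ i - y $ i) * (x $ i - y $ i)))"
    by (simp add: paraboloid_def inner_vec_def)
  moreover have "smooth_fn (\<lambda>y. a + (- c) * (\<Sum>i\<in>UNIV. (x $ i - y $ i) * (x $ i - y $ i)))"
    by (intro smooth_fn.intros smooth_sum smooth_diff) auto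
  ultimately show ?thesis by (simp only:)
qed

lemma smooth_fn_paraboloid: "smooth_fn (paraboloid a c :: real ^ 'n \<Rightarrow> real)"
  using smooth_fn_paraboloid_shift[of a c 0] by (simp add: paraboloid_def[abs_def])

lemma paraboloid_has_partial: "has_partial j (paraboloid a c) (\<lambda>x. - 2 * c * x $ j)"
proof -
  have "(paraboloid a c has_derivative (\<lambda>h. - c * (x \<bullet> h + h \<bullet> x))) (at x)" for x :: "real ^ 'n"
    unfolding paraboloid_def[abs_def] by (auto intro!: derivative_eq_intros)
  then have "has_partial j (paraboloid a c) (\<lambda>x. - c * (x \<bullet> axis j 1 + axis j 1 \<bullet> x))"
    by (rule has_partial_derivative)
  then show ?thesis
    by (simp add: inner_axis inner_commute[of "axis j 1"] algebra_simps)
qed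

lemma has_partial_bexp:
  assumes "has_partial j q q'"
  shows "has_partial j (\<lambda>x. bexp k (q x)) (\<lambda>x. (bexp (k + 2) (q x) - real k * bexp (k + 1) (q x)) * q' x)"
  unfolding has_partial_def
proof
  fix x
  have "((\<lambda>t. q (x + t *\<^sub>R axis j 1)) has_real_derivative q' x) (at 0)"
    using assms by (simp add: has_partial_def)
  from DERIV_chain2[OF DERIV_bexp this]
  show "((\<lambda>t. bexp k (q (x + t *\<^sub>R axis j 1))) has_real_derivative
      (bexp (k + 2) (q x) - real k * bexp (k + 1) (q x)) * q' x) (at 0)"
    by simp
qed

lemma has_partial_cmult: "has_partial j p p' \<Longrightarrow> has_partial j (\<lambda>x. c * p x) (\<lambda>x. c * p' x)"
  unfolding has_partial_def by (auto intro!: derivative_eq_intros)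

lemma has_partial_coord_scaled: "has_partial j (\<lambda>x. c * x $ i) (\<lambda>x. if i = j then c else 0)"
  using has_partial_cmult[OF has_partial_coord, of j c i] by (simp add: if_distrib cong: if_cong)

lemma has_partial_reflect:
  assumes "has_partial j K K'"
  shows "has_partial j (\<lambda>y. K (x - y)) (\<lambda>y. - K' (x - y))"
  unfolding has_partial_def
proof
  fix y
  have m: "((\<lambda>t::real. - t) has_real_derivative -1) (at 0)"
    by (auto intro!: derivative_eq_intros)
  have "((\<lambda>s. K ((x - y) + s *\<^sub>R axis j 1)) has_real_derivative K' (x - y)) (at (- 0))"
    using assms by (simp add: has_partial_def)
  from DERIV_chain2[where g="\<lambda>t. - t" and x=0 and Db="-1" and s=UNIV, OF this m]
  show "((\<lambda>t. K (x - (y + t *\<^sub>R axis j 1))) has_real_derivative - K' (x - y)) (at 0)"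
    by (simp add: algebra_simps)
qed

lemma has_partial_partial_deriv: "smooth_fn \<phi> \<Longrightarrow> has_partial j \<phi> \<phi>' \<Longrightarrow> partial_deriv j \<phi> = \<phi>'"
  using smooth_fn_has_partial has_partial_unique by blast

section \<open>Cutoff functions\<close>

text \<open>Since \<open>bexp 0 1 = exp (- 1)\<close>, the factor \<open>exp 1\<close> normalises
  the value at the origin to 1. There is no plateau: values in [0, 1] and pointwise convergence to 1
  as R grows suffice for dominated convergence.\<close>

definition cutoff :: "real \<Rightarrow> real ^ 'n \<Rightarrow> real" where
  "cutoff R x = exp 1 * bexp 0 (paraboloid 1 (1 / R\<^sup>2) x)"

definition cutoff_deriv :: "real \<Rightarrow> 'n \<Rightarrow> real ^ 'n \<Rightarrow> real" where
  "cutoff_deriv R j x = exp 1 * (bexp 2 (paraboloid 1 (1 / R\<^sup>2) x) * (- 2 * (1 / R\<^sup>2) * x $ j))"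

lemma cutoff_smooth: "smooth_fn (cutoff R)"
  unfolding cutoff_def[abs_def] by (intro smooth_fn.intros smooth_fn_paraboloid)

lemma cutoff_deriv_smooth: "smooth_fn (cutoff_deriv R j)"
  unfolding cutoff_deriv_def[abs_def] by (intro smooth_fn.intros smooth_fn_paraboloid)

lemma cutoff_has_partial: "has_partial j (cutoff R) (cutoff_deriv R j)"
  using has_partial_cmult[OF has_partial_bexp[OF paraboloid_has_partial[of j 1 "1 / R\<^sup>2"], of 0], of "exp 1"]
  by (simp add: cutoff_def[abs_def] cutoff_deriv_def[abs_def] numeral_2_eq_2)

lemma paraboloid_nonpos: "0 < R \<Longrightarrow> R < norm x \<Longrightarrow> paraboloid 1 (1 / R\<^sup>2) x \<le> 0"
  using power_strict_mono[of R "norm x" 2]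
  by (simp add: paraboloid_def power2_norm_eq_inner[symmetric] field_simps)

lemma cutoff_0: "0 < R \<Longrightarrow> R < norm x \<Longrightarrow> cutoff R x = 0"
  by (simp add: cutoff_def paraboloid_nonpos)

lemma cutoff_deriv_0: "0 < R \<Longrightarrow> R < norm x \<Longrightarrow> cutoff_deriv R j x = 0"
  by (simp add: cutoff_deriv_def paraboloid_nonpos)

lemma cutoff_nonneg: "0 \<le> cutoff R x"
  by (simp add: cutoff_def bexp_nonneg)

lemma cutoff_le_1: "cutoff R x \<le> 1"
proof (cases "0 < paraboloid 1 (1 / R\<^sup>2) x")
  case True
  have "paraboloid 1 (1 / R\<^sup>2) x \<le> 1" by (simp add: paraboloid_def)
  then have "1 + - 1 / paraboloid 1 (1 / R\<^sup>2) x \<le> 0"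
    using True by (simp add: field_simps)
  then have "exp (1 + - 1 / paraboloid 1 (1 / R\<^sup>2) x) \<le> 1"
    by simp
  then show ?thesis
    using True by (simp only: cutoff_def bexp_def exp_add) simp
qed (simp add: cutoff_def)

text \<open>On the support, the coordinate is at most R, hence at most R^2 as R is at least 1; with
  \<open>bexp_2_le_2\<close> this leaves 2 * 2 * exp 1. Independence of R is what lets dominated
  convergence run as R grows.\<close>

lemma cutoff_deriv_bound:
  assumes "1 \<le> R"
  shows "\<bar>cutoff_deriv R j x\<bar> \<le> 4 * exp 1"
proof (cases "R < norm x")
  case True
  then show ?thesis using cutoff_deriv_0[of R x j] assms by simp
next
  case False
  then have "\<bar>x $ j\<bar> \<le> R" using component_le_norm_cart[of x j] by simp
  also have "R \<le> R\<^sup>2" using assms by (simp add: power2_eq_square)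
  finally have "\<bar>x $ j\<bar> / R\<^sup>2 \<le> 1" using assms by (simp add: field_simps)
  then have "bexp 2 (paraboloid 1 (1 / R\<^sup>2) x) * (\<bar>x $ j\<bar> / R\<^sup>2) \<le> 2 * 1"
    by (intro mult_mono bexp_2_le_2) auto
  then have "(2 * exp 1) * (bexp 2 (paraboloid 1 (1 / R\<^sup>2) x) * (\<bar>x $ j\<bar> / R\<^sup>2)) \<le> (2 * exp 1) * (2 * 1)"
    by (rule mult_left_mono) simp
  then show ?thesis
    by (simp add: cutoff_deriv_def abs_mult bexp_nonneg mult_ac)
qed

lemma paraboloid_tendsto: "(\<lambda>k. paraboloid 1 (1 / (real (Suc k))\<^sup>2) x) \<longlonglongrightarrow> 1"
proof -
  have "(\<lambda>k. 1 - (1 / real (Suc k))\<^sup>2 * (x \<bullet> x)) \<longlonglongrightarrow> 1 - 0\<^sup>2 * (x \<bullet> x)"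
    by (intro tendsto_intros LIMSEQ_Suc[OF lim_1_over_n])
  then show ?thesis by (simp add: paraboloid_def power_divide)
qed

lemma cutoff_tendsto: "(\<lambda>k. cutoff (real (Suc k)) x) \<longlonglongrightarrow> 1"
proof -
  have "(\<lambda>k. bexp 0 (paraboloid 1 (1 / (real (Suc k))\<^sup>2) x)) \<longlonglongrightarrow> bexp 0 1"
    by (rule isCont_tendsto_compose[OF isCont_bexp paraboloid_tendsto])
  then have "(\<lambda>k. exp 1 * bexp 0 (paraboloid 1 (1 / (real (Suc k))\<^sup>2) x)) \<longlonglongrightarrow> exp 1 * bexp 0 1"
    by (intro tendsto_intros)
  also have "exp 1 * bexp 0 1 = 1" by (simp add: bexp_def exp_minus)
  finally show ?thesis by (simp add: cutoff_def)
qed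

lemma cutoff_deriv_tendsto: "(\<lambda>k. cutoff_deriv (real (Suc k)) j x) \<longlonglongrightarrow> 0"
proof -
  have "(\<lambda>k. bexp 2 (paraboloid 1 (1 / (real (Suc k))\<^sup>2) x)) \<longlonglongrightarrow> bexp 2 1"
    by (rule isCont_tendsto_compose[OF isCont_bexp paraboloid_tendsto])
  moreover have "(\<lambda>k. - 2 * (1 / real (Suc k))\<^sup>2 * x $ j) \<longlonglongrightarrow> - 2 * 0\<^sup>2 * x $ j"
    by (intro tendsto_intros LIMSEQ_Suc[OF lim_1_over_n])
  ultimately have "(\<lambda>k. exp 1 * (bexp 2 (paraboloid 1 (1 / (real (Suc k))\<^sup>2) x) * (- 2 * (1 / real (Suc k))\<^sup>2 * x $ j)))
      \<longlonglongrightarrow> exp 1 * (bexp 2 1 * (- 2 * 0\<^sup>2 * x $ j))"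
    by (intro tendsto_intros LIMSEQ_Suc[OF lim_1_over_n])
  then show ?thesis by (simp add: cutoff_deriv_def power_divide)
qed

text \<open>On a ball the Gaussian density has a positive minimum, so there Gaussian L2 embeds in
  Lebesgue L2.\<close>

lemma gauss_L2_vanishing_imp_lborel:
  fixes h :: "real ^ 'n \<Rightarrow> real"
  assumes [measurable]: "h \<in> borel_measurable borel" and int: "integrable gauss_measure (\<lambda>x. (h x)\<^sup>2)"
    and h0: "\<And>x. norm x > R \<Longrightarrow> h x = 0" and R: "0 \<le> R"
  shows "integrable lborel (\<lambda>x. (h x)\<^sup>2)"
proof -
  have "\<exists>z\<in>cball 0 R. \<forall>x\<in>cball 0 R. gauss (z :: real ^ 'n) \<le> gauss (x :: real ^ 'n)"
    by (rule continuous_attains_inf)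
       (use R in \<open>auto intro: continuous_on_subset[OF gauss_continuous]\<close>)
  then obtain z :: "real ^ 'n" where z: "\<forall>x\<in>cball 0 R. gauss z \<le> gauss (x :: real ^ 'n)" by blast
  define c where "c = gauss z"
  have c: "c > 0" "\<And>x :: real ^ 'n. norm x \<le> R \<Longrightarrow> c \<le> gauss x"
    using z gauss_pos by (auto simp: c_def)
  show ?thesis
  proof (rule Bochner_Integration.integrable_bound)
    show "integrable lborel (\<lambda>x. (gauss x * (h x)\<^sup>2) / c)"
      using int by (simp add: integrable_gauss_measure)
    have "(h x)\<^sup>2 \<le> (gauss x * (h x)\<^sup>2) / c" for x
    proof (cases "norm x \<le> R")
      case True
      then show ?thesis
        using c(1) mult_right_mono[OF c(2)[OF True], of "(h x)\<^sup>2"] by (simp add: field_simps)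
    qed (use h0 in simp)
    then show "AE x in lborel. norm ((h x)\<^sup>2) \<le> norm ((gauss x * (h x)\<^sup>2) / c)"
      using c(1) by (auto intro!: AE_I2 simp: abs_of_pos)
  qed simp
qed

section \<open>Mollification of weak gradients\<close>

definition bump_kernel :: "real \<Rightarrow> real ^ 'n \<Rightarrow> real" where
  "bump_kernel \<delta> x = bexp 0 (paraboloid (\<delta>\<^sup>2) 1 x) / (\<integral>y. bexp 0 (paraboloid (\<delta>\<^sup>2) 1 (y :: real ^ 'n)) \<partial>lborel)"

lemma paraboloid_nonpos': "0 < \<delta> \<Longrightarrow> \<delta> < norm x \<Longrightarrow> paraboloid (\<delta>\<^sup>2) 1 x \<le> 0"
  using power_strict_mono[of \<delta> "norm x" 2]
  by (simp add: paraboloid_def power2_norm_eq_inner[symmetric])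

lemma mollifier_bump_kernel:
  assumes "0 < \<delta>"
  shows "mollifier \<delta> (bump_kernel \<delta> :: real ^ 'n \<Rightarrow> real)"
proof -
  let ?b = "\<lambda>x :: real ^ 'n. bexp 0 (paraboloid (\<delta>\<^sup>2) 1 x)"
  have c: "continuous_on UNIV ?b"
    by (intro smooth_fn_continuous smooth_fn.intros smooth_fn_paraboloid)
  have b0: "?b x = 0" if "norm x > \<delta>" for x
    using that by (intro bexp_nonpos paraboloid_nonpos' assms)
  have i: "integrable lborel ?b"
    using c b0 by (intro C0c_integrable_lborel) (auto simp: C0c_def)
  \<comment> \<open>The normalising constant must be nonzero: a continuous function vanishing almost
    everywhere vanishes at 0 too, while \<open>?b 0\<close> is positive.\<close>
  have "(\<integral>x. ?b x \<partial>lborel) \<noteq> 0"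
  proof
    assume "(\<integral>x. ?b x \<partial>lborel) = 0"
    then have "AE x in lborel. ?b x = 0"
      using i by (subst (asm) integral_nonneg_eq_0_iff_AE) (auto simp: bexp_nonneg)
    then have "?b 0 = 0"
    proof -
      have "closed {x. ?b x = 0}"
        using continuous_closed_vimage[of "{0}" ?b] c
        by (simp add: closed_Collect_eq continuous_on_const)
      moreover have "AE x in lebesgue. x \<in> {x. ?b x = 0}"
        using \<open>AE x in lborel. ?b x = 0\<close> by (simp add: AE_completion)
      ultimately have "0 \<in> {x. ?b x = 0}"
        by (rule mem_closed_if_AE_lebesgue)
      then show ?thesis by blast
    qed
    then show False
      using assms by (simp add: paraboloid_def bexp_def)
  qed
  moreover have "0 \<le> (\<integral>x. ?b x \<partial>lborel)"
    by (intro integral_nonneg_AE) (simp add: bexp_nonneg)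
  ultimately have pos: "0 < (\<integral>x. ?b x \<partial>lborel)" by simp
  show ?thesis
    unfolding mollifier_def bump_kernel_def[abs_def]
    using c b0 i pos by (auto intro!: continuous_intros simp: bexp_nonneg paraboloid_def)
qed

lemma bump_kernel_derivs:
  fixes \<delta> :: real
  assumes "0 < \<delta>"
  obtains K1 :: "'n \<Rightarrow> real ^ 'n \<Rightarrow> real" and K2 :: "'n \<Rightarrow> 'n \<Rightarrow> real ^ 'n \<Rightarrow> real"
  where "C2c (bump_kernel \<delta>) K1 K2"
proof -
  let ?q = "paraboloid (\<delta>\<^sup>2) 1 :: real ^ 'n \<Rightarrow> real"
  define c where "c = 1 / (\<integral>y. bexp 0 (?q y) \<partial>lborel)"
  define K1 where "K1 = (\<lambda>j x. c * (bexp 2 (?q x) * (- 2 * x $ j)))"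
  \<comment> \<open>From \<open>DERIV_bexp\<close>, \<open>bexp 0\<close> has derivative
    \<open>bexp 2\<close>, and \<open>bexp 2\<close> has derivative
    \<open>bexp 4 - 2 * bexp 3\<close>.\<close>
  define K2 where "K2 = (\<lambda>i j x. c * (bexp 2 (?q x) * (if i = j then - 2 else 0)
    + (bexp 4 (?q x) - 2 * bexp 3 (?q x)) * (- 2 * x $ j) * (- 2 * x $ i)))"
  have cb: "continuous_on UNIV (\<lambda>x. bexp k (?q x))" for k
    by (intro smooth_fn_continuous smooth_fn.intros smooth_fn_paraboloid)
  have b0: "bexp k (?q x) = 0" if "norm x > \<delta>" for k x
    using that by (intro bexp_nonpos paraboloid_nonpos' assms)
  have C0c: "C0c (\<lambda>x. bexp k (?q x))" for k
    using cb b0 by (auto simp: C0c_def)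
  have K: "bump_kernel \<delta> = (\<lambda>x. c * bexp 0 (?q x))"
    by (auto simp: bump_kernel_def c_def)
  have p: "has_partial j ?q (\<lambda>x. - 2 * x $ j)" for j
    using paraboloid_has_partial[of j "\<delta>\<^sup>2" 1] by simp
  have pb: "has_partial j (\<lambda>x. bexp 2 (?q x)) (\<lambda>x. (bexp 4 (?q x) - 2 * bexp 3 (?q x)) * (- 2 * x $ j))" for j
    using has_partial_bexp[OF p[of j], of 2] by simp
  have pb0: "has_partial j (\<lambda>x. bexp 0 (?q x)) (\<lambda>x. bexp 2 (?q x) * (- 2 * x $ j))" for j
    using has_partial_bexp[OF p[of j], of 0] by (simp add: numeral_2_eq_2)
  have sym: "K2 i j = K2 j i" for i j
    by (auto simp: K2_def mult_ac)
  have "C2c (bump_kernel \<delta>) K1 K2"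
    unfolding C2c_def
  proof (intro conjI allI)
    show "C0c (bump_kernel \<delta> :: real ^ 'n \<Rightarrow> real)"
      unfolding K by (intro C0c_mult continuous_intros C0c)
    show "C0c (K1 j)" "has_partial j (bump_kernel \<delta>) (K1 j)" for j
      unfolding K K1_def
      by (intro C0c_mult C0c_mult' continuous_intros coord_continuous C0c has_partial_cmult pb0)+
    show "C0c (K2 i j)" for i j
      unfolding K2_def
      by (intro C0c_mult C0c_add C0c_mult' C0c_diff continuous_intros coord_continuous C0c)
    show "has_partial j (K1 i) (K2 i j)" for i j
      unfolding K1_def K2_def
      by (intro has_partial_cmult has_partial_mult pb has_partial_coord_scaled)
  qed (rule sym)
  then show thesis by (rule that)
qed

lemma L2_vanishing_integrable:
  fixes h :: "real ^ 'n \<Rightarrow> real"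
  assumes "h \<in> borel_measurable borel" and "integrable gauss_measure (\<lambda>x. (h x)\<^sup>2)"
    and "\<And>x. norm x > R \<Longrightarrow> h x = 0" and "0 \<le> R"
  shows "integrable lborel h"
  by (rule square_integrable_vanishing_imp_integrable[OF assms(1) gauss_L2_vanishing_imp_lborel[OF assms] assms(3)])

lemma integrable_square_bound:
  fixes h p :: "'a \<Rightarrow> real"
  assumes "integrable M p" "h \<in> borel_measurable M" "\<And>x. (h x)\<^sup>2 \<le> p x"
  shows "integrable M (\<lambda>x. (h x)\<^sup>2)"
  by (rule Bochner_Integration.integrable_bound[OF assms(1)])
     (use assms in \<open>auto intro!: AE_I2 intro: order_trans[OF _ abs_ge_self]\<close>)

lemma mult_square_le: "\<bar>c\<bar> \<le> b \<Longrightarrow> (c * a)\<^sup>2 \<le> b\<^sup>2 * (a::real)\<^sup>2"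
  by (simp add: power_mult_distrib mult_right_mono abs_le_square_iff[symmetric])

text \<open>Test the weak derivative against
  \<open>bump_kernel \<delta> (x - y) * cutoff R y\<close> as a function of \<open>y\<close>. This
  single test function yields both the product rule for the cutoff and the exchange of
  differentiation with convolution.\<close>

lemma mollify_weak_gradient:
  fixes u :: "real ^ 'n \<Rightarrow> real" and g :: "'n \<Rightarrow> real ^ 'n \<Rightarrow> real"
  assumes u [measurable]: "u \<in> borel_measurable borel" and g [measurable]: "\<And>j. g j \<in> borel_measurable borel"
    and u2: "integrable gauss_measure (\<lambda>x. (u x)\<^sup>2)"
    and g2: "\<And>j. integrable gauss_measure (\<lambda>x. (g j x)\<^sup>2)"
    and weak: "\<And>\<phi> j. test_function \<phi> \<Longrightarrow>
      (\<integral>x. u x * partial_deriv j \<phi> x \<partial>lborel) = - (\<integral>x. g j x * \<phi> x \<partial>lborel)"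
    and R: "1 \<le> R" and \<delta>: "0 < \<delta>" and K: "C2c (bump_kernel \<delta>) K1 K2"
  shows "conv (K1 j) (\<lambda>y. cutoff R y * u y) =
    conv (bump_kernel \<delta>) (\<lambda>y. cutoff R y * g j y + u y * cutoff_deriv R j y)"
proof
  fix x :: "real ^ 'n"
  note KD = C2cD[OF K]
  have [measurable]: "cutoff R \<in> borel_measurable borel" "cutoff_deriv R j \<in> borel_measurable borel"
    by (intro borel_measurable_continuous_onI smooth_fn_continuous cutoff_smooth cutoff_deriv_smooth)+
  have \<chi>: "\<bar>cutoff R y\<bar> \<le> 1" for y :: "real ^ 'n"
    using cutoff_nonneg[of R y] cutoff_le_1[of R y] by simp
  have R0: "0 < R" "0 \<le> R" using R by auto
  obtain B where B: "\<And>x :: real ^ 'n. \<bar>bump_kernel \<delta> x\<bar> \<le> B" using C0c_bounded[OF KD(1)] by blast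
  obtain B1 where B1: "\<And>x. \<bar>K1 j x\<bar> \<le> B1" using C0c_bounded[OF KD(2)] by blast
  have i1: "integrable lborel (\<lambda>y. cutoff R y * u y)"
    by (rule L2_vanishing_integrable[where R=R, OF _ integrable_square_bound[where p="\<lambda>y. 1\<^sup>2 * (u y)\<^sup>2"]])
       (use u2 R0 cutoff_0 mult_square_le[OF \<chi>] in auto)
  have i2: "integrable lborel (\<lambda>y. cutoff R y * g j y)"
    by (rule L2_vanishing_integrable[where R=R, OF _ integrable_square_bound[where p="\<lambda>y. 1\<^sup>2 * (g j y)\<^sup>2"]])
       (use g2 R0 cutoff_0 mult_square_le[OF \<chi>] in auto)
  have "integrable lborel (\<lambda>y. cutoff_deriv R j y * u y)"
    by (rule L2_vanishing_integrable[where R=R, OF _ integrable_square_bound[where p="\<lambda>y. (4 * exp 1)\<^sup>2 * (u y)\<^sup>2"]])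
       (use u2 R0 cutoff_deriv_0 mult_square_le[OF cutoff_deriv_bound[OF R]] in auto)
  then have i3: "integrable lborel (\<lambda>y. u y * cutoff_deriv R j y)"
    by (simp add: mult.commute)
  let ?\<phi> = "\<lambda>y. bump_kernel \<delta> (x - y) * cutoff R y"
  have sm: "smooth_fn ?\<phi>"
  proof -
    define c where "c = 1 / (\<integral>y. bexp 0 (paraboloid (\<delta>\<^sup>2) 1 (y :: real ^ 'n)) \<partial>lborel)"
    have "?\<phi> = (\<lambda>y. c * bexp 0 (paraboloid (\<delta>\<^sup>2) 1 (x - y)) * cutoff R y)"
      by (simp add: bump_kernel_def c_def)
    moreover have "smooth_fn (\<lambda>y. c * bexp 0 (paraboloid (\<delta>\<^sup>2) 1 (x - y)) * cutoff R y)"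
      by (intro smooth_fn.intros smooth_fn_paraboloid_shift cutoff_smooth)
    ultimately show ?thesis by (simp only:)
  qed
  have test: "test_function ?\<phi>"
    by (rule smooth_test_function[OF sm, where R=R]) (simp add: cutoff_0 R0)
  \<comment> \<open>The minus sign comes from differentiating the kernel in \<open>y\<close> rather
    than in \<open>x\<close>; it cancels the one in the definition of a weak derivative.\<close>
  have pd: "partial_deriv j ?\<phi> = (\<lambda>y. bump_kernel \<delta> (x - y) * cutoff_deriv R j y + (- K1 j (x - y)) * cutoff R y)"
    by (intro has_partial_partial_deriv[OF sm] has_partial_mult has_partial_reflect KD cutoff_has_partial)
  note ii1 = conv_integrand_integrable[OF C0c_continuous[OF KD(2)] B1 i1, of x]
  note ii2 = conv_integrand_integrable[OF C0c_continuous[OF KD(1)] B i2, of x]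
  note ii3 = conv_integrand_integrable[OF C0c_continuous[OF KD(1)] B i3, of x]
  have "(\<integral>y. bump_kernel \<delta> (x - y) * (u y * cutoff_deriv R j y) \<partial>lborel) -
      (\<integral>y. K1 j (x - y) * (cutoff R y * u y) \<partial>lborel) =
      (\<integral>y. bump_kernel \<delta> (x - y) * (u y * cutoff_deriv R j y) - K1 j (x - y) * (cutoff R y * u y) \<partial>lborel)"
    by (rule Bochner_Integration.integral_diff[symmetric, OF ii3 ii1])
  also have "\<dots> = (\<integral>y. u y * partial_deriv j ?\<phi> y \<partial>lborel)"
    unfolding pd by (intro Bochner_Integration.integral_cong) (auto simp: algebra_simps)
  also have "\<dots> = - (\<integral>y. g j y * ?\<phi> y \<partial>lborel)"
    by (rule weak[OF test])
  also have "(\<integral>y. g j y * ?\<phi> y \<partial>lborel) = (\<integral>y. bump_kernel \<delta> (x - y) * (cutoff R y * g j y) \<partial>lborel)"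
    by (intro Bochner_Integration.integral_cong) (auto simp: algebra_simps)
  finally have "(\<integral>y. K1 j (x - y) * (cutoff R y * u y) \<partial>lborel) =
      (\<integral>y. bump_kernel \<delta> (x - y) * (cutoff R y * g j y) \<partial>lborel) +
      (\<integral>y. bump_kernel \<delta> (x - y) * (u y * cutoff_deriv R j y) \<partial>lborel)"
    by simp
  also have "\<dots> = (\<integral>y. bump_kernel \<delta> (x - y) * (cutoff R y * g j y) + bump_kernel \<delta> (x - y) * (u y * cutoff_deriv R j y) \<partial>lborel)"
    by (rule Bochner_Integration.integral_add[symmetric, OF ii2 ii3])
  finally show "conv (K1 j) (\<lambda>y. cutoff R y * u y) x =
      conv (bump_kernel \<delta>) (\<lambda>y. cutoff R y * g j y + u y * cutoff_deriv R j y) x"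
    by (simp add: conv_def distrib_left)
qed

lemma gauss_L2_le_lborel:
  fixes h :: "real ^ 'n \<Rightarrow> real"
  assumes [measurable]: "h \<in> borel_measurable borel" and i: "integrable lborel (\<lambda>x. (h x)\<^sup>2)"
  shows "integrable gauss_measure (\<lambda>x. (h x)\<^sup>2)"
    and "(\<integral>x. (h x)\<^sup>2 \<partial>gauss_measure) \<le> (\<integral>x. (h x)\<^sup>2 \<partial>lborel)"
proof -
  have le: "gauss x * (h x)\<^sup>2 \<le> (h x)\<^sup>2" for x
    using mult_right_mono[OF gauss_le_1, of "(h x)\<^sup>2" x] by simp
  have i': "integrable lborel (\<lambda>x. gauss x * (h x)\<^sup>2)"
    by (rule Bochner_Integration.integrable_bound[OF i]) (use le in \<open>auto intro!: AE_I2 simp: abs_mult\<close>)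
  then show "integrable gauss_measure (\<lambda>x. (h x)\<^sup>2)"
    by (simp add: integrable_gauss_measure)
  show "(\<integral>x. (h x)\<^sup>2 \<partial>gauss_measure) \<le> (\<integral>x. (h x)\<^sup>2 \<partial>lborel)"
    using integral_mono[OF i' i le] by (simp add: integral_gauss_measure)
qed

lemma integral_square_triangle:
  fixes a b c :: "'a \<Rightarrow> real"
  assumes ab: "integrable M (\<lambda>x. (a x - b x)\<^sup>2)" and bc: "integrable M (\<lambda>x. (b x - c x)\<^sup>2)"
    and m: "a \<in> borel_measurable M" "c \<in> borel_measurable M"
  shows "integrable M (\<lambda>x. (a x - c x)\<^sup>2)"
    and "(\<integral>x. (a x - c x)\<^sup>2 \<partial>M) \<le> 2 * ((\<integral>x. (a x - b x)\<^sup>2 \<partial>M) + (\<integral>x. (b x - c x)\<^sup>2 \<partial>M))"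
proof -
  have le: "(a x - c x)\<^sup>2 \<le> 2 * ((a x - b x)\<^sup>2 + (b x - c x)\<^sup>2)" for x
    using square_add_le[of "a x - b x" "b x - c x"] by simp
  have i: "integrable M (\<lambda>x. 2 * ((a x - b x)\<^sup>2 + (b x - c x)\<^sup>2))"
    using ab bc by simp
  show ac: "integrable M (\<lambda>x. (a x - c x)\<^sup>2)"
    by (rule integrable_square_bound[OF i]) (use m le in auto)
  show "(\<integral>x. (a x - c x)\<^sup>2 \<partial>M) \<le> 2 * ((\<integral>x. (a x - b x)\<^sup>2 \<partial>M) + (\<integral>x. (b x - c x)\<^sup>2 \<partial>M))"
    using integral_mono[OF ac i le] ab bc by simp
qed

text \<open>The cutoff comes before the mollification, because the convolution estimates are for
  Lebesgue measure, where \<open>u\<close> itself need not be integrable. Errors are measured in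
  Gaussian L2 for the cutoff and in Lebesgue L2, which dominates it, for the mollification. Two
  errors below e/4 give less than e by \<open>integral_square_triangle\<close>.\<close>

lemma smooth_approximation:
  fixes u :: "real ^ 'n \<Rightarrow> real" and g :: "'n \<Rightarrow> real ^ 'n \<Rightarrow> real"
  assumes u [measurable]: "u \<in> borel_measurable borel" and g [measurable]: "\<And>j. g j \<in> borel_measurable borel"
    and u2: "integrable gauss_measure (\<lambda>x. (u x)\<^sup>2)"
    and g2: "\<And>j. integrable gauss_measure (\<lambda>x. (g j x)\<^sup>2)"
    and weak: "\<And>\<phi> j. test_function \<phi> \<Longrightarrow>
      (\<integral>x. u x * partial_deriv j \<phi> x \<partial>lborel) = - (\<integral>x. g j x * \<phi> x \<partial>lborel)"
    and e: "e > 0"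
  obtains w w1 w2 where "C2c w w1 w2"
    "(\<integral>x. (w x - u x)\<^sup>2 \<partial>gauss_measure) < e"
    "\<And>j. (\<integral>x. (w1 j x - g j x)\<^sup>2 \<partial>gauss_measure) < e"
proof -
  define v where "v = (\<lambda>R y. cutoff R y * u y)"
  define v1 where "v1 = (\<lambda>R j y. cutoff R y * g j y + u y * cutoff_deriv R j y)"
  have \<chi>m [measurable]: "cutoff R \<in> borel_measurable borel" "cutoff_deriv R j \<in> borel_measurable borel"
    for R and j :: 'n
    by (intro borel_measurable_continuous_onI smooth_fn_continuous cutoff_smooth cutoff_deriv_smooth)+
  have vm [measurable]: "v R \<in> borel_measurable borel" "v1 R j \<in> borel_measurable borel" for R j
    unfolding v_def v1_def by measurable
  have b1: "(v R x - u x)\<^sup>2 \<le> (u x)\<^sup>2" for R x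
  proof -
    have "\<bar>cutoff R x - 1\<bar> \<le> 1"
      using cutoff_nonneg[of R x] cutoff_le_1[of R x] by simp
    from mult_square_le[OF this, of "u x"] show ?thesis
      by (simp add: v_def algebra_simps)
  qed
  \<comment> \<open>An integrable majorant not depending on R: the factor \<open>cutoff - 1\<close>
    is bounded by 1 and the derivative of the cutoff by 4 * exp 1.\<close>
  let ?h = "\<lambda>j x. 2 * ((g j x)\<^sup>2 + (4 * exp 1)\<^sup>2 * (u x)\<^sup>2)"
  have b2: "(v1 R j x - g j x)\<^sup>2 \<le> ?h j x" if "1 \<le> R" for R j x
  proof -
    have "\<bar>cutoff R x - 1\<bar> \<le> 1"
      using cutoff_nonneg[of R x] cutoff_le_1[of R x] by simp
    from mult_square_le[OF this, of "g j x"] mult_square_le[OF cutoff_deriv_bound[OF that], of j x "u x"]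
      square_add_le[of "(cutoff R x - 1) * g j x" "cutoff_deriv R j x * u x"]
    show ?thesis
      by (simp add: v1_def algebra_simps)
  qed
  have hi: "integrable gauss_measure (?h j)" for j
    using u2 g2 by simp
  have "(\<lambda>k. \<integral>x. (v (real (Suc k)) x - u x)\<^sup>2 \<partial>gauss_measure) \<longlonglongrightarrow> 0"
  proof (rule dominated_L2[OF _ _ _ u2])
    have "(\<lambda>k. v (real (Suc k)) x - u x) \<longlonglongrightarrow> 1 * u x - u x" for x
      unfolding v_def by (intro tendsto_intros cutoff_tendsto)
    then show "AE x in gauss_measure. (\<lambda>k. v (real (Suc k)) x - u x) \<longlonglongrightarrow> 0"
      by simp
  qed (use b1 in auto)
  then have ev1: "\<forall>\<^sub>F k in sequentially. (\<integral>x. (v (real (Suc k)) x - u x)\<^sup>2 \<partial>gauss_measure) < e / 4"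
    using e by (intro order_tendstoD(2)) auto
  have ev2: "\<forall>\<^sub>F k in sequentially. (\<integral>x. (v1 (real (Suc k)) j x - g j x)\<^sup>2 \<partial>gauss_measure) < e / 4" for j
  proof -
    have "(\<lambda>k. \<integral>x. (v1 (real (Suc k)) j x - g j x)\<^sup>2 \<partial>gauss_measure) \<longlonglongrightarrow> 0"
    proof (rule dominated_L2[OF _ _ _ hi])
      have "(\<lambda>k. v1 (real (Suc k)) j x - g j x) \<longlonglongrightarrow> (1 * g j x + u x * 0) - g j x" for x
        unfolding v1_def by (intro tendsto_intros cutoff_tendsto cutoff_deriv_tendsto)
      then show "AE x in gauss_measure. (\<lambda>k. v1 (real (Suc k)) j x - g j x) \<longlonglongrightarrow> 0"
        by simp
      show "AE x in gauss_measure. (v1 (real (Suc k)) j x - g j x)\<^sup>2 \<le> ?h j x" for k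
        by (intro AE_I2 b2) simp
    qed auto
    then show ?thesis
      using e by (intro order_tendstoD(2)) auto
  qed
  have "\<forall>\<^sub>F k in sequentially. (\<integral>x. (v (real (Suc k)) x - u x)\<^sup>2 \<partial>gauss_measure) < e / 4 \<and>
      (\<forall>j. (\<integral>x. (v1 (real (Suc k)) j x - g j x)\<^sup>2 \<partial>gauss_measure) < e / 4)"
    using ev1 ev2 by (intro eventually_conj eventually_all_finite) auto
  then obtain k where k: "(\<integral>x. (v (real (Suc k)) x - u x)\<^sup>2 \<partial>gauss_measure) < e / 4"
      "\<And>j. (\<integral>x. (v1 (real (Suc k)) j x - g j x)\<^sup>2 \<partial>gauss_measure) < e / 4"
    using eventually_happens'[OF sequentially_bot] by blast
  define R where "R = real (Suc k)"
  have R: "1 \<le> R" "0 < R" "0 \<le> R" by (auto simp: R_def)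
  have d1: "integrable gauss_measure (\<lambda>x. (v R x - u x)\<^sup>2)"
    by (rule integrable_square_bound[OF u2]) (use b1 in auto)
  have d2: "integrable gauss_measure (\<lambda>x. (v1 R j x - g j x)\<^sup>2)" for j
    by (rule integrable_square_bound[OF hi]) (use b2 R in auto)
  have v2: "integrable gauss_measure (\<lambda>x. (v R x)\<^sup>2)"
    using integral_square_triangle(1)[OF d1, where c="\<lambda>_. 0"] u2 by simp
  have v12: "integrable gauss_measure (\<lambda>x. (v1 R j x)\<^sup>2)" for j
    using integral_square_triangle(1)[OF d2, where c="\<lambda>_. 0"] g2 by simp
  have v0: "v R x = 0" "v1 R j x = 0" if "norm x > R" for x j
    using that R by (simp_all add: v_def v1_def cutoff_0 cutoff_deriv_0)
  have vl: "integrable lborel (\<lambda>x. (v R x)\<^sup>2)" "integrable lborel (\<lambda>x. (v1 R j x)\<^sup>2)" for j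
    using v0 R by (auto intro!: gauss_L2_vanishing_imp_lborel[where R=R] vm v2 v12)
  have vi: "integrable lborel (v R)"
    using v0 R by (auto intro!: L2_vanishing_integrable[where R=R] vm v2)
  have e4: "e / 4 > 0" using e by simp
  obtain \<delta>0 where \<delta>0: "\<delta>0 > 0" "\<And>K. mollifier \<delta>0 K \<Longrightarrow> integrable lborel (\<lambda>x. (conv K (v R) x - v R x)\<^sup>2) \<and>
       (\<integral>x. (conv K (v R) x - v R x)\<^sup>2 \<partial>lborel) < e / 4"
    by (rule mollifier_L2[where R=R, OF vm(1) vl(1) _ e4]) (erule v0(1), rule that)
  define P where "P = (\<lambda>j \<delta>. 0 < \<delta> \<and> (\<forall>K. mollifier \<delta> K \<longrightarrow>
    integrable lborel (\<lambda>x. (conv K (v1 R j) x - v1 R j x)\<^sup>2) \<and>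
    (\<integral>x. (conv K (v1 R j) x - v1 R j x)\<^sup>2 \<partial>lborel) < e / 4))"
  have "\<exists>\<delta>. P j \<delta>" for j
    unfolding P_def
    by (rule mollifier_L2[where R=R, OF vm(2)[of R j] vl(2) _ e4]) (erule v0(2), blast)
  then obtain \<delta>1 where P: "\<And>j. P j (\<delta>1 j)"
    by metis
  have \<delta>1: "\<delta>1 j > 0" "mollifier (\<delta>1 j) K \<Longrightarrow> integrable lborel (\<lambda>x. (conv K (v1 R j) x - v1 R j x)\<^sup>2) \<and>
       (\<integral>x. (conv K (v1 R j) x - v1 R j x)\<^sup>2 \<partial>lborel) < e / 4" for j K
    using P[of j] by (simp_all add: P_def)
  \<comment> \<open>One kernel must serve \<open>u\<close> and each of its finitely many weak
    derivatives. A kernel of smaller radius is also a mollifier for every larger one, so the minimum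
    works.\<close>
  define \<delta> where "\<delta> = Min (insert \<delta>0 (range \<delta>1))"
  have \<delta>: "0 < \<delta>" unfolding \<delta>_def using \<delta>0(1) \<delta>1(1) by (subst Min_gr_iff) auto
  have \<delta>le: "\<delta> \<le> \<delta>0" "\<delta> \<le> \<delta>1 j" for j
    unfolding \<delta>_def by (rule Min_le, simp, simp)+
  define K where "K = (bump_kernel \<delta> :: real ^ 'n \<Rightarrow> real)"
  have mK: "mollifier \<delta> K" unfolding K_def by (rule mollifier_bump_kernel[OF \<delta>])
  obtain K1 K2 where KC: "C2c K K1 K2"
    unfolding K_def using bump_kernel_derivs[OF \<delta>] by blast
  note KD = C2cD[OF KC]
  have ccc: "C0c (conv H (v R))" if H: "C0c H" for H
  proof -
    obtain B where "\<And>x. \<bar>H x\<bar> \<le> B" using C0c_bounded[OF H] by blast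
    moreover obtain r where "\<And>x. norm x > r \<Longrightarrow> H x = 0" using H by (auto simp: C0c_def)
    ultimately have "continuous_on UNIV (conv H (v R))" "\<And>x. norm x > r + R \<Longrightarrow> conv H (v R) x = 0"
      using conv_continuous[OF C0c_continuous[OF H] _ vi] conv_vanishing[of r H R "v R"] v0 by blast+
    then show ?thesis unfolding C0c_def by blast
  qed
  have pdc: "has_partial j (conv H (v R)) (conv H' (v R))" if "C0c H" "C0c H'" "has_partial j H H'" for j H H'
    using that C0c_bounded[of H] C0c_bounded[of H'] conv_has_partial[OF C0c_continuous _ C0c_continuous _ _ vi]
    by metis
  have C: "C2c (conv K (v R)) (\<lambda>j. conv (K1 j) (v R)) (\<lambda>i j. conv (K2 i j) (v R))"
    unfolding C2c_def using KD(6) by (intro conjI allI ccc pdc KD) metis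
  have w1: "conv (K1 j) (v R) = conv K (v1 R j)" for j
    unfolding v_def v1_def K_def
    by (rule mollify_weak_gradient[OF u g u2 g2 weak R(1) \<delta> KC[unfolded K_def]])
  note CD = C2cD[OF C]
  have m0: "integrable lborel (\<lambda>x. (conv K (v R) x - v R x)\<^sup>2)" "(\<integral>x. (conv K (v R) x - v R x)\<^sup>2 \<partial>lborel) < e / 4"
    using \<delta>0(2)[OF mollifier_mono[OF mK \<delta>le(1)]] by auto
  have m1: "integrable lborel (\<lambda>x. (conv (K1 j) (v R) x - v1 R j x)\<^sup>2)"
      "(\<integral>x. (conv (K1 j) (v R) x - v1 R j x)\<^sup>2 \<partial>lborel) < e / 4" for j
    unfolding w1 using \<delta>1(2)[OF mollifier_mono[OF mK \<delta>le(2)]] by auto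
  note [measurable] = C0c_measurable[OF CD(1)] C0c_measurable[OF CD(2)]
  show thesis
  proof (rule that[OF C])
    note n = gauss_L2_le_lborel[OF _ m0(1)]
    have "(\<integral>x. (conv K (v R) x - u x)\<^sup>2 \<partial>gauss_measure) \<le>
        2 * ((\<integral>x. (conv K (v R) x - v R x)\<^sup>2 \<partial>gauss_measure) + (\<integral>x. (v R x - u x)\<^sup>2 \<partial>gauss_measure))"
      by (rule integral_square_triangle(2)[OF n(1) d1]) auto
    also have "\<dots> < e"
      using n(2) m0(2) k(1)[folded R_def] by simp
    finally show "(\<integral>x. (conv K (v R) x - u x)\<^sup>2 \<partial>gauss_measure) < e" .
    fix j
    note n = gauss_L2_le_lborel[OF _ m1(1)[of j]]
    have "(\<integral>x. (conv (K1 j) (v R) x - g j x)\<^sup>2 \<partial>gauss_measure) \<le>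
        2 * ((\<integral>x. (conv (K1 j) (v R) x - v1 R j x)\<^sup>2 \<partial>gauss_measure) + (\<integral>x. (v1 R j x - g j x)\<^sup>2 \<partial>gauss_measure))"
      by (rule integral_square_triangle(2)[OF n(1) d2]) auto
    also have "\<dots> < e"
      using n(2) m1(2)[of j] k(2)[of j, folded R_def] by simp
    finally show "(\<integral>x. (conv (K1 j) (v R) x - g j x)\<^sup>2 \<partial>gauss_measure) < e" .
  qed
qed

section \<open>Second-order Stein formula for weakly differentiable functions\<close>

lemma L2_mult_integrable:
  fixes a b :: "'a \<Rightarrow> real"
  assumes [measurable]: "a \<in> borel_measurable M" "b \<in> borel_measurable M"
    and "integrable M (\<lambda>x. (a x)\<^sup>2)" "integrable M (\<lambda>x. (b x)\<^sup>2)"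
  shows "integrable M (\<lambda>x. a x * b x)"
proof (rule Bochner_Integration.integrable_bound[where f="\<lambda>x. (a x)\<^sup>2 + (b x)\<^sup>2"])
  have "\<bar>a x * b x\<bar> \<le> (a x)\<^sup>2 + (b x)\<^sup>2" for x
    using zero_le_power2[of "a x - b x"] zero_le_power2[of "a x + b x"]
      zero_le_power2[of "a x"] zero_le_power2[of "b x"]
    by (auto simp: power2_diff power2_sum abs_le_iff)
  then show "AE x in M. norm (a x * b x) \<le> norm ((a x)\<^sup>2 + (b x)\<^sup>2)"
    by (auto intro!: AE_I2)
qed (use assms in auto)

text \<open>The quadratic form in s and t given by the integral of the square of s a - t b is
  nonnegative; suitable s and t yield the bound.\<close>

lemma L2_cauchy_schwarz:
  fixes a b :: "'a \<Rightarrow> real"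
  assumes [measurable]: "a \<in> borel_measurable M" "b \<in> borel_measurable M"
    and a2: "integrable M (\<lambda>x. (a x)\<^sup>2)" and b2: "integrable M (\<lambda>x. (b x)\<^sup>2)"
  shows "(\<integral>x. a x * b x \<partial>M)\<^sup>2 \<le> (\<integral>x. (a x)\<^sup>2 \<partial>M) * (\<integral>x. (b x)\<^sup>2 \<partial>M)"
proof -
  define A B C where "A = (\<integral>x. (a x)\<^sup>2 \<partial>M)" and "B = (\<integral>x. (b x)\<^sup>2 \<partial>M)" and "C = (\<integral>x. a x * b x \<partial>M)"
  have ab: "integrable M (\<lambda>x. a x * b x)"
    by (rule L2_mult_integrable) (use a2 b2 in auto)
  have q: "0 \<le> s\<^sup>2 * A - 2 * s * t * C + t\<^sup>2 * B" for s t
  proof -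
    have "0 \<le> (\<integral>x. (s * a x - t * b x)\<^sup>2 \<partial>M)"
      by (intro integral_nonneg_AE) auto
    also have "(\<lambda>x. (s * a x - t * b x)\<^sup>2) = (\<lambda>x. s\<^sup>2 * (a x)\<^sup>2 - (2 * s * t) * (a x * b x) + t\<^sup>2 * (b x)\<^sup>2)"
      by (auto simp: power2_eq_square algebra_simps)
    also have "(\<integral>x. s\<^sup>2 * (a x)\<^sup>2 - (2 * s * t) * (a x * b x) + t\<^sup>2 * (b x)\<^sup>2 \<partial>M) = s\<^sup>2 * A - 2 * s * t * C + t\<^sup>2 * B"
      using a2 b2 ab by (simp add: A_def B_def C_def)
    finally show ?thesis .
  qed
  have "0 \<le> B" unfolding B_def by (intro integral_nonneg_AE) auto
  then consider "B = 0" | "B > 0" by linarith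
  then have "C\<^sup>2 \<le> A * B"
  proof cases
    case 1
    have "C = 0"
    proof (rule ccontr)
      assume "C \<noteq> 0"
      then show False
        \<comment> \<open>With B = 0 the form at this point equals A - (A + 1) = -1.\<close>
        using q[of 1 "(A + 1) / (2 * C)"] 1 by (simp add: field_simps)
    qed
    then show ?thesis using 1 by simp
  next
    case 2
    \<comment> \<open>The form at s = B, t = C equals B (A B - C^2).\<close>
    have "0 \<le> B * (A * B - C\<^sup>2)"
      using q[of B C] by (simp add: power2_eq_square algebra_simps)
    then show ?thesis
      using 2 by (simp add: zero_le_mult_iff)
  qed
  then show ?thesis by (simp add: A_def B_def C_def)
qed

text \<open>Write the product as its limit plus three terms, each containing a factor that tends to
  0 in L2, and apply Cauchy-Schwarz to each.\<close>

lemma L2_tendsto_mult: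
  fixes a b :: "'a \<Rightarrow> real" and ak bk :: "nat \<Rightarrow> 'a \<Rightarrow> real"
  assumes m [measurable]: "a \<in> borel_measurable M" "b \<in> borel_measurable M"
      "\<And>k. ak k \<in> borel_measurable M" "\<And>k. bk k \<in> borel_measurable M"
    and a2: "integrable M (\<lambda>x. (a x)\<^sup>2)" and b2: "integrable M (\<lambda>x. (b x)\<^sup>2)"
    and da: "\<And>k. integrable M (\<lambda>x. (ak k x - a x)\<^sup>2)" and db: "\<And>k. integrable M (\<lambda>x. (bk k x - b x)\<^sup>2)"
    and la: "(\<lambda>k. \<integral>x. (ak k x - a x)\<^sup>2 \<partial>M) \<longlonglongrightarrow> 0" and lb: "(\<lambda>k. \<integral>x. (bk k x - b x)\<^sup>2 \<partial>M) \<longlonglongrightarrow> 0"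
  shows "(\<lambda>k. \<integral>x. ak k x * bk k x \<partial>M) \<longlonglongrightarrow> (\<integral>x. a x * b x \<partial>M)"
proof -
  have z: "(\<lambda>k. \<integral>x. p k x * q k x \<partial>M) \<longlonglongrightarrow> 0"
    if [measurable]: "\<And>k. p k \<in> borel_measurable M" "\<And>k. q k \<in> borel_measurable M"
      and p2: "\<And>k. integrable M (\<lambda>x. (p k x)\<^sup>2)" and q2: "\<And>k. integrable M (\<lambda>x. (q k x)\<^sup>2)"
      and l: "(\<lambda>k. (\<integral>x. (p k x)\<^sup>2 \<partial>M) * (\<integral>x. (q k x)\<^sup>2 \<partial>M)) \<longlonglongrightarrow> 0" for p q :: "nat \<Rightarrow> 'a \<Rightarrow> real"
  proof -
    have "(\<lambda>k. (\<integral>x. p k x * q k x \<partial>M)\<^sup>2) \<longlonglongrightarrow> 0"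
      by (rule tendsto_sandwich[OF _ _ tendsto_const l])
         (auto intro!: always_eventually L2_cauchy_schwarz p2 q2)
    then have "(\<lambda>k. sqrt ((\<integral>x. p k x * q k x \<partial>M)\<^sup>2)) \<longlonglongrightarrow> sqrt 0"
      by (rule tendsto_real_sqrt)
    then show ?thesis by (simp add: tendsto_rabs_zero_iff)
  qed
  have 1: "(\<lambda>k. \<integral>x. (ak k x - a x) * (bk k x - b x) \<partial>M) \<longlonglongrightarrow> 0"
    by (rule z) (use da db tendsto_mult[OF la lb] in auto)
  have 2: "(\<lambda>k. \<integral>x. (ak k x - a x) * b x \<partial>M) \<longlonglongrightarrow> 0"
    by (rule z) (use da b2 tendsto_mult_right[OF la, of "\<integral>x. (b x)\<^sup>2 \<partial>M"] in auto)
  have 3: "(\<lambda>k. \<integral>x. a x * (bk k x - b x) \<partial>M) \<longlonglongrightarrow> 0"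
    by (rule z) (use db a2 tendsto_mult_left[OF lb, of "\<integral>x. (a x)\<^sup>2 \<partial>M"] in auto)
  have e: "(\<integral>x. ak k x * bk k x \<partial>M) = (\<integral>x. (ak k x - a x) * (bk k x - b x) \<partial>M) +
      (\<integral>x. (ak k x - a x) * b x \<partial>M) + (\<integral>x. a x * (bk k x - b x) \<partial>M) + (\<integral>x. a x * b x \<partial>M)" for k
  proof -
    have i: "integrable M (\<lambda>x. (ak k x - a x) * (bk k x - b x))" "integrable M (\<lambda>x. (ak k x - a x) * b x)"
        "integrable M (\<lambda>x. a x * (bk k x - b x))" "integrable M (\<lambda>x. a x * b x)"
      by (intro L2_mult_integrable; use a2 b2 da db in simp)+
    have "(\<integral>x. ak k x * bk k x \<partial>M) = (\<integral>x. (ak k x - a x) * (bk k x - b x) +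
      (ak k x - a x) * b x + a x * (bk k x - b x) + a x * b x \<partial>M)"
      by (intro Bochner_Integration.integral_cong) (auto simp: algebra_simps)
    also have "\<dots> = (\<integral>x. (ak k x - a x) * (bk k x - b x) \<partial>M) +
      (\<integral>x. (ak k x - a x) * b x \<partial>M) + (\<integral>x. a x * (bk k x - b x) \<partial>M) + (\<integral>x. a x * b x \<partial>M)"
      by (simp only: Bochner_Integration.integral_add Bochner_Integration.integrable_add i)
    finally show ?thesis .
  qed
  show ?thesis
    unfolding e using tendsto_add[OF tendsto_add[OF tendsto_add[OF 1 2] 3] tendsto_const[of "\<integral>x. a x * b x \<partial>M"]]
    by simp
qed

text \<open>L1 convergence gives an almost everywhere convergent subsequence, and Fatou then bounds
  the second moment of the limit. Square integrability of \<open>a\<close> is a conclusion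
  here.\<close>

lemma integral_square_le_liminf:
  fixes a :: "'a \<Rightarrow> real" and ak :: "nat \<Rightarrow> 'a \<Rightarrow> real"
  assumes m [measurable]: "a \<in> borel_measurable M" "\<And>k. ak k \<in> borel_measurable M"
    and i: "\<And>k. integrable M (\<lambda>x. (ak k x)\<^sup>2)" and l1i: "\<And>k. integrable M (\<lambda>x. ak k x - a x)"
    and l1: "(\<lambda>k. \<integral>x. \<bar>ak k x - a x\<bar> \<partial>M) \<longlonglongrightarrow> 0"
    and A: "(\<lambda>k. \<integral>x. (ak k x)\<^sup>2 \<partial>M) \<longlonglongrightarrow> A"
  shows "integrable M (\<lambda>x. (a x)\<^sup>2)" "(\<integral>x. (a x)\<^sup>2 \<partial>M) \<le> A"
proof -
  obtain r :: "nat \<Rightarrow> nat" where r: "strict_mono r" and ae: "AE x in M. (\<lambda>k. ak (r k) x - a x) \<longlonglongrightarrow> 0"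
    using tendsto_L1_AE_subseq[OF l1i, unfolded real_norm_def, OF l1] by auto
  have A0: "0 \<le> A"
    by (rule LIMSEQ_le_const[OF A]) (auto intro!: integral_nonneg_AE)
  have "(\<integral>\<^sup>+x. ennreal ((a x)\<^sup>2) \<partial>M) = (\<integral>\<^sup>+x. liminf (\<lambda>k. ennreal ((ak (r k) x)\<^sup>2)) \<partial>M)"
  proof (rule nn_integral_cong_AE)
    show "AE x in M. ennreal ((a x)\<^sup>2) = liminf (\<lambda>k. ennreal ((ak (r k) x)\<^sup>2))"
      using ae
    proof eventually_elim
      case (elim x)
      then have "(\<lambda>k. ak (r k) x) \<longlonglongrightarrow> a x"
        by (simp add: LIM_zero_iff)
      then have "(\<lambda>k. ennreal ((ak (r k) x)\<^sup>2)) \<longlonglongrightarrow> ennreal ((a x)\<^sup>2)"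
        by (intro tendsto_ennrealI tendsto_intros)
      then show ?case
        by (intro lim_imp_Liminf[symmetric]) auto
    qed
  qed
  also have "\<dots> \<le> liminf (\<lambda>k. \<integral>\<^sup>+x. ennreal ((ak (r k) x)\<^sup>2) \<partial>M)"
    by (rule nn_integral_liminf) measurable
  also have "(\<lambda>k. \<integral>\<^sup>+x. ennreal ((ak (r k) x)\<^sup>2) \<partial>M) = (\<lambda>k. ennreal (\<integral>x. (ak (r k) x)\<^sup>2 \<partial>M))"
    by (intro ext nn_integral_eq_integral i) auto
  also have "liminf \<dots> = ennreal A"
    using LIMSEQ_subseq_LIMSEQ[OF A r]
    by (intro lim_imp_Liminf tendsto_ennrealI) (auto simp: o_def)
  finally have le: "(\<integral>\<^sup>+x. ennreal ((a x)\<^sup>2) \<partial>M) \<le> ennreal A" .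
  then show ia: "integrable M (\<lambda>x. (a x)\<^sup>2)"
    by (intro integrableI_nonneg) (auto simp: le_less_trans)
  show "(\<integral>x. (a x)\<^sup>2 \<partial>M) \<le> A"
    using le A0 nn_integral_eq_integral[OF ia] by simp
qed

section \<open>Coordinates under the Gaussian measure\<close>

lemma distr_gauss_measure_coord:
  "distr gauss_measure borel (\<lambda>x :: real ^ 'n. x $ i) = gauss1"
proof -
  have [measurable]: "vec_lambda \<in> gauss_prod UNIV \<rightarrow>\<^sub>M (borel :: (real ^ 'n) measure)"
    using vec_lambda_measurable by (simp cong: measurable_cong_sets sets_PiM_cong)
  have "distr gauss_measure borel (\<lambda>x :: real ^ 'n. x $ i) = distr (gauss_prod UNIV) borel (\<lambda>f. f i)"
    unfolding gauss_measure_product by (subst distr_distr) (auto simp: o_def)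
  also have "\<dots> = distr (gauss_prod UNIV) gauss1 (\<lambda>f. f i)"
    by (rule distr_cong) auto
  also have "\<dots> = gauss1"
    by (rule distr_PiM_component) (auto intro: prob_space_gauss1)
  finally show ?thesis .
qed

lemma gauss_coord_power_integrable: "integrable gauss_measure (\<lambda>x :: real ^ 'n. (x $ i) ^ k)"
proof -
  have "integrable gauss1 (\<lambda>x. x ^ k)"
    unfolding gauss1_def using integrable_std_normal_moment[of k] by (subst integrable_density) auto
  then have "integrable (distr gauss_measure borel (\<lambda>x :: real ^ 'n. x $ i)) (\<lambda>x. x ^ k)"
    by (simp add: distr_gauss_measure_coord)
  then show ?thesis
    by (subst (asm) integrable_distr_eq) auto
qed

text \<open>Needed to test \<xi> against a coordinate, where \<open>f i x\<close> is paired with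
  \<open>x $ i * x $ l\<close>.\<close>

lemma gauss_coord_product_L2: "integrable gauss_measure (\<lambda>x :: real ^ 'n. (x $ i * x $ j)\<^sup>2)"
proof (rule integrable_square_bound)
  show "integrable gauss_measure (\<lambda>x :: real ^ 'n. (x $ i) ^ 4 + (x $ j) ^ 4)"
    by (intro Bochner_Integration.integrable_add gauss_coord_power_integrable)
  show "(x $ i * x $ j)\<^sup>2 \<le> (x $ i) ^ 4 + (x $ j) ^ 4" for x :: "real ^ 'n"
  proof -
    have "0 \<le> ((x $ i)\<^sup>2 - (x $ j)\<^sup>2)\<^sup>2" by simp
    then have "2 * ((x $ i)\<^sup>2 * (x $ j)\<^sup>2) \<le> (x $ i) ^ 4 + (x $ j) ^ 4"
      by (simp add: power2_diff power_mult[symmetric])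
    moreover have "0 \<le> (x $ i)\<^sup>2 * (x $ j)\<^sup>2" by simp
    ultimately show ?thesis
      unfolding power_mult_distrib by linarith
  qed
qed measurable

section \<open>Vector fields with weak gradients in Gaussian L2\<close>

text \<open>Borel representatives in scalar components, with \<open>g i j\<close> the weak
  derivative of \<open>f i\<close> in direction \<open>j\<close>. Null sets and matrices are dealt
  with once, when the locale is instantiated.\<close>

locale gauss_sobolev =
  fixes f :: "'n::finite \<Rightarrow> real ^ 'n \<Rightarrow> real" and g :: "'n \<Rightarrow> 'n \<Rightarrow> real ^ 'n \<Rightarrow> real"
  assumes f [measurable]: "\<And>i. f i \<in> borel_measurable borel"
    and g [measurable]: "\<And>i j. g i j \<in> borel_measurable borel"
    and f2: "\<And>i. integrable gauss_measure (\<lambda>x. (f i x)\<^sup>2)"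
    and g2: "\<And>i j. integrable gauss_measure (\<lambda>x. (g i j x)\<^sup>2)"
    and weak: "\<And>i j \<phi>. test_function \<phi> \<Longrightarrow>
      (\<integral>x. f i x * partial_deriv j \<phi> x \<partial>lborel) = - (\<integral>x. g i j x * \<phi> x \<partial>lborel)"
begin

lemma approximants:
  obtains w w1 w2 where "\<And>i k. C2c (w i k) (w1 i k) (w2 i k)"
    "\<And>i k. integrable gauss_measure (\<lambda>x. (w i k x - f i x)\<^sup>2)"
    "\<And>i j k. integrable gauss_measure (\<lambda>x. (w1 i k j x - g i j x)\<^sup>2)"
    "\<And>i. (\<lambda>k. \<integral>x. (w i k x - f i x)\<^sup>2 \<partial>gauss_measure) \<longlonglongrightarrow> 0"
    "\<And>i j. (\<lambda>k. \<integral>x. (w1 i k j x - g i j x)\<^sup>2 \<partial>gauss_measure) \<longlonglongrightarrow> 0"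
proof -
  define P where "P = (\<lambda>i k w w1 w2. C2c w w1 w2 \<and>
    (\<integral>x. (w x - f i x)\<^sup>2 \<partial>gauss_measure) < 1 / real (Suc k) \<and>
    (\<forall>j. (\<integral>x. (w1 j x - g i j x)\<^sup>2 \<partial>gauss_measure) < 1 / real (Suc k)))"
  have "\<exists>w w1 w2. P i k w w1 w2" for i k
  proof (rule smooth_approximation[where u="f i" and g="g i" and e="1 / real (Suc k)"])
    fix w w1 w2
    assume "C2c w w1 w2" "(\<integral>x. (w x - f i x)\<^sup>2 \<partial>gauss_measure) < 1 / real (Suc k)"
      "\<And>j. (\<integral>x. (w1 j x - g i j x)\<^sup>2 \<partial>gauss_measure) < 1 / real (Suc k)"
    then show "\<exists>w w1 w2. P i k w w1 w2"
      unfolding P_def by (intro exI[of _ w] exI[of _ w1] exI[of _ w2]) simp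
  qed (simp_all add: f g f2 g2 weak del: of_nat_Suc)
  then obtain w w1 w2 where P: "\<And>i k. P i k (w i k) (w1 i k) (w2 i k)"
    by metis
  have C: "C2c (w i k) (w1 i k) (w2 i k)" for i k
    using P[of i k] by (simp add: P_def)
  note D = C2cD[OF C]
  have sq: "integrable gauss_measure (\<lambda>x. (h x)\<^sup>2)" if "C0c h" for h :: "real ^ 'n \<Rightarrow> real"
    using C0c_integrable_gauss[OF C0c_mult[OF C0c_continuous[OF that] that]] by (simp add: power2_eq_square)
  have i: "integrable gauss_measure (\<lambda>x. (h x - p x)\<^sup>2)"
    if h: "C0c h" and "p \<in> borel_measurable borel" "integrable gauss_measure (\<lambda>x. (p x)\<^sup>2)"
    for h p :: "real ^ 'n \<Rightarrow> real"
    using integral_square_triangle(1)[where M=gauss_measure and a=h and b="\<lambda>_. 0" and c=p] sq[OF h] C0c_measurable[OF h] that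
    by simp
  have l: "(\<lambda>k. a k) \<longlonglongrightarrow> 0" if "\<And>k. 0 \<le> a k" "\<And>k. a k < 1 / real (Suc k)" for a :: "nat \<Rightarrow> real"
    by (rule tendsto_sandwich[OF _ _ tendsto_const LIMSEQ_Suc[OF lim_1_over_n]])
       (use that in \<open>auto intro!: always_eventually less_imp_le\<close>)
  show thesis
  proof (rule that[OF C])
    show "(\<lambda>k. \<integral>x. (w i k x - f i x)\<^sup>2 \<partial>gauss_measure) \<longlonglongrightarrow> 0" for i
      by (rule l) (use P[of i] in \<open>auto simp: P_def intro!: integral_nonneg_AE\<close>)
    show "(\<lambda>k. \<integral>x. (w1 i k j x - g i j x)\<^sup>2 \<partial>gauss_measure) \<longlonglongrightarrow> 0" for i j
      by (rule l) (use P[of i] in \<open>auto simp: P_def intro!: integral_nonneg_AE\<close>)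
  qed (intro i D f g f2 g2)+
qed

definition \<xi> :: "real ^ 'n \<Rightarrow> real" where
  "\<xi> x = (\<Sum>i\<in>UNIV. x $ i * f i x - g i i x)"

lemma \<xi>_measurable [measurable]: "\<xi> \<in> borel_measurable borel"
  unfolding \<xi>_def[abs_def] by measurable

text \<open>All five facts are limits of facts about the same approximants, hence one joint
  proof.\<close>

lemma
  shows \<xi>_L2: "integrable gauss_measure (\<lambda>x. (\<xi> x)\<^sup>2)"
    and second_moment_le: "(\<integral>x. (\<xi> x)\<^sup>2 \<partial>gauss_measure) \<le>
      (\<Sum>i\<in>UNIV. \<integral>x. (f i x)\<^sup>2 \<partial>gauss_measure) +
      (\<Sum>i\<in>UNIV. \<Sum>j\<in>UNIV. \<integral>x. g i j x * g j i x \<partial>gauss_measure)"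
    and mean_zero: "(\<integral>x. \<xi> x \<partial>gauss_measure) = 0"
    and mean_coord: "(\<integral>x. \<xi> x * x $ l \<partial>gauss_measure) = (\<integral>x. f l x \<partial>gauss_measure)"
    and poincare: "(\<integral>x. (f i x)\<^sup>2 \<partial>gauss_measure) - (\<integral>x. f i x \<partial>gauss_measure)\<^sup>2 \<le>
      (\<Sum>j\<in>UNIV. \<integral>x. (g i j x)\<^sup>2 \<partial>gauss_measure)"
proof -
  interpret N: prob_space "gauss_measure :: (real ^ 'n) measure"
    by (rule prob_space_gauss_measure)
  let ?N = "gauss_measure :: (real ^ 'n) measure"
  obtain w w1 w2 where C: "\<And>i k. C2c (w i k) (w1 i k) (w2 i k)"
    and dw: "\<And>i k. integrable ?N (\<lambda>x. (w i k x - f i x)\<^sup>2)"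
      "\<And>i j k. integrable ?N (\<lambda>x. (w1 i k j x - g i j x)\<^sup>2)"
    and lw: "\<And>i. (\<lambda>k. \<integral>x. (w i k x - f i x)\<^sup>2 \<partial>?N) \<longlonglongrightarrow> 0"
      "\<And>i j. (\<lambda>k. \<integral>x. (w1 i k j x - g i j x)\<^sup>2 \<partial>?N) \<longlonglongrightarrow> 0"
    by (rule approximants) (rule that)
  note D = C2cD[OF C]
  have wm [measurable]: "w i k \<in> borel_measurable borel" "w1 i k j \<in> borel_measurable borel" for i j k
    by (intro C0c_measurable D)+
  have mult: "(\<lambda>k. \<integral>x. ak k x * bk k x \<partial>?N) \<longlonglongrightarrow> (\<integral>x. a x * b x \<partial>?N)"
    if "a \<in> borel_measurable borel" "b \<in> borel_measurable borel"
      "\<And>k. ak k \<in> borel_measurable borel" "\<And>k. bk k \<in> borel_measurable borel"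
      "integrable ?N (\<lambda>x. (a x)\<^sup>2)" "integrable ?N (\<lambda>x. (b x)\<^sup>2)"
      "\<And>k. integrable ?N (\<lambda>x. (ak k x - a x)\<^sup>2)" "\<And>k. integrable ?N (\<lambda>x. (bk k x - b x)\<^sup>2)"
      "(\<lambda>k. \<integral>x. (ak k x - a x)\<^sup>2 \<partial>?N) \<longlonglongrightarrow> 0" "(\<lambda>k. \<integral>x. (bk k x - b x)\<^sup>2 \<partial>?N) \<longlonglongrightarrow> 0"
    for a b :: "real ^ 'n \<Rightarrow> real" and ak bk :: "nat \<Rightarrow> real ^ 'n \<Rightarrow> real"
    by (rule L2_tendsto_mult) (use that in auto)
  have mult1: "(\<lambda>k. \<integral>x. ak k x * b x \<partial>?N) \<longlonglongrightarrow> (\<integral>x. a x * b x \<partial>?N)"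
    if "a \<in> borel_measurable borel" "b \<in> borel_measurable borel" "\<And>k. ak k \<in> borel_measurable borel"
      "integrable ?N (\<lambda>x. (a x)\<^sup>2)" "integrable ?N (\<lambda>x. (b x)\<^sup>2)"
      "\<And>k. integrable ?N (\<lambda>x. (ak k x - a x)\<^sup>2)"
      "(\<lambda>k. \<integral>x. (ak k x - a x)\<^sup>2 \<partial>?N) \<longlonglongrightarrow> 0"
    for a b :: "real ^ 'n \<Rightarrow> real" and ak :: "nat \<Rightarrow> real ^ 'n \<Rightarrow> real"
    by (rule mult) (use that in auto)
  have lsq: "(\<lambda>k. \<integral>x. (ak k x)\<^sup>2 \<partial>?N) \<longlonglongrightarrow> (\<integral>x. (a x)\<^sup>2 \<partial>?N)"
    if "a \<in> borel_measurable borel" "\<And>k. ak k \<in> borel_measurable borel"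
      "integrable ?N (\<lambda>x. (a x)\<^sup>2)" "\<And>k. integrable ?N (\<lambda>x. (ak k x - a x)\<^sup>2)"
      "(\<lambda>k. \<integral>x. (ak k x - a x)\<^sup>2 \<partial>?N) \<longlonglongrightarrow> 0" for a :: "real ^ 'n \<Rightarrow> real" and ak :: "nat \<Rightarrow> real ^ 'n \<Rightarrow> real"
    unfolding power2_eq_square using that by (intro mult) (auto simp: power2_eq_square)
  have one: "integrable ?N (\<lambda>x. (1::real)\<^sup>2)" by simp
  have coord2: "integrable ?N (\<lambda>x. (x $ i)\<^sup>2)" for i
    by (rule gauss_coord_power_integrable)
  show "(\<integral>x. (f i x)\<^sup>2 \<partial>?N) - (\<integral>x. f i x \<partial>?N)\<^sup>2 \<le> (\<Sum>j\<in>UNIV. \<integral>x. (g i j x)\<^sup>2 \<partial>?N)"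
  proof (rule LIMSEQ_le)
    have "(\<lambda>k. \<integral>x. w i k x * 1 \<partial>?N) \<longlonglongrightarrow> (\<integral>x. f i x * 1 \<partial>?N)"
      by (rule mult1[OF _ _ _ f2 one dw(1) lw(1)]) auto
    then have "(\<lambda>k. \<integral>x. w i k x \<partial>?N) \<longlonglongrightarrow> (\<integral>x. f i x \<partial>?N)"
      by simp
    then show "(\<lambda>k. (\<integral>x. (w i k x)\<^sup>2 \<partial>?N) - (\<integral>x. w i k x \<partial>?N)\<^sup>2) \<longlonglongrightarrow>
        (\<integral>x. (f i x)\<^sup>2 \<partial>?N) - (\<integral>x. f i x \<partial>?N)\<^sup>2"
      by (intro tendsto_diff tendsto_power lsq[OF _ _ f2 dw(1) lw(1)]) auto
    show "(\<lambda>k. \<Sum>j\<in>UNIV. \<integral>x. (w1 i k j x)\<^sup>2 \<partial>?N) \<longlonglongrightarrow> (\<Sum>j\<in>UNIV. \<integral>x. (g i j x)\<^sup>2 \<partial>?N)"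
      by (intro tendsto_sum lsq[OF _ _ g2 dw(2) lw(2)]) auto
    show "\<exists>N. \<forall>k\<ge>N. (\<integral>x. (w i k x)\<^sup>2 \<partial>?N) - (\<integral>x. w i k x \<partial>?N)\<^sup>2 \<le>
        (\<Sum>j\<in>UNIV. \<integral>x. (w1 i k j x)\<^sup>2 \<partial>?N)"
      by (intro exI allI impI poincare_C1c D)
  qed
  define \<xi>k where "\<xi>k = (\<lambda>k x. \<Sum>i\<in>UNIV. x $ i * w i k x - w1 i k i x)"
  have cck: "C0c (\<xi>k k)" for k
    unfolding \<xi>k_def by (intro C0c_sum C0c_diff C0c_mult coord_continuous D)
  have [measurable]: "\<xi>k k \<in> borel_measurable borel" for k
    by (rule C0c_measurable[OF cck])
  \<comment> \<open>Reading \<open>x $ i * f i x * h x\<close> as \<open>f i x\<close> times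
    \<open>x $ i * h x\<close> makes every term an L2 pairing with a fixed second factor; hence the
    condition that \<open>x $ i * h x\<close> be square integrable.\<close>
  have h_lim: "(\<lambda>k. \<integral>x. \<xi>k k x * h x \<partial>?N) \<longlonglongrightarrow> (\<integral>x. \<xi> x * h x \<partial>?N)"
    if [measurable]: "h \<in> borel_measurable borel" and ch: "continuous_on UNIV h"
      and h2: "integrable ?N (\<lambda>x. (h x)\<^sup>2)"
      and xh2: "\<And>i. integrable ?N (\<lambda>x. (x $ i * h x)\<^sup>2)" for h
  proof -
    have ik: "integrable ?N (\<lambda>x. w i k x * (x $ i * h x))" "integrable ?N (\<lambda>x. w1 i k i x * h x)" for i k
      by (intro C0c_integrable_gauss C0c_mult' continuous_intros coord_continuous ch D)+
    have ii: "integrable ?N (\<lambda>x. f i x * (x $ i * h x))" "integrable ?N (\<lambda>x. g i i x * h x)" for i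
      by (intro L2_mult_integrable f2 g2 h2 xh2; measurable)+
    have e1: "(\<integral>x. \<xi>k k x * h x \<partial>?N) = (\<Sum>i\<in>UNIV. (\<integral>x. w i k x * (x $ i * h x) \<partial>?N) - (\<integral>x. w1 i k i x * h x \<partial>?N))" for k
    proof -
      have "(\<integral>x. \<xi>k k x * h x \<partial>?N) = (\<integral>x. (\<Sum>i\<in>UNIV. w i k x * (x $ i * h x) - w1 i k i x * h x) \<partial>?N)"
        unfolding \<xi>k_def sum_distrib_right by (intro Bochner_Integration.integral_cong sum.cong) (auto simp: algebra_simps)
      also have "\<dots> = (\<Sum>i\<in>UNIV. \<integral>x. w i k x * (x $ i * h x) - w1 i k i x * h x \<partial>?N)"
        by (rule Bochner_Integration.integral_sum) (intro Bochner_Integration.integrable_diff ik)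
      finally show ?thesis by (simp only: Bochner_Integration.integral_diff ik)
    qed
    have e2: "(\<integral>x. \<xi> x * h x \<partial>?N) = (\<Sum>i\<in>UNIV. (\<integral>x. f i x * (x $ i * h x) \<partial>?N) - (\<integral>x. g i i x * h x \<partial>?N))"
    proof -
      have "(\<integral>x. \<xi> x * h x \<partial>?N) = (\<integral>x. (\<Sum>i\<in>UNIV. f i x * (x $ i * h x) - g i i x * h x) \<partial>?N)"
        unfolding \<xi>_def sum_distrib_right by (intro Bochner_Integration.integral_cong sum.cong) (auto simp: algebra_simps)
      also have "\<dots> = (\<Sum>i\<in>UNIV. \<integral>x. f i x * (x $ i * h x) - g i i x * h x \<partial>?N)"
        by (rule Bochner_Integration.integral_sum) (intro Bochner_Integration.integrable_diff ii)
      finally show ?thesis by (simp only: Bochner_Integration.integral_diff ii)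
    qed
    show ?thesis
      unfolding e1 e2
      by (intro tendsto_sum tendsto_diff mult1[OF _ _ _ f2 xh2 dw(1) lw(1)] mult1[OF _ _ _ g2 h2 dw(2) lw(2)])
         auto
  qed
  have smooth_stein: "(\<integral>x. \<xi>k k x * h x \<partial>?N) = (\<Sum>i\<in>UNIV. \<integral>x. w i k x * h' i x \<partial>?N)"
    if h: "continuous_on UNIV h" "\<And>i. continuous_on UNIV (h' i)" "\<And>i. has_partial i h (h' i)" for h h' k
  proof -
    have "(\<integral>x. \<xi>k k x * h x \<partial>?N) = (\<integral>x. (\<Sum>i\<in>UNIV. (x $ i * w i k x - w1 i k i x) * h x) \<partial>?N)"
      by (simp add: \<xi>k_def sum_distrib_right)
    also have "\<dots> = (\<Sum>i\<in>UNIV. \<integral>x. (x $ i * w i k x - w1 i k i x) * h x \<partial>?N)"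
      by (rule Bochner_Integration.integral_sum)
         (intro C0c_integrable_gauss C0c_mult' C0c_diff C0c_mult coord_continuous D h)
    also have "\<dots> = (\<Sum>i\<in>UNIV. \<integral>x. w i k x * h' i x \<partial>?N)"
      by (intro sum.cong refl gaussian_by_parts D h)
    finally show ?thesis .
  qed
  have "(\<lambda>k. \<integral>x. \<xi>k k x * 1 \<partial>?N) \<longlonglongrightarrow> (\<integral>x. \<xi> x * 1 \<partial>?N)"
    by (rule h_lim) (use coord2 in auto)
  \<comment> \<open>A constant has zero gradient, so every approximating divergence has mean
    0.\<close>
  moreover have "(\<integral>x. \<xi>k k x * 1 \<partial>?N) = 0" for k
    using smooth_stein[of "\<lambda>_. 1" "\<lambda>_ _. 0" k] by (simp add: has_partial_def)
  ultimately show "(\<integral>x. \<xi> x \<partial>?N) = 0"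
    by (simp add: LIMSEQ_const_iff)
  have "(\<lambda>k. \<integral>x. \<xi>k k x * x $ l \<partial>?N) \<longlonglongrightarrow> (\<integral>x. \<xi> x * x $ l \<partial>?N)"
    by (rule h_lim) (use coord2 gauss_coord_product_L2 in \<open>auto intro: coord_continuous\<close>)
  moreover have "(\<integral>x. \<xi>k k x * x $ l \<partial>?N) = (\<integral>x. w l k x * 1 \<partial>?N)" for k
  proof -
    have "(\<integral>x. \<xi>k k x * x $ l \<partial>?N) = (\<Sum>i\<in>UNIV. \<integral>x. w i k x * (if l = i then 1 else 0) \<partial>?N)"
      by (rule smooth_stein[of "\<lambda>x. x $ l" "\<lambda>i x. if l = i then 1 else 0"])
         (rule coord_continuous continuous_on_const has_partial_coord)+
    also have "\<dots> = (\<Sum>i\<in>UNIV. if i = l then \<integral>x. w l k x * 1 \<partial>?N else 0)"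
      by (intro sum.cong) auto
    finally show ?thesis by simp
  qed
  moreover have "(\<lambda>k. \<integral>x. w l k x * 1 \<partial>?N) \<longlonglongrightarrow> (\<integral>x. f l x * 1 \<partial>?N)"
    by (rule mult1[OF _ _ _ f2 one dw(1) lw(1)]) auto
  ultimately show "(\<integral>x. \<xi> x * x $ l \<partial>?N) = (\<integral>x. f l x \<partial>?N)"
    using LIMSEQ_unique by fastforce
  let ?A = "(\<Sum>i\<in>UNIV. \<integral>x. (f i x)\<^sup>2 \<partial>?N) + (\<Sum>i\<in>UNIV. \<Sum>j\<in>UNIV. \<integral>x. g i j x * g j i x \<partial>?N)"
  have A: "(\<lambda>k. \<integral>x. (\<xi>k k x)\<^sup>2 \<partial>?N) \<longlonglongrightarrow> ?A"
  proof -
    have "(\<integral>x. (\<xi>k k x)\<^sup>2 \<partial>?N) = (\<Sum>i\<in>UNIV. \<integral>x. (w i k x)\<^sup>2 \<partial>?N) +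
        (\<Sum>i\<in>UNIV. \<Sum>j\<in>UNIV. \<integral>x. w1 i k j x * w1 j k i x \<partial>?N)" for k
    proof -
      have i: "integrable ?N (\<lambda>x. (w i k x)\<^sup>2)" "integrable ?N (\<lambda>x. w1 i k j x * w1 j k i x)" for i j
        unfolding power2_eq_square by (intro C0c_integrable_gauss C0c_mult' C0c_continuous D)+
      show ?thesis
        unfolding \<xi>k_def second_order_stein[OF C]
        by (simp only: Bochner_Integration.integral_add Bochner_Integration.integral_sum
            Bochner_Integration.integrable_sum i)
    qed
    then show ?thesis
      by (simp only:)
         (intro tendsto_add tendsto_sum lsq[OF _ _ f2 dw(1) lw(1)] mult[OF _ _ _ _ g2 g2 dw(2) dw(2) lw(2) lw(2)]; measurable)
  qed
  \<comment> \<open>The coordinate factor is only square integrable, so Cauchy-Schwarz gives L1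
    convergence of \<open>\<xi>k\<close> to \<open>\<xi>\<close>, the input for Fatou.\<close>
  have L1i: "integrable ?N (\<lambda>x. \<bar>w i k x - f i x\<bar> * \<bar>x $ i\<bar>)" "integrable ?N (\<lambda>x. \<bar>w1 i k i x - g i i x\<bar> * 1)" for i k
    by (intro L2_mult_integrable; use dw coord2 in simp)+
  have le: "\<bar>\<xi>k k x - \<xi> x\<bar> \<le> (\<Sum>i\<in>UNIV. \<bar>w i k x - f i x\<bar> * \<bar>x $ i\<bar> + \<bar>w1 i k i x - g i i x\<bar> * 1)" for k x
  proof -
    have "\<xi>k k x - \<xi> x = (\<Sum>i\<in>UNIV. (w i k x - f i x) * x $ i - (w1 i k i x - g i i x))"
      unfolding \<xi>k_def \<xi>_def sum_subtractf[symmetric] by (intro sum.cong) (auto simp: algebra_simps)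
    also have "\<bar>\<dots>\<bar> \<le> (\<Sum>i\<in>UNIV. \<bar>(w i k x - f i x) * x $ i - (w1 i k i x - g i i x)\<bar>)"
      by (rule sum_abs)
    also have "\<dots> \<le> (\<Sum>i\<in>UNIV. \<bar>w i k x - f i x\<bar> * \<bar>x $ i\<bar> + \<bar>w1 i k i x - g i i x\<bar> * 1)"
      by (intro sum_mono order_trans[OF abs_triangle_ineq4]) (simp add: abs_mult)
    finally show ?thesis .
  qed
  have L1s: "integrable ?N (\<lambda>x. \<Sum>i\<in>UNIV. \<bar>w i k x - f i x\<bar> * \<bar>x $ i\<bar> + \<bar>w1 i k i x - g i i x\<bar> * 1)" for k
    by (intro Bochner_Integration.integrable_sum Bochner_Integration.integrable_add L1i)
  have d1: "integrable ?N (\<lambda>x. \<xi>k k x - \<xi> x)" for k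
    by (rule Bochner_Integration.integrable_bound[OF L1s[of k]])
       (use le in \<open>auto intro!: AE_I2 intro: order_trans[OF _ abs_ge_self]\<close>)
  have l1: "(\<lambda>k. \<integral>x. \<bar>\<xi>k k x - \<xi> x\<bar> \<partial>?N) \<longlonglongrightarrow> 0"
  proof (rule tendsto_sandwich[OF _ _ tendsto_const])
    show "\<forall>\<^sub>F k in sequentially. 0 \<le> (\<integral>x. \<bar>\<xi>k k x - \<xi> x\<bar> \<partial>?N)"
      by (auto intro!: always_eventually integral_nonneg_AE)
    show "\<forall>\<^sub>F k in sequentially. (\<integral>x. \<bar>\<xi>k k x - \<xi> x\<bar> \<partial>?N) \<le>
        (\<Sum>i\<in>UNIV. (\<integral>x. \<bar>w i k x - f i x\<bar> * \<bar>x $ i\<bar> \<partial>?N) + (\<integral>x. \<bar>w1 i k i x - g i i x\<bar> * 1 \<partial>?N))"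
    proof (intro always_eventually allI)
      fix k
      have "(\<integral>x. \<bar>\<xi>k k x - \<xi> x\<bar> \<partial>?N) \<le> (\<integral>x. (\<Sum>i\<in>UNIV. \<bar>w i k x - f i x\<bar> * \<bar>x $ i\<bar> + \<bar>w1 i k i x - g i i x\<bar> * 1) \<partial>?N)"
        by (intro integral_mono integrable_abs d1 L1s le)
      then show "(\<integral>x. \<bar>\<xi>k k x - \<xi> x\<bar> \<partial>?N) \<le>
        (\<Sum>i\<in>UNIV. (\<integral>x. \<bar>w i k x - f i x\<bar> * \<bar>x $ i\<bar> \<partial>?N) + (\<integral>x. \<bar>w1 i k i x - g i i x\<bar> * 1 \<partial>?N))"
        by (simp only: Bochner_Integration.integral_add Bochner_Integration.integral_sum
            Bochner_Integration.integrable_add L1i)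
    qed
    have z: "(\<lambda>k. \<integral>x. \<bar>ak k x - a x\<bar> * b x \<partial>?N) \<longlonglongrightarrow> 0"
      if "a \<in> borel_measurable borel" "b \<in> borel_measurable borel" "\<And>k. ak k \<in> borel_measurable borel"
        "integrable ?N (\<lambda>x. (b x)\<^sup>2)" "\<And>k. integrable ?N (\<lambda>x. (ak k x - a x)\<^sup>2)"
        "(\<lambda>k. \<integral>x. (ak k x - a x)\<^sup>2 \<partial>?N) \<longlonglongrightarrow> 0" for a b :: "real ^ 'n \<Rightarrow> real" and ak :: "nat \<Rightarrow> real ^ 'n \<Rightarrow> real"
      using mult1[of "\<lambda>_. 0" b "\<lambda>k x. \<bar>ak k x - a x\<bar>"] that by simp
    have "(\<lambda>k. \<Sum>i\<in>UNIV. (\<integral>x. \<bar>w i k x - f i x\<bar> * \<bar>x $ i\<bar> \<partial>?N) + (\<integral>x. \<bar>w1 i k i x - g i i x\<bar> * 1 \<partial>?N))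
        \<longlonglongrightarrow> (\<Sum>i\<in>(UNIV::'n set). 0 + 0)"
      by (intro tendsto_sum tendsto_add z[OF _ _ _ _ dw(1) lw(1)] z[OF _ _ _ _ dw(2) lw(2)])
         (use coord2 in auto)
    then show "(\<lambda>k. \<Sum>i\<in>UNIV. (\<integral>x. \<bar>w i k x - f i x\<bar> * \<bar>x $ i\<bar> \<partial>?N) + (\<integral>x. \<bar>w1 i k i x - g i i x\<bar> * 1 \<partial>?N))
        \<longlonglongrightarrow> 0"
      by simp
  qed
  have k2: "integrable ?N (\<lambda>x. (\<xi>k k x)\<^sup>2)" for k
    unfolding power2_eq_square by (intro C0c_integrable_gauss C0c_mult' C0c_continuous cck)
  show "integrable ?N (\<lambda>x. (\<xi> x)\<^sup>2)"
    by (rule integral_square_le_liminf(1)[OF _ _ k2 d1 l1 A]) auto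
  show "(\<integral>x. (\<xi> x)\<^sup>2 \<partial>?N) \<le> ?A"
    by (rule integral_square_le_liminf(2)[OF _ _ k2 d1 l1 A]) auto
qed

end

section \<open>Kolmogorov distance and transfer to the probability space\<close>

text \<open>The standard normal density is at most its value 1 / sqrt (2 * pi) at 0, the origin of
  the second summand of C.\<close>

lemma (in prob_space) prob_interval_std_normal_le:
  assumes Z: "distributed M lborel Z (\<lambda>x. ennreal (std_normal_density x))" and "0 \<le> \<delta>"
  shows "prob {\<omega> \<in> space M. a < Z \<omega> \<and> Z \<omega> \<le> a + \<delta>} \<le> \<delta> / sqrt (2 * pi)"
proof -
  have "emeasure M (Z -` {a<..a + \<delta>} \<inter> space M) =
      (\<integral>\<^sup>+x. ennreal (std_normal_density x) * indicator {a<..a + \<delta>} x \<partial>lborel)"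
    by (rule distributed_emeasure[OF Z]) simp
  also have "\<dots> \<le> (\<integral>\<^sup>+x. ennreal (1 / sqrt (2 * pi)) * indicator {a<..a + \<delta>} x \<partial>lborel)"
  proof (intro nn_integral_mono mult_right_mono ennreal_leI)
    fix x :: real
    show "std_normal_density x \<le> 1 / sqrt (2 * pi)"
      unfolding std_normal_density_def by (simp add: divide_right_mono)
  qed simp
  also have "\<dots> = ennreal (\<delta> / sqrt (2 * pi))"
    using assms(2) by (simp add: nn_integral_cmult ennreal_mult[symmetric])
  also have "Z -` {a<..a + \<delta>} \<inter> space M = {\<omega> \<in> space M. a < Z \<omega> \<and> Z \<omega> \<le> a + \<delta>}"
    by auto
  finally show ?thesis
    using assms(2) by (simp add: emeasure_eq_measure)
qed

text \<open>Off the event that \<open>X\<close> and \<open>Z\<close> differ by at least \<delta>,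
  the events \<open>X \<le> t\<close> and \<open>Z \<le> t\<close> can disagree only if
  \<open>Z\<close> lies in an interval of length \<delta> next to t. Chebyshev bounds the
  exceptional event.\<close>

lemma (in prob_space) kolmogorov_distance_le:
  assumes X [measurable]: "X \<in> borel_measurable M"
    and Z: "distributed M lborel Z (\<lambda>x. ennreal (std_normal_density x))"
    and i: "integrable M (\<lambda>\<omega>. (X \<omega> - Z \<omega>)\<^sup>2)" and \<delta>: "0 < \<delta>"
  shows "\<bar>prob {\<omega> \<in> space M. X \<omega> \<le> t} - prob {\<omega> \<in> space M. Z \<omega> \<le> t}\<bar> \<le>
    expectation (\<lambda>\<omega>. (X \<omega> - Z \<omega>)\<^sup>2) / \<delta>\<^sup>2 + \<delta> / sqrt (2 * pi)"
proof -
  have [measurable]: "Z \<in> borel_measurable M"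
    using Z by (simp add: distributed_def)
  let ?E = "{\<omega> \<in> space M. \<bar>X \<omega> - Z \<omega>\<bar> \<ge> \<delta>}"
  have E: "prob ?E \<le> expectation (\<lambda>\<omega>. (X \<omega> - Z \<omega>)\<^sup>2) / \<delta>\<^sup>2"
    by (rule second_moment_method[OF _ i \<delta>]) measurable
  have "prob {\<omega> \<in> space M. X \<omega> \<le> t} \<le>
      prob ({\<omega> \<in> space M. Z \<omega> \<le> t} \<union> ({\<omega> \<in> space M. t < Z \<omega> \<and> Z \<omega> \<le> t + \<delta>} \<union> ?E))"
    by (rule finite_measure_mono) auto
  also have "\<dots> \<le> prob {\<omega> \<in> space M. Z \<omega> \<le> t} + prob ({\<omega> \<in> space M. t < Z \<omega> \<and> Z \<omega> \<le> t + \<delta>} \<union> ?E)"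
    by (rule measure_Un_le) auto
  also have "prob ({\<omega> \<in> space M. t < Z \<omega> \<and> Z \<omega> \<le> t + \<delta>} \<union> ?E) \<le>
      prob {\<omega> \<in> space M. t < Z \<omega> \<and> Z \<omega> \<le> t + \<delta>} + prob ?E"
    by (rule measure_Un_le) auto
  also have "prob {\<omega> \<in> space M. t < Z \<omega> \<and> Z \<omega> \<le> t + \<delta>} \<le> \<delta> / sqrt (2 * pi)"
    by (rule prob_interval_std_normal_le[OF Z]) (use \<delta> in simp)
  finally have 1: "prob {\<omega> \<in> space M. X \<omega> \<le> t} - prob {\<omega> \<in> space M. Z \<omega> \<le> t} \<le> \<delta> / sqrt (2 * pi) + prob ?E"
    by simp
  \<comment> \<open>The symmetric estimate uses the interval that ends at t;
    \<open>(t - \<delta>) + \<delta>\<close> is kept in this form to match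
    \<open>prob_interval_std_normal_le\<close>.\<close>
  have "prob {\<omega> \<in> space M. Z \<omega> \<le> t} \<le>
      prob ({\<omega> \<in> space M. X \<omega> \<le> t} \<union> ({\<omega> \<in> space M. t - \<delta> < Z \<omega> \<and> Z \<omega> \<le> (t - \<delta>) + \<delta>} \<union> ?E))"
    by (rule finite_measure_mono) auto
  also have "\<dots> \<le> prob {\<omega> \<in> space M. X \<omega> \<le> t} + prob ({\<omega> \<in> space M. t - \<delta> < Z \<omega> \<and> Z \<omega> \<le> (t - \<delta>) + \<delta>} \<union> ?E)"
    by (rule measure_Un_le) auto
  also have "prob ({\<omega> \<in> space M. t - \<delta> < Z \<omega> \<and> Z \<omega> \<le> (t - \<delta>) + \<delta>} \<union> ?E) \<le>
      prob {\<omega> \<in> space M. t - \<delta> < Z \<omega> \<and> Z \<omega> \<le> (t - \<delta>) + \<delta>} + prob ?E"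
    by (rule measure_Un_le) auto
  also have "prob {\<omega> \<in> space M. t - \<delta> < Z \<omega> \<and> Z \<omega> \<le> (t - \<delta>) + \<delta>} \<le> \<delta> / sqrt (2 * pi)"
    by (rule prob_interval_std_normal_le[OF Z]) (use \<delta> in simp)
  finally have 2: "prob {\<omega> \<in> space M. Z \<omega> \<le> t} - prob {\<omega> \<in> space M. X \<omega> \<le> t} \<le> \<delta> / sqrt (2 * pi) + prob ?E"
    by simp
  show ?thesis using 1 2 E by linarith
qed

lemma (in prob_space) kolmogorov_distance_sup_le:
  assumes X: "X \<in> borel_measurable M"
    and Z: "distributed M lborel Z (\<lambda>x. ennreal (std_normal_density x))"
    and i: "integrable M (\<lambda>\<omega>. (X \<omega> - Z \<omega>)\<^sup>2)"
  shows "(\<Squnion>t::real. \<bar>prob {\<omega> \<in> space M. X \<omega> \<le> t} - prob {\<omega> \<in> space M. Z \<omega> \<le> t}\<bar>) \<le>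
    (1 + 1 / sqrt (2 * pi)) * expectation (\<lambda>\<omega>. (X \<omega> - Z \<omega>)\<^sup>2) powr (1 / 3)"
proof (rule cSUP_least)
  fix t
  define W where "W = expectation (\<lambda>\<omega>. (X \<omega> - Z \<omega>)\<^sup>2)"
  let ?d = "\<bar>prob {\<omega> \<in> space M. X \<omega> \<le> t} - prob {\<omega> \<in> space M. Z \<omega> \<le> t}\<bar>"
  have W: "0 \<le> W" unfolding W_def by (intro integral_nonneg_AE) auto
  have b: "?d \<le> W / \<delta>\<^sup>2 + \<delta> / sqrt (2 * pi)" if "0 < \<delta>" for \<delta>
    unfolding W_def by (rule kolmogorov_distance_le[OF X Z i that])
  show "?d \<le> (1 + 1 / sqrt (2 * pi)) * W powr (1 / 3)"
  proof (cases "W = 0")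
    case True
    \<comment> \<open>For W = 0 only the interval term remains, and it can be made as small as
      desired.\<close>
    have "?d \<le> e" if "0 < e" for e
      using b[of "e * sqrt (2 * pi)"] that True by simp
    then have "?d \<le> 0" by (rule field_le_epsilon) simp
    then show ?thesis using True by simp
  next
    case False
    \<comment> \<open>This choice makes W / \<delta>^2 equal to \<delta>, so both terms are
      multiples of the cube root of W.\<close>
    define \<delta> where "\<delta> = W powr (1 / 3)"
    have "0 < W" using False W by simp
    then have \<delta>0: "0 < \<delta>" by (simp add: \<delta>_def)
    have "\<delta> powr 3 = W"
      using \<open>0 < W\<close> by (simp add: \<delta>_def powr_powr)
    then have \<delta>: "0 < \<delta>" "\<delta> ^ 3 = W"
      using \<delta>0 by simp_all
    then have "W / \<delta>\<^sup>2 = \<delta>"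
      by (simp add: power3_eq_cube power2_eq_square field_simps)
    then show ?thesis
      using b[OF \<delta>(1)] by (simp add: \<delta>_def[symmetric] distrib_right)
  qed
qed simp

text \<open>With s = sqrt (1 - e) one has e = (1 - s)(1 + s), so c = 1 / (1 + s)^2; the range of c
  reflects s in [0, 1].\<close>

lemma one_minus_sqrt_square:
  fixes e :: real
  assumes "0 \<le> e" "e \<le> 1"
  obtains c where "c \<in> {1 / 4..1}" "(1 - sqrt (1 - e))\<^sup>2 = c * e\<^sup>2"
proof
  define s where "s = sqrt (1 - e)"
  have s: "0 \<le> s" "s \<le> 1" "s\<^sup>2 = 1 - e"
    using assms by (auto simp: s_def)
  let ?c = "1 / (1 + s)\<^sup>2"
  have "1 \<le> (1 + s)\<^sup>2" using s power_mono[of 1 "1 + s" 2] by simp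
  moreover have "(1 + s)\<^sup>2 \<le> 4" using s power_mono[of "1 + s" 2 2] by simp
  ultimately show "?c \<in> {1 / 4..1}" by (auto simp: divide_simps)
  have "e = (1 - s) * (1 + s)"
    using s(3) by (simp add: power2_eq_square algebra_simps)
  then have e2: "e\<^sup>2 = (1 - s)\<^sup>2 * (1 + s)\<^sup>2"
    by (simp add: power_mult_distrib)
  show "(1 - sqrt (1 - e))\<^sup>2 = ?c * e\<^sup>2"
    unfolding s_def[symmetric] e2 using s by simp
qed

lemma frac_mono:
  fixes x y m :: real
  assumes "0 < m" "0 \<le> x" "x \<le> y"
  shows "x / (m + x) \<le> y / (m + y)"
  using assms by (simp add: field_simps)

lemma norm_vec_square: "(norm (v :: real ^ 'n))\<^sup>2 = (\<Sum>i\<in>UNIV. (v $ i)\<^sup>2)"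
  by (simp add: norm_vec_def L2_set_def sum_nonneg)

section \<open>Law of a linear functional of a Gaussian vector\<close>

lemma distributed_gauss_linear:
  fixes m :: "real ^ 'n"
  assumes "m \<noteq> 0"
  shows "distributed gauss_measure lborel (\<lambda>x. (x \<bullet> m) / norm m) (\<lambda>x. ennreal (std_normal_density x))"
proof -
  let ?N = "gauss_measure :: (real ^ 'n) measure"
  interpret N: prob_space ?N by (rule prob_space_gauss_measure)
  have vl [measurable]: "vec_lambda \<in> gauss_prod UNIV \<rightarrow>\<^sub>M (borel :: (real ^ 'n) measure)"
    using vec_lambda_measurable by (simp cong: measurable_cong_sets sets_PiM_cong)
  have indep: "N.indep_vars (\<lambda>_. borel) (\<lambda>i x. x $ i) UNIV"
  proof (subst N.indep_vars_iff_distr_eq_PiM)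
    have r: "(\<lambda>x :: real ^ 'n. \<lambda>i\<in>UNIV. x $ i) \<in> borel \<rightarrow>\<^sub>M (\<Pi>\<^sub>M i\<in>UNIV. borel)"
      by (intro measurable_restrict) auto
    have e: "(\<lambda>x :: real ^ 'n. \<lambda>i\<in>UNIV. x $ i) \<circ> vec_lambda = (\<lambda>f. f)"
      by (auto simp: fun_eq_iff restrict_def)
    have "distr ?N (\<Pi>\<^sub>M i\<in>UNIV. borel) (\<lambda>x. \<lambda>i\<in>UNIV. x $ i) = distr (gauss_prod UNIV) (\<Pi>\<^sub>M i\<in>UNIV. borel) (\<lambda>f. f)"
      unfolding gauss_measure_product distr_distr[OF r vl] e ..
    also have "\<dots> = gauss_prod UNIV"
      by (rule distr_id2) (simp cong: sets_PiM_cong)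
    finally show "distr ?N (\<Pi>\<^sub>M i\<in>UNIV. borel) (\<lambda>x. \<lambda>i\<in>UNIV. x $ i) = (\<Pi>\<^sub>M i\<in>UNIV. distr ?N borel (\<lambda>x. x $ i))"
      by (simp add: distr_gauss_measure_coord)
  qed auto
  \<comment> \<open>The theorem on sums of independent normals asks for positive standard
    deviations, so coordinates with zero coefficient are left out of the sum.\<close>
  let ?I = "{i. m $ i \<noteq> 0}"
  have nm: "norm m > 0" using assms by simp
  have I: "?I \<noteq> {}" using assms by (auto simp: vec_eq_iff)
  have coord: "distributed ?N lborel (\<lambda>x. x $ i) (normal_density 0 1)" for i
    unfolding distributed_def
  proof (intro conjI)
    have "distr ?N lborel (\<lambda>x. x $ i) = distr ?N borel (\<lambda>x. x $ i)"
      by (rule distr_cong) auto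
    then show "distr ?N lborel (\<lambda>x. x $ i) = density lborel (\<lambda>x. ennreal (normal_density 0 1 x))"
      by (simp add: distr_gauss_measure_coord gauss1_def)
  qed auto
  have "distributed ?N lborel (\<lambda>x. \<Sum>i\<in>?I. (m $ i / norm m) * x $ i)
      (normal_density (\<Sum>i\<in>?I. 0) (sqrt (\<Sum>i\<in>?I. (\<bar>m $ i / norm m\<bar>)\<^sup>2)))"
  proof (rule N.sum_indep_normal)
    show "N.indep_vars (\<lambda>_. borel) (\<lambda>i x. (m $ i / norm m) * x $ i) ?I"
      by (rule N.indep_vars_compose2[OF N.indep_vars_subset[OF indep], where Y="\<lambda>i y. (m $ i / norm m) * y"]) auto
    fix i assume "i \<in> ?I"
    then show "0 < \<bar>m $ i / norm m\<bar>" using nm by simp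
    show "distributed ?N lborel (\<lambda>x. (m $ i / norm m) * x $ i) (normal_density 0 \<bar>m $ i / norm m\<bar>)"
      using N.normal_density_affine[OF coord, where \<alpha>="m $ i / norm m" and \<beta>=0] \<open>i \<in> ?I\<close> nm by simp
  qed (use I in auto)
  also have "(\<lambda>x. \<Sum>i\<in>?I. (m $ i / norm m) * x $ i) = (\<lambda>x. (x \<bullet> m) / norm m)"
  proof
    fix x
    have "(\<Sum>i\<in>?I. (m $ i / norm m) * x $ i) = (\<Sum>i\<in>UNIV. (m $ i / norm m) * x $ i)"
      by (rule sum.mono_neutral_left) auto
    then show "(\<Sum>i\<in>?I. (m $ i / norm m) * x $ i) = (x \<bullet> m) / norm m"
      by (simp add: inner_vec_def sum_divide_distrib mult.commute)
  qed
  also have "(\<Sum>i\<in>?I. (\<bar>m $ i / norm m\<bar>)\<^sup>2) = 1"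
  proof -
    have "(\<Sum>i\<in>?I. (\<bar>m $ i / norm m\<bar>)\<^sup>2) = (\<Sum>i\<in>UNIV. (m $ i / norm m)\<^sup>2)"
      by (subst power2_abs) (rule sum.mono_neutral_left, auto)
    also have "\<dots> = (\<Sum>i\<in>UNIV. (m $ i)\<^sup>2) / (norm m)\<^sup>2"
      by (simp add: power_divide sum_divide_distrib)
    also have "(\<Sum>i\<in>UNIV. (m $ i)\<^sup>2) = (norm m)\<^sup>2"
      by (rule norm_vec_square[symmetric])
    finally show ?thesis using nm by simp
  qed
  finally show ?thesis by simp
qed

section \<open>Borel representatives and the symmetric part\<close>

lemma locally_integrable_measurable:
  fixes u :: "real ^ 'n \<Rightarrow> 'b::euclidean_space"
  assumes "locally_integrable u"
  shows "u \<in> borel_measurable lebesgue"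
proof (rule borel_measurable_LIMSEQ_metric)
  fix k :: nat
  have "u absolutely_integrable_on cball 0 (real k)"
    using assms by (auto simp: locally_integrable_def)
  then show "(\<lambda>x. indicator (cball 0 (real k)) x *\<^sub>R u x) \<in> borel_measurable lebesgue"
    unfolding set_integrable_def by (rule borel_measurable_integrable)
next
  fix x :: "real ^ 'n"
  have "\<forall>\<^sub>F k in sequentially. norm x \<le> real k"
    using filterlim_real_sequentially by (auto simp: filterlim_at_top)
  then have "\<forall>\<^sub>F k in sequentially. indicator (cball 0 (real k)) x *\<^sub>R u x = u x"
    by eventually_elim (simp add: indicator_def dist_norm)
  then show "(\<lambda>k. indicator (cball 0 (real k)) x *\<^sub>R u x) \<longlonglongrightarrow> u x"
    by (rule tendsto_eventually)
qed

lemma test_function_measurable: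
  assumes "test_function \<phi>"
  shows "\<phi> \<in> borel_measurable borel" "partial_deriv j \<phi> \<in> borel_measurable borel"
proof -
  have "Ck 0 \<phi>" "Ck 1 \<phi>" using assms by (auto simp: test_function_def)
  then show "\<phi> \<in> borel_measurable borel" "partial_deriv j \<phi> \<in> borel_measurable borel"
    by (auto intro: borel_measurable_continuous_onI)
qed

text \<open>A weak gradient is only Lebesgue measurable, whereas transferring integrals along the
  law of \<open>z\<close> calls for Borel functions. Borel versions equal almost everywhere leave
  the test identities unchanged.\<close>

lemma weak_gradient_borel:
  fixes u :: "real ^ 'n \<Rightarrow> real"
  assumes "weak_gradient u g"
  obtains u' g' where "u' \<in> borel_measurable borel" "\<And>j. g' j \<in> borel_measurable borel"
    "AE x in lborel. u x = u' x" "\<And>j. AE x in lborel. g x $ j = g' j x"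
    "\<And>\<phi> j. test_function \<phi> \<Longrightarrow>
      (\<integral>x. u' x * partial_deriv j \<phi> x \<partial>lborel) = - (\<integral>x. g' j x * \<phi> x \<partial>lborel)"
proof -
  have m [measurable]: "u \<in> borel_measurable lebesgue" "g \<in> borel_measurable lebesgue"
    using assms by (auto simp: weak_gradient_def locally_integrable_measurable)
  have mj [measurable]: "(\<lambda>x. g x $ j) \<in> borel_measurable lebesgue" for j
    by (rule measurable_compose[OF m(2)])
       (intro borel_measurable_continuous_onI continuous_intros)
  obtain u' where u': "u' \<in> borel_measurable lborel" "AE x in lborel. u x = u' x"
    using completion_ex_borel_measurable_real[OF m(1)] by blast
  have "\<exists>h. h \<in> borel_measurable lborel \<and> (AE x in lborel. g x $ j = h x)" for j
    using completion_ex_borel_measurable_real[OF mj] by blast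
  then obtain g' where g': "\<And>j. g' j \<in> borel_measurable lborel" "\<And>j. AE x in lborel. g x $ j = g' j x"
    by metis
  have tr: "(\<integral>x. a x * b x \<partial>lebesgue) = (\<integral>x. a' x * b x \<partial>lborel)"
    if [measurable]: "a' \<in> borel_measurable borel" "b \<in> borel_measurable borel" "a \<in> borel_measurable lebesgue"
      and ae: "AE x in lborel. a x = a' x"
    for a a' b :: "real ^ 'n \<Rightarrow> real"
  proof -
    have [measurable]: "b \<in> borel_measurable lebesgue" "a' \<in> borel_measurable lebesgue"
      by (rule measurable_completion, simp)+
    have "(\<integral>x. a x * b x \<partial>lebesgue) = (\<integral>x. a' x * b x \<partial>lebesgue)"
      by (rule integral_cong_AE) (use AE_completion[OF ae] in auto)
    also have "\<dots> = (\<integral>x. a' x * b x \<partial>lborel)"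
      by (rule integral_completion) simp
    finally show ?thesis .
  qed
  show thesis
  proof (rule that[of u' g'])
    fix \<phi> :: "real ^ 'n \<Rightarrow> real" and j assume \<phi>: "test_function \<phi>"
    have "(\<integral>x. u x * partial_deriv j \<phi> x \<partial>lebesgue) = - (\<integral>x. g x $ j * \<phi> x \<partial>lebesgue)"
      using assms \<phi> by (auto simp: weak_gradient_def)
    also have "(\<integral>x. u x * partial_deriv j \<phi> x \<partial>lebesgue) = (\<integral>x. u' x * partial_deriv j \<phi> x \<partial>lborel)"
      by (rule tr) (use u' m test_function_measurable[OF \<phi>] in auto)
    also have "(\<integral>x. g x $ j * \<phi> x \<partial>lebesgue) = (\<integral>x. g' j x * \<phi> x \<partial>lborel)"
      by (rule tr) (use g' mj test_function_measurable[OF \<phi>] in auto)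
    finally show "(\<integral>x. u' x * partial_deriv j \<phi> x \<partial>lborel) = - (\<integral>x. g' j x * \<phi> x \<partial>lborel)" .
  qed (use u' g' in auto)
qed

lemma norm_matrix_square: "(norm (A :: real ^ 'n ^ 'm))\<^sup>2 = (\<Sum>i\<in>UNIV. \<Sum>j\<in>UNIV. (A $ i $ j)\<^sup>2)"
  by (simp add: norm_matrix_frobenius sum_nonneg)

text \<open>The last double sum is the trace of \<open>A ** A\<close>, the quantity produced by the
  second-order formula.\<close>

lemma norm_sym_part_square:
  fixes A :: "real ^ 'n ^ 'n"
  shows "2 * (norm (sym_part A))\<^sup>2 =
    (\<Sum>i\<in>UNIV. \<Sum>j\<in>UNIV. (A $ i $ j)\<^sup>2) + (\<Sum>i\<in>UNIV. \<Sum>j\<in>UNIV. A $ i $ j * A $ j $ i)"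
proof -
  let ?q = "\<Sum>i\<in>UNIV. \<Sum>j\<in>UNIV. (A $ i $ j)\<^sup>2"
  have sw: "(\<Sum>i\<in>UNIV. \<Sum>j\<in>UNIV. (A $ j $ i)\<^sup>2) = ?q"
    by (rule sum.swap)
  have "2 * (norm (sym_part A))\<^sup>2 =
      (\<Sum>i\<in>UNIV. \<Sum>j\<in>UNIV. (A $ i $ j)\<^sup>2 / 2 + (A $ j $ i)\<^sup>2 / 2 + A $ i $ j * A $ j $ i)"
    unfolding norm_matrix_square sum_distrib_left
    by (intro sum.cong) (auto simp: sym_part_def transpose_def power2_eq_square field_simps)
  also have "\<dots> = ?q / 2 + ?q / 2 + (\<Sum>i\<in>UNIV. \<Sum>j\<in>UNIV. A $ i $ j * A $ j $ i)"
    by (simp only: sum.distrib sum_divide_distrib[symmetric] sw)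
  finally show ?thesis by simp
qed

section \<open>Assembly of the normal approximation bound\<close>

text \<open>Square integrability of \<xi>, positivity of \<open>V\<close> and nonnegativity of
  \<open>eps_sq\<close> belong to the conclusion, so that the variance, the quotients by
  \<open>V\<close> and the cube root have their intended meaning rather than default values.\<close>

theorem theorem2p2:
  fixes M :: "'a measure"
    and z :: "'a \<Rightarrow> real ^ 'n"
    and f :: "real ^ 'n \<Rightarrow> real ^ 'n"
    and G :: "real ^ 'n \<Rightarrow> real ^ 'n ^ 'n"
    and \<xi> Z :: "'a \<Rightarrow> real"
    and m :: "real ^ 'n"
    and V S D eps_sq epsbar_sq C :: real
  assumes M: "prob_space M"
    and z: "std_gaussian_vector M z"
    and grad: "weak_gradient_matrix f G"
    and f_L2: "\<And>i. square_integrable M (\<lambda>\<omega>. f (z \<omega>) $ i)"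
    and grad_L2: "\<And>i. square_integrable M (\<lambda>\<omega>. column i (G (z \<omega>)))"
    and mean_nz: "prob_space.expectation M (\<lambda>\<omega>. f (z \<omega>)) \<noteq> 0"
  defines "m \<equiv> prob_space.expectation M (\<lambda>\<omega>. f (z \<omega>))"
    and "\<xi> \<equiv> (\<lambda>\<omega>. z \<omega> \<bullet> f (z \<omega>) - trace (G (z \<omega>)))"
    and "Z \<equiv> (\<lambda>\<omega>. (z \<omega> \<bullet> m) / norm m)"
    and "V \<equiv> prob_space.variance M \<xi>"
    and "S \<equiv> prob_space.expectation M (\<lambda>\<omega>. (norm (sym_part (G (z \<omega>))))\<^sup>2)"
    and "D \<equiv> prob_space.expectation M (\<lambda>\<omega>. (norm (G (z \<omega>)))\<^sup>2)"
    and "eps_sq \<equiv> 1 - (norm m)\<^sup>2 / V"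
    and "epsbar_sq \<equiv> 2 * S / ((norm m)\<^sup>2 + 2 * S)"
    and "C \<equiv> 1 + 1 / sqrt (2 * pi)"
  shows "square_integrable M \<xi> \<and> 0 < V \<and> 0 \<le> eps_sq \<and>
    distributed M lborel Z (\<lambda>x. ennreal (std_normal_density x)) \<and>
    (\<exists>c\<^sub>1\<in>{1/4..1}.
      prob_space.expectation M (\<lambda>\<omega>. (\<xi> \<omega> / sqrt V - Z \<omega>)\<^sup>2)
        = eps_sq + (1 - sqrt (1 - eps_sq))\<^sup>2 \<and>
      eps_sq + (1 - sqrt (1 - eps_sq))\<^sup>2 = eps_sq + c\<^sub>1 * eps_sq\<^sup>2 \<and>
      eps_sq \<le> epsbar_sq \<and>
      epsbar_sq \<le> 2 * D / (prob_space.expectation M (\<lambda>\<omega>. (norm (f (z \<omega>)))\<^sup>2) + D) \<and>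
      (\<Squnion>t::real. \<bar>prob_space.prob M {\<omega> \<in> space M. \<xi> \<omega> / sqrt V \<le> t}
                   - prob_space.prob M {\<omega> \<in> space M. Z \<omega> \<le> t}\<bar>)
        \<le> C * (eps_sq + c\<^sub>1 * eps_sq\<^sup>2) powr (1/3))"
proof -
  interpret M: prob_space M by (rule M)
  let ?N = "gauss_measure :: (real ^ 'n) measure"
  have zm [measurable]: "z \<in> borel_measurable M"
    using z by (simp add: std_gaussian_vector_def distributed_def)
  have dz: "distr M borel z = ?N"
  proof -
    have "distr M borel z = distr M lborel z" by (rule distr_cong) auto
    also have "\<dots> = ?N"
      using z by (simp add: std_gaussian_vector_def distributed_def gauss_measure_def gauss_def)
    finally show ?thesis .
  qed
  have tr: "M.expectation (\<lambda>\<omega>. h (z \<omega>)) = (\<integral>x. h x \<partial>?N)"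
    if "h \<in> borel_measurable borel" for h :: "real ^ 'n \<Rightarrow> real"
    unfolding dz[symmetric] using that by (subst integral_distr) auto
  have tri: "integrable M (\<lambda>\<omega>. h (z \<omega>)) \<longleftrightarrow> integrable ?N h"
    if "h \<in> borel_measurable borel" for h :: "real ^ 'n \<Rightarrow> real"
    unfolding dz[symmetric] using that by (subst integrable_distr_eq) auto
  have trae: "AE \<omega> in M. P (z \<omega>)" if "AE x in lborel. P x" for P
  proof (rule AE_distrD[OF zm])
    show "AE x in distr M borel z. P x" unfolding dz AE_gauss_measure by (rule that)
  qed
  define P where "P = (\<lambda>i u g'. u \<in> borel_measurable borel \<and> (\<forall>j. g' j \<in> borel_measurable borel) \<and>
    (AE x in lborel. f x $ i = u x) \<and> (\<forall>j. AE x in lborel. column i (G x) $ j = g' j x) \<and>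
    (\<forall>\<phi> j. test_function \<phi> \<longrightarrow>
      (\<integral>x. u x * partial_deriv j \<phi> x \<partial>lborel) = - (\<integral>x. g' j x * \<phi> x \<partial>lborel)))"
  have "\<exists>u g'. P i u g'" for i
  proof (rule weak_gradient_borel)
    show "weak_gradient (\<lambda>x. f x $ i) (\<lambda>x. column i (G x))"
      using grad by (simp add: weak_gradient_matrix_def)
    fix u g'
    assume "u \<in> borel_measurable borel" "\<And>j. g' j \<in> borel_measurable borel"
      "AE x in lborel. f x $ i = u x" "\<And>j. AE x in lborel. column i (G x) $ j = g' j x"
      "\<And>\<phi> j. test_function \<phi> \<Longrightarrow>
        (\<integral>x. u x * partial_deriv j \<phi> x \<partial>lborel) = - (\<integral>x. g' j x * \<phi> x \<partial>lborel)"
    then show "\<exists>u g'. P i u g'"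
      unfolding P_def by (intro exI[of _ u] exI[of _ g']) simp
  qed
  then obtain fb gb where P: "\<And>i. P i (fb i) (gb i)" by metis
  have fbm [measurable]: "fb i \<in> borel_measurable borel" and gbm [measurable]: "gb i j \<in> borel_measurable borel" for i j
    using P[of i] by (auto simp: P_def)
  have "AE \<omega> in M. f (z \<omega>) $ i = fb i (z \<omega>)" for i
    by (rule trae) (use P[of i] in \<open>simp add: P_def\<close>)
  then have fz: "AE \<omega> in M. \<forall>i. f (z \<omega>) $ i = fb i (z \<omega>)"
    by (simp add: AE_all_countable)
  have "AE \<omega> in M. column i (G (z \<omega>)) $ j = gb i j (z \<omega>)" for i j
    by (rule trae) (use P[of i] in \<open>simp add: P_def\<close>)
  \<comment> \<open>Columns of \<open>G\<close> are gradients, so the row index \<open>j\<close> is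
    the direction and the column index \<open>i\<close> the component; hence the swapped
    indices.\<close>
  then have gz: "AE \<omega> in M. \<forall>i j. G (z \<omega>) $ j $ i = gb i j (z \<omega>)"
    by (simp add: AE_all_countable column_def)
  have fm [measurable]: "(\<lambda>\<omega>. f (z \<omega>) $ i) \<in> borel_measurable M" for i
    using f_L2[of i] by (simp add: square_integrable_def)
  have Gm [measurable]: "(\<lambda>\<omega>. G (z \<omega>) $ j $ i) \<in> borel_measurable M" for i j
  proof -
    have 1: "(\<lambda>\<omega>. column i (G (z \<omega>))) \<in> borel_measurable M"
      using grad_L2[of i] by (simp add: square_integrable_def)
    have 2: "(\<lambda>v :: real ^ 'n. v $ j) \<in> borel_measurable borel"
      by (intro borel_measurable_continuous_onI continuous_intros)
    have "(\<lambda>\<omega>. column i (G (z \<omega>)) $ j) \<in> borel_measurable M"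
      by (rule measurable_compose[OF 1 2])
    then show ?thesis by (simp add: column_def)
  qed
  have f2: "integrable M (\<lambda>\<omega>. (f (z \<omega>) $ i)\<^sup>2)" for i
    using f_L2[of i] by (simp add: square_integrable_def)
  have G2: "integrable M (\<lambda>\<omega>. (G (z \<omega>) $ j $ i)\<^sup>2)" for i j
  proof (rule integrable_square_bound)
    show "integrable M (\<lambda>\<omega>. (norm (column i (G (z \<omega>))))\<^sup>2)"
      using grad_L2[of i] by (simp add: square_integrable_def)
    show "(G (z \<omega>) $ j $ i)\<^sup>2 \<le> (norm (column i (G (z \<omega>))))\<^sup>2" for \<omega>
      unfolding norm_vec_square
      using member_le_sum[of j UNIV "\<lambda>j. (G (z \<omega>) $ j $ i)\<^sup>2"] by (simp add: column_def)
  qed measurable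
  have fb2: "integrable ?N (\<lambda>x. (fb i x)\<^sup>2)" for i
  proof -
    have "integrable M (\<lambda>\<omega>. (fb i (z \<omega>))\<^sup>2)"
      by (rule integrable_cong_AE_imp[OF f2[of i]]) (use fz in \<open>auto elim!: eventually_mono\<close>)
    then show ?thesis using tri[of "\<lambda>x. (fb i x)\<^sup>2"] by simp
  qed
  have gb2: "integrable ?N (\<lambda>x. (gb i j x)\<^sup>2)" for i j
  proof -
    have "integrable M (\<lambda>\<omega>. (gb i j (z \<omega>))\<^sup>2)"
      by (rule integrable_cong_AE_imp[OF G2[of j i]]) (use gz in \<open>auto elim!: eventually_mono\<close>)
    then show ?thesis using tri[of "\<lambda>x. (gb i j x)\<^sup>2"] by simp
  qed
  interpret gs: gauss_sobolev fb gb
    using fbm gbm fb2 gb2 P by unfold_locales (auto simp: P_def)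
  have \<xi>_sum: "\<xi> \<omega> = (\<Sum>i\<in>UNIV. z \<omega> $ i * f (z \<omega>) $ i) - (\<Sum>i\<in>UNIV. G (z \<omega>) $ i $ i)" for \<omega>
    by (simp add: \<xi>_def inner_vec_def trace_def)
  \<comment> \<open>\<open>f\<close> and \<open>G\<close> are not assumed Borel; measurability comes
    from the assumptions on the coordinates of \<open>f (z \<omega>)\<close> and the columns of
    \<open>G (z \<omega>)\<close>.\<close>
  have \<xi>m [measurable]: "\<xi> \<in> borel_measurable M"
  proof -
    have 2: "(\<lambda>v :: real ^ 'n. v $ j) \<in> borel_measurable borel" for j
      by (intro borel_measurable_continuous_onI continuous_intros)
    show ?thesis
      unfolding \<xi>_sum[abs_def]
      by (intro borel_measurable_diff borel_measurable_sum borel_measurable_times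
          measurable_compose[OF zm 2] fm Gm)
  qed
  have \<xi>z: "AE \<omega> in M. \<xi> \<omega> = gs.\<xi> (z \<omega>)"
    using fz gz by eventually_elim (simp add: \<xi>_sum gs.\<xi>_def sum_subtractf)
  have trx: "M.expectation (\<lambda>\<omega>. h (\<xi> \<omega>) (z \<omega>)) = (\<integral>x. h (gs.\<xi> x) x \<partial>?N)"
    if "(\<lambda>\<omega>. h (\<xi> \<omega>) (z \<omega>)) \<in> borel_measurable M" "(\<lambda>x. h (gs.\<xi> x) x) \<in> borel_measurable borel"
    for h :: "real \<Rightarrow> real ^ 'n \<Rightarrow> real"
  proof -
    have "(\<lambda>\<omega>. h (gs.\<xi> (z \<omega>)) (z \<omega>)) \<in> borel_measurable M"
      by (rule measurable_compose[OF zm that(2)])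
    then have "M.expectation (\<lambda>\<omega>. h (\<xi> \<omega>) (z \<omega>)) = M.expectation (\<lambda>\<omega>. h (gs.\<xi> (z \<omega>)) (z \<omega>))"
      by (intro integral_cong_AE that(1)) (use \<xi>z in \<open>auto elim!: eventually_mono\<close>)
    then show ?thesis using tr[OF that(2)] by simp
  qed
  have \<xi>mean: "M.expectation \<xi> = 0"
    using trx[of "\<lambda>a _. a"] gs.mean_zero by simp
  have \<xi>2: "integrable M (\<lambda>\<omega>. (\<xi> \<omega>)\<^sup>2)"
  proof -
    have "integrable M (\<lambda>\<omega>. (gs.\<xi> (z \<omega>))\<^sup>2)"
      using tri[of "\<lambda>x. (gs.\<xi> x)\<^sup>2"] gs.\<xi>_L2 by simp
    then show ?thesis
      by (rule integrable_cong_AE_imp) (use \<xi>z in \<open>auto elim!: eventually_mono\<close>)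
  qed
  have V: "V = (\<integral>x. (gs.\<xi> x)\<^sup>2 \<partial>?N)"
    using trx[of "\<lambda>a _. a\<^sup>2"] by (simp add: V_def \<xi>mean)
  have VE: "V = M.expectation (\<lambda>\<omega>. (\<xi> \<omega>)\<^sup>2)"
    by (simp add: V_def \<xi>mean)
  have fi: "integrable M (\<lambda>\<omega>. f (z \<omega>))"
  proof -
    have "integrable M (\<lambda>\<omega>. \<Sum>i\<in>UNIV. (f (z \<omega>) $ i) *\<^sub>R (axis i 1 :: real ^ 'n))"
      by (intro Bochner_Integration.integrable_sum integrable_scaleR_left)
         (rule M.square_integrable_imp_integrable[OF fm f2])
    then show ?thesis
      using basis_expansion[of "f (z _)"] by (simp add: scalar_mult_eq_scaleR)
  qed
  have m: "m $ i = (\<integral>x. fb i x \<partial>?N)" for i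
  proof -
    have "m $ i = M.expectation (\<lambda>\<omega>. f (z \<omega>) $ i)"
      unfolding m_def using integral_bounded_linear[OF bounded_linear_vec_nth fi] by simp
    also have "\<dots> = M.expectation (\<lambda>\<omega>. fb i (z \<omega>))"
      by (rule integral_cong_AE) (use fz in \<open>auto elim!: eventually_mono\<close>)
    finally show ?thesis using tr[OF fbm] by simp
  qed
  have F: "M.expectation (\<lambda>\<omega>. (norm (f (z \<omega>)))\<^sup>2) = (\<Sum>i\<in>UNIV. \<integral>x. (fb i x)\<^sup>2 \<partial>?N)"
  proof -
    have "M.expectation (\<lambda>\<omega>. (norm (f (z \<omega>)))\<^sup>2) = M.expectation (\<lambda>\<omega>. \<Sum>i\<in>UNIV. (fb i (z \<omega>))\<^sup>2)"
      unfolding norm_vec_square by (rule integral_cong_AE) (use fz in \<open>auto elim!: eventually_mono\<close>)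
    also have "\<dots> = (\<integral>x. (\<Sum>i\<in>UNIV. (fb i x)\<^sup>2) \<partial>?N)"
      by (rule tr) measurable
    also have "\<dots> = (\<Sum>i\<in>UNIV. \<integral>x. (fb i x)\<^sup>2 \<partial>?N)"
      by (rule Bochner_Integration.integral_sum) (rule fb2)
    finally show ?thesis .
  qed
  have ggi: "integrable ?N (\<lambda>x. gb i j x * gb j i x)" for i j
    by (intro L2_mult_integrable gb2; measurable)
  \<comment> \<open>The expected trace of the squared gradient matrix.\<close>
  define T where "T = (\<Sum>i\<in>UNIV. \<Sum>j\<in>UNIV. \<integral>x. gb i j x * gb j i x \<partial>?N)"
  have D: "D = (\<Sum>i\<in>UNIV. \<Sum>j\<in>UNIV. \<integral>x. (gb i j x)\<^sup>2 \<partial>?N)"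
  proof -
    have "D = M.expectation (\<lambda>\<omega>. \<Sum>i\<in>UNIV. \<Sum>j\<in>UNIV. (gb j i (z \<omega>))\<^sup>2)"
      unfolding D_def norm_matrix_square
      by (rule integral_cong_AE) (use gz in \<open>auto elim!: eventually_mono\<close>)
    also have "\<dots> = (\<integral>x. (\<Sum>i\<in>UNIV. \<Sum>j\<in>UNIV. (gb j i x)\<^sup>2) \<partial>?N)"
      by (rule tr) measurable
    also have "\<dots> = (\<Sum>i\<in>UNIV. \<Sum>j\<in>UNIV. \<integral>x. (gb j i x)\<^sup>2 \<partial>?N)"
      by (simp only: Bochner_Integration.integral_sum Bochner_Integration.integrable_sum gb2)
    finally show ?thesis by (subst sum.swap)
  qed
  have S: "2 * S = D + T"
  proof -
    have "2 * S = M.expectation (\<lambda>\<omega>. 2 * (norm (sym_part (G (z \<omega>))))\<^sup>2)"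
      by (simp add: S_def)
    also have "\<dots> = M.expectation (\<lambda>\<omega>. (\<Sum>i\<in>UNIV. \<Sum>j\<in>UNIV. (gb j i (z \<omega>))\<^sup>2) +
        (\<Sum>i\<in>UNIV. \<Sum>j\<in>UNIV. gb j i (z \<omega>) * gb i j (z \<omega>)))"
      unfolding norm_sym_part_square
      by (rule integral_cong_AE) (use gz in \<open>auto elim!: eventually_mono\<close>)
    also have "\<dots> = (\<integral>x. (\<Sum>i\<in>UNIV. \<Sum>j\<in>UNIV. (gb j i x)\<^sup>2) + (\<Sum>i\<in>UNIV. \<Sum>j\<in>UNIV. gb j i x * gb i j x) \<partial>?N)"
      by (rule tr) measurable
    also have "\<dots> = (\<Sum>i\<in>UNIV. \<Sum>j\<in>UNIV. \<integral>x. (gb j i x)\<^sup>2 \<partial>?N) +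
        (\<Sum>i\<in>UNIV. \<Sum>j\<in>UNIV. \<integral>x. gb j i x * gb i j x \<partial>?N)"
      by (simp only: Bochner_Integration.integral_add Bochner_Integration.integral_sum
          Bochner_Integration.integrable_sum gb2 ggi)
    also have "(\<Sum>i\<in>UNIV. \<Sum>j\<in>UNIV. \<integral>x. (gb j i x)\<^sup>2 \<partial>?N) = D"
      unfolding D by (rule sum.swap)
    also have "(\<Sum>i\<in>UNIV. \<Sum>j\<in>UNIV. \<integral>x. gb j i x * gb i j x \<partial>?N) = T"
      unfolding T_def by (rule sum.swap)
    finally show ?thesis .
  qed
  \<comment> \<open>From 2 a b \<le> a^2 + b^2 for each pair of transposed entries; it gives 2 S
    \<le> 2 D.\<close>
  have TD: "T \<le> D"
  proof -
    have "2 * (\<integral>x. gb i j x * gb j i x \<partial>?N) \<le> (\<integral>x. (gb i j x)\<^sup>2 \<partial>?N) + (\<integral>x. (gb j i x)\<^sup>2 \<partial>?N)" for i j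
    proof -
      have "0 \<le> (\<integral>x. (gb i j x - gb j i x)\<^sup>2 \<partial>?N)"
        by (intro integral_nonneg_AE) auto
      also have "\<dots> = (\<integral>x. (gb i j x)\<^sup>2 + (gb j i x)\<^sup>2 - 2 * (gb i j x * gb j i x) \<partial>?N)"
        by (simp add: power2_diff mult.assoc)
      finally show ?thesis using gb2 ggi by simp
    qed
    then have "(\<Sum>i\<in>UNIV. \<Sum>j\<in>UNIV. 2 * (\<integral>x. gb i j x * gb j i x \<partial>?N)) \<le>
        (\<Sum>i\<in>UNIV. \<Sum>j\<in>UNIV. (\<integral>x. (gb i j x)\<^sup>2 \<partial>?N) + (\<integral>x. (gb j i x)\<^sup>2 \<partial>?N))"
      by (intro sum_mono)
    also have "\<dots> = D + (\<Sum>i\<in>UNIV. \<Sum>j\<in>UNIV. \<integral>x. (gb j i x)\<^sup>2 \<partial>?N)"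
      by (simp only: sum.distrib D)
    also have "(\<Sum>i\<in>UNIV. \<Sum>j\<in>UNIV. \<integral>x. (gb j i x)\<^sup>2 \<partial>?N) = D"
      unfolding D by (rule sum.swap)
    also have "(\<Sum>i\<in>UNIV. \<Sum>j\<in>UNIV. 2 * (\<integral>x. gb i j x * gb j i x \<partial>?N)) = 2 * T"
      by (simp only: T_def sum_distrib_left)
    finally show ?thesis by simp
  qed
  let ?F = "M.expectation (\<lambda>\<omega>. (norm (f (z \<omega>)))\<^sup>2)"
  have FD: "?F \<le> (norm m)\<^sup>2 + D"
  proof -
    have "(\<Sum>i\<in>UNIV. (\<integral>x. (fb i x)\<^sup>2 \<partial>?N) - (m $ i)\<^sup>2) \<le> D"
      unfolding D m by (intro sum_mono gs.poincare)
    then show ?thesis unfolding F by (simp add: norm_vec_square sum_subtractf)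
  qed
  \<comment> \<open>V is at most E |f(z)|^2 + T, Poincare bounds this by |m|^2 + D + T, and D + T =
    2 S.\<close>
  have VS: "V \<le> (norm m)\<^sup>2 + 2 * S"
    using gs.second_moment_le FD unfolding V S F T_def[symmetric] by simp
  have m0: "m \<noteq> 0" using mean_nz by (simp add: m_def)
  then have nm: "0 < norm m" by simp
  have dZ: "distributed M lborel Z (\<lambda>x. ennreal (std_normal_density x))"
    unfolding distributed_def
  proof (intro conjI)
    have "distr M lborel Z = distr (distr M borel z) lborel (\<lambda>x. (x \<bullet> m) / norm m)"
      unfolding Z_def by (subst distr_distr) (auto simp: o_def)
    also have "\<dots> = density lborel (\<lambda>x. ennreal (std_normal_density x))"
      using distributed_gauss_linear[OF m0] by (simp add: dz distributed_def)
    finally show "distr M lborel Z = density lborel (\<lambda>x. ennreal (std_normal_density x))" .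
  qed (auto simp: Z_def)
  have Zm [measurable]: "Z \<in> borel_measurable M"
    using dZ by (simp add: distributed_def)
  have Z2: "integrable M (\<lambda>\<omega>. (Z \<omega>)\<^sup>2)"
    using distributed_integrable[OF dZ, of "\<lambda>x. x\<^sup>2"] integrable_std_normal_moment[of 2] by simp
  have EZ2: "M.expectation (\<lambda>\<omega>. (Z \<omega>)\<^sup>2) = 1"
    using M.standard_normal_distributed_variance[OF dZ] M.standard_normal_distributed_expectation[OF dZ]
    by simp
  have \<xi>Z: "M.expectation (\<lambda>\<omega>. \<xi> \<omega> * Z \<omega>) = norm m"
  proof -
    have xi: "integrable ?N (\<lambda>x. gs.\<xi> x * x $ l)" for l
      by (intro L2_mult_integrable gs.\<xi>_L2 gauss_coord_power_integrable; measurable)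
    have "M.expectation (\<lambda>\<omega>. \<xi> \<omega> * Z \<omega>) = (\<integral>x. gs.\<xi> x * ((x \<bullet> m) / norm m) \<partial>?N)"
      unfolding Z_def by (rule trx[of "\<lambda>a x. a * ((x \<bullet> m) / norm m)"]) measurable
    also have "\<dots> = (\<integral>x. (\<Sum>l\<in>UNIV. (gs.\<xi> x * x $ l) * (m $ l / norm m)) \<partial>?N)"
      by (intro Bochner_Integration.integral_cong)
         (auto simp: inner_vec_def sum_divide_distrib sum_distrib_left mult.assoc)
    also have "\<dots> = (\<Sum>l\<in>UNIV. \<integral>x. (gs.\<xi> x * x $ l) * (m $ l / norm m) \<partial>?N)"
      by (rule Bochner_Integration.integral_sum) (intro integrable_mult_left xi)
    also have "\<dots> = (\<Sum>l\<in>UNIV. (m $ l) * (m $ l / norm m))"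
      by (simp add: gs.mean_coord m[symmetric] del: times_divide_eq_right)
    also have "\<dots> = (norm m)\<^sup>2 / norm m"
      unfolding norm_vec_square sum_divide_distrib by (simp add: power2_eq_square)
    finally show ?thesis using nm by (simp add: power2_eq_square)
  qed
  \<comment> \<open>Cauchy-Schwarz with E[\<xi> Z] = norm m and E[Z^2] = 1. Since m is nonzero, this
    also makes \<open>V\<close> positive.\<close>
  have mV: "(norm m)\<^sup>2 \<le> V"
    using L2_cauchy_schwarz[OF \<xi>m Zm \<xi>2 Z2] by (simp add: \<xi>Z EZ2 VE)
  then have V0: "0 < V"
    using nm zero_less_power[of "norm m" 2] by linarith
  have e01: "0 \<le> eps_sq" "eps_sq \<le> 1"
    using mV V0 by (auto simp: eps_sq_def field_simps)
  have \<xi>Zi: "integrable M (\<lambda>\<omega>. \<xi> \<omega> * Z \<omega>)"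
    by (rule L2_mult_integrable[OF \<xi>m Zm \<xi>2 Z2])
  have expand: "(\<xi> \<omega> / sqrt V - Z \<omega>)\<^sup>2 = (\<xi> \<omega>)\<^sup>2 / V - (2 / sqrt V) * (\<xi> \<omega> * Z \<omega>) + (Z \<omega>)\<^sup>2" for \<omega>
    using V0 by (simp add: power2_diff power_divide)
  have di: "integrable M (\<lambda>\<omega>. (\<xi> \<omega> / sqrt V - Z \<omega>)\<^sup>2)"
    unfolding expand using \<xi>2 Z2 \<xi>Zi by simp
  have s: "sqrt (1 - eps_sq) = norm m / sqrt V"
    by (simp add: eps_sq_def real_sqrt_divide)
  have W: "M.expectation (\<lambda>\<omega>. (\<xi> \<omega> / sqrt V - Z \<omega>)\<^sup>2) = eps_sq + (1 - sqrt (1 - eps_sq))\<^sup>2"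
  proof -
    have "M.expectation (\<lambda>\<omega>. (\<xi> \<omega> / sqrt V - Z \<omega>)\<^sup>2) = V / V - (2 / sqrt V) * norm m + 1"
      unfolding expand using \<xi>2 Z2 \<xi>Zi by (simp add: \<xi>Z EZ2 VE[symmetric])
    also have "\<dots> = 2 - 2 * sqrt (1 - eps_sq)"
      using V0 by (simp add: s)
    \<comment> \<open>With s = sqrt (1 - eps_sq) this is 2 - 2 s = (1 - s^2) + (1 - s)^2.\<close>
    also have "\<dots> = eps_sq + (1 - sqrt (1 - eps_sq))\<^sup>2"
      using e01 by (simp add: power2_diff)
    finally show ?thesis .
  qed
  obtain c\<^sub>1 where c1: "c\<^sub>1 \<in> {1 / 4..1}" "(1 - sqrt (1 - eps_sq))\<^sup>2 = c\<^sub>1 * eps_sq\<^sup>2"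
    using one_minus_sqrt_square[OF e01] by blast
  have F0: "(norm m)\<^sup>2 > 0" using nm by simp
  have S0: "0 \<le> S" unfolding S_def by (intro integral_nonneg_AE) auto
  have eb: "eps_sq \<le> epsbar_sq"
  proof -
    \<comment> \<open>In this form \<open>epsbar_sq\<close> is \<open>eps_sq\<close> with
      \<open>V\<close> replaced by its upper bound.\<close>
    have "epsbar_sq = 1 - (norm m)\<^sup>2 / ((norm m)\<^sup>2 + 2 * S)"
    proof -
      have "b / (a + b) = 1 - a / (a + b)" if "a + b \<noteq> 0" for a b :: real
        using that by (simp add: field_simps)
      from this[of "(norm m)\<^sup>2" "2 * S"] show ?thesis
        using F0 S0 by (simp add: epsbar_sq_def)
    qed
    moreover have "(norm m)\<^sup>2 / ((norm m)\<^sup>2 + 2 * S) \<le> (norm m)\<^sup>2 / V"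
      using VS V0 by (intro divide_left_mono) (auto intro!: mult_pos_pos simp: less_le_trans[OF V0 VS])
    ultimately show ?thesis by (simp add: eps_sq_def)
  qed
  have bD: "epsbar_sq \<le> 2 * D / (?F + D)"
  proof -
    \<comment> \<open>First x / (|m|^2 + x) increases from x = 2 S to x = 2 D; then Poincare in the
      form E |f(z)|^2 \<le> |m|^2 + D lowers the denominator.\<close>
    have "epsbar_sq \<le> 2 * D / ((norm m)\<^sup>2 + 2 * D)"
      unfolding epsbar_sq_def by (rule frac_mono) (use F0 S0 S TD in auto)
    also have "\<dots> \<le> 2 * D / (?F + D)"
    \<comment> \<open>For D = 0 both numerators vanish; otherwise D > 0 makes both denominators
      positive.\<close>
    proof (cases "D = 0")
      case False
      have "0 \<le> D" unfolding D_def by (intro integral_nonneg_AE) auto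
      moreover have "0 \<le> ?F" by (intro integral_nonneg_AE) auto
      ultimately show ?thesis
        using FD F0 False by (intro divide_left_mono mult_pos_pos) (auto intro: add_nonneg_pos add_pos_nonneg)
    qed simp
    finally show ?thesis .
  qed
  have K: "(\<Squnion>t::real. \<bar>M.prob {\<omega> \<in> space M. \<xi> \<omega> / sqrt V \<le> t} - M.prob {\<omega> \<in> space M. Z \<omega> \<le> t}\<bar>)
      \<le> C * (eps_sq + c\<^sub>1 * eps_sq\<^sup>2) powr (1 / 3)"
    using M.kolmogorov_distance_sup_le[OF _ dZ di] by (simp add: W c1(2) C_def)
  show ?thesis
    using \<xi>m \<xi>2 V0 e01 dZ c1 W eb bD K
    by (intro conjI bexI[of _ c\<^sub>1]) (simp_all add: square_integrable_def)
qed

end
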